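(* For every integer $n\ge 1$ the following identities hold in $U_q^+(w)$: \begin{align*} B[n,0,0,n-1]&=q^{n-1}u_3B[n-1,0,0,n-1]-q^{2n-1}u_2B[n-1,0,1,n-2]\\ &=q^{3n-3}B[n-1,0,0,n-1]u_3-q^{2n-3}B[n-1,0,1,n-2]u_2,\\[0.5em] B[n-1,0,0,n]&=q^{n-1}B[n-1,0,0,n-1]u_0-q^{2n-1}B[n-2,1,0,n-1]u_1\\ &=q^{3n-3}u_0B[n-1,0,0,n-1]-q^{2n-3}u_1B[n-2,1,0,n-1],\\[0.5em] B[n,0,0,n]&=q^{n-1}B[n,0,0,n-1]u_0-q^{2n}B[n-1,1,0,n-1]u_1\\ &=q^{3n-1}u_0B[n,0,0,n-1]-q^{2n-2}u_1B[n-1,1,0,n-1]\\ &=q^{n-1}u_3B[n-1,0,0,n]-q^{2n}u_2B[n-1,0,1,n-1]\\ &=q^{3n-1}B[n-1,0,0,n]u_3-q^{2n-2}B[n-1,0,1,n-1]u_2. \end{align*}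
   Context: Let $q$ be an indeterminate. For $k\in\mathbb Z$ let $[k]=\frac{q^k-q^{-k}}{q-q^{-1}}$, $[k]!=[k]\cdots[1]$ for $k\in\mathbb N$. Let $(a_{ij})=\begin{pmatrix}2&-2\\-2&2\end{pmatrix}$ and let $U_q(\mathfrak g)$ be the $\mathbb Q(q)$-algebra generated by $E_i,F_i,K_i^{\pm1}$ ($i=1,2$) with relations $K_1K_2=K_2K_1$, $K_iK_i^{-1}=K_i^{-1}K_i=1$, $K_iE_jK_i^{-1}=q^{a_{ij}}E_j$, $K_iF_jK_i^{-1}=q^{-a_{ij}}F_j$, $E_iF_j-F_jE_i=\delta_{ij}\frac{K_i-K_i^{-1}}{q-q^{-1}}$, and, for $\{i,j\}=\{1,2\}$, $E_i^3E_j-[3]E_i^2E_jE_i+[3]E_iE_jE_i^2-E_jE_i^3=0$ and the same with $F$ in place of $E$. Put $E_i^{(k)}=E_i^k/[k]!$, $F_i^{(k)}=F_i^k/[k]!$. Let $T_i$ ($i=1,2$) be Lusztig's automorphism of $U_q(\mathfrak g)$ with $T_i(E_i)=-K_i^{-1}F_i$, $T_i(F_i)=-E_iK_i$, $T_i(E_j)=\sum_{r+s=2}(-1)^rq^{-r}E_i^{(r)}E_jE_i^{(s)}$, $T_i(F_j)=\sum_{r+s=2}(-1)^rq^rF_i^{(s)}F_jF_i^{(r)}$ ($j\neq i$), $T_i(K_j)=K_jK_i^{-a_{ij}}$. Let $v_0=E_1$, $v_1=T_1(E_2)$, $v_2=T_1T_2(E_1)$, $v_3=T_1T_2T_1(E_2)$,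 and $w=s_1s_2s_1s_2$. By Lusztig, the elements $v_3^{(a_3)}v_2^{(a_2)}v_1^{(a_1)}v_0^{(a_0)}$ ($(a_3,a_2,a_1,a_0)\in\mathbb N^4$, with $x^{(k)}=x^k/[k]!$) form a $\mathbb Q(q)$-basis of a subalgebra $U_q^+(w)$ of $U_q(\mathfrak g)$. Put $u_i=(1-q^{-2})^{-2i}v_i$ for $i=0,1,2,3$. For $\mathbf a=(a_3,a_2,a_1,a_0)\in\mathbb N^4$ let $b(\mathbf a)=\sum_{i}\binom{a_i}{2}$, $E[\mathbf a]=q^{b(\mathbf a)}u_3^{a_3}u_2^{a_2}u_1^{a_1}u_0^{a_0}$ (the dual PBW basis), and $N(\mathbf a)=(a_3+a_2+a_1+a_0)^2-7a_3-5a_2-3a_1-a_0$. Write $\mathbf a\lhd\mathbf b$ iff $\mathbf b-\mathbf a\in\mathbb N(-1,2,-1,0)+\mathbb N(0,-1,2,-1)$, and $S(\mathbf a)=\{\mathbf b\in\mathbb N^4:\mathbf a\lhd\mathbf b,\ \mathbf b\ne\mathbf a\}$. Let $\sigma$ be the ring anti-automorphism of $U_q^+(w)$ with $\sigma(q)=q^{-1}$ (i.e. $\sigma(f(q)x)=f(q^{-1})\sigma(x)$) and $\sigma(u_i)=q^{2i}u_i$. The dual canonical basis $\{B[\mathbf a]:\mathbf a\in\mathbb N^4\}$ of $U_q^+(w)$ is the unique basis such that for all $\mathbf a$: $B[\mathbf a]-E[\mathbf a]\in\bigoplus_{\mathbf b\in S(\mathbf a)}q\mathbb Z[q]E[\mathbf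 b]$ and $\sigma(B[\mathbf a])=q^{-N(\mathbf a)}B[\mathbf a]$. Convention: $B[\mathbf a]=0$ if $\mathbf a\in\mathbb Z^4$ has a negative entry. *)

theory Defs
  imports "HOL-Computational_Algebra.Fraction_Field" "HOL-Computational_Algebra.Polynomial"
begin

type_synonym fq = "rat poly fract"

definition qq :: fq where "qq = Fraction_Field.Fract [:0, 1:] 1"

definition qpow :: "int \<Rightarrow> fq" where "qpow k = qq powi k"

definition qint :: "int \<Rightarrow> fq" where
  "qint k = (qpow k - qpow (- k)) / (qq - inverse qq)"

definition qfact :: "nat \<Rightarrow> fq" where
  "qfact k = (\<Prod>i = 1..k. qint (int i))"

definition evq :: "int poly \<Rightarrow> fq \<Rightarrow> fq" where
  "evq p x = poly (map_poly of_int p) x"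

datatype idx = I1 | I2

definition cartan :: "idx \<Rightarrow> idx \<Rightarrow> int" where
  "cartan i j = (if i = j then 2 else -2)"

datatype gen = GE idx | GF idx | GK idx | GKi idx

datatype expr = Gen gen | Sc fq | Add expr expr (infixl "\<oplus>" 65) | Mul expr expr (infixl "\<odot>" 70)

definition eE :: "idx \<Rightarrow> expr" where "eE i = Gen (GE i)"
definition eF :: "idx \<Rightarrow> expr" where "eF i = Gen (GF i)"
definition eK :: "idx \<Rightarrow> expr" where "eK i = Gen (GK i)"
definition eKi :: "idx \<Rightarrow> expr" where "eKi i = Gen (GKi i)"

definition esub :: "expr \<Rightarrow> expr \<Rightarrow> expr" where "esub x y = x \<oplus> Sc (-1) \<odot> y"

fun epow :: "expr \<Rightarrow> nat \<Rightarrow> expr" where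
  "epow x 0 = Sc 1"
| "epow x (Suc k) = x \<odot> epow x k"

definition esum :: "expr list \<Rightarrow> expr" where "esum xs = foldr Add xs (Sc 0)"

definition dpow :: "expr \<Rightarrow> nat \<Rightarrow> expr" where
  "dpow x k = Sc (inverse (qfact k)) \<odot> epow x k"

definition serre :: "expr \<Rightarrow> expr \<Rightarrow> expr" where
  "serre x y = esum [epow x 3 \<odot> y, Sc (- qint 3) \<odot> epow x 2 \<odot> y \<odot> x,
                     Sc (qint 3) \<odot> x \<odot> y \<odot> epow x 2, Sc (-1) \<odot> y \<odot> epow x 3]"

text \<open>Smallest congruence making the expression algebra a Q(q)-algebra
  (with central scalars) and imposing the defining relations of \<open>U_q(g)\<close>.\<close>
inductive ueq :: "expr \<Rightarrow> expr \<Rightarrow> bool" where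
  refl: "ueq x x"
| sym: "ueq x y \<Longrightarrow> ueq y x"
| trans: "ueq x y \<Longrightarrow> ueq y z \<Longrightarrow> ueq x z"
| addc: "ueq x y \<Longrightarrow> ueq z w \<Longrightarrow> ueq (x \<oplus> z) (y \<oplus> w)"
| mulc: "ueq x y \<Longrightarrow> ueq z w \<Longrightarrow> ueq (x \<odot> z) (y \<odot> w)"
| add_assoc: "ueq (x \<oplus> y \<oplus> z) (x \<oplus> (y \<oplus> z))"
| add_comm: "ueq (x \<oplus> y) (y \<oplus> x)"
| add_zero: "ueq (Sc 0 \<oplus> x) x"
| mul_assoc: "ueq (x \<odot> y \<odot> z) (x \<odot> (y \<odot> z))"
| mul_one_l: "ueq (Sc 1 \<odot> x) x"
| mul_one_r: "ueq (x \<odot> Sc 1) x"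
| distl: "ueq (x \<odot> (y \<oplus> z)) (x \<odot> y \<oplus> x \<odot> z)"
| distr: "ueq ((x \<oplus> y) \<odot> z) (x \<odot> z \<oplus> y \<odot> z)"
| sc_add: "ueq (Sc a \<oplus> Sc b) (Sc (a + b))"
| sc_mul: "ueq (Sc a \<odot> Sc b) (Sc (a * b))"
| sc_central: "ueq (Sc a \<odot> x) (x \<odot> Sc a)"
| sc_zero: "ueq (Sc 0 \<odot> x) (Sc 0)"
| rel_KK: "ueq (eK I1 \<odot> eK I2) (eK I2 \<odot> eK I1)"
| rel_Kinv1: "ueq (eK i \<odot> eKi i) (Sc 1)"
| rel_Kinv2: "ueq (eKi i \<odot> eK i) (Sc 1)"
| rel_KE: "ueq (eK i \<odot> eE j \<odot> eKi i) (Sc (qpow (cartan i j)) \<odot> eE j)"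
| rel_KF: "ueq (eK i \<odot> eF j \<odot> eKi i) (Sc (qpow (- cartan i j)) \<odot> eF j)"
| rel_EF: "ueq (esub (eE i \<odot> eF j) (eF j \<odot> eE i))
             (if i = j then Sc (inverse (qq - inverse qq)) \<odot> esub (eK i) (eKi i) else Sc 0)"
| rel_serreE: "i \<noteq> j \<Longrightarrow> ueq (serre (eE i) (eE j)) (Sc 0)"
| rel_serreF: "i \<noteq> j \<Longrightarrow> ueq (serre (eF i) (eF j)) (Sc 0)"

lemma ueq_equivp: "equivp ueq"
  by (intro equivpI reflpI sympI transpI) (auto intro: ueq.intros)

quotient_type U = expr / ueq
  by (rule ueq_equivp)

lemmas [trans] = ueq.trans

instantiation U :: ring
begin
lift_definition zero_U :: U is "Sc 0" .
lift_definition plus_U :: "U \<Rightarrow> U \<Rightarrow> U" is Add by (rule ueq.addc)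
lift_definition times_U :: "U \<Rightarrow> U \<Rightarrow> U" is Mul by (rule ueq.mulc)
lift_definition uminus_U :: "U \<Rightarrow> U" is "\<lambda>x. Sc (-1) \<odot> x" by (auto intro: ueq.intros)
lift_definition minus_U :: "U \<Rightarrow> U \<Rightarrow> U" is "\<lambda>x y. x \<oplus> Sc (-1) \<odot> y" by (auto intro: ueq.intros)
instance
proof
  fix a b c :: U
  show "a + b + c = a + (b + c)" by transfer (rule ueq.add_assoc)
  show "a + b = b + a" by transfer (rule ueq.add_comm)
  show "0 + a = a" by transfer (rule ueq.add_zero)
  show "a * b * c = a * (b * c)" by transfer (rule ueq.mul_assoc)
  show "(a + b) * c = a * c + b * c" by transfer (rule ueq.distr)
  show "a * (b + c) = a * b + a * c" by transfer (rule ueq.distl)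
  show "a - b = a + - b" by transfer (rule ueq.refl)
  show "- a + a = 0"
  proof transfer
    fix a
    have "ueq (Sc (-1) \<odot> a \<oplus> a) (Sc (-1) \<odot> a \<oplus> Sc 1 \<odot> a)"
      by (auto intro: ueq.intros)
    also have "ueq \<dots> ((Sc (-1) \<oplus> Sc 1) \<odot> a)" by (rule ueq.sym, rule ueq.distr)
    also have "ueq \<dots> (Sc 0 \<odot> a)" using ueq.sc_add[of "-1" 1]
      by (auto intro: ueq.intros)
    also have "ueq \<dots> (Sc 0)" by (rule ueq.sc_zero)
    finally show "ueq (Sc (-1) \<odot> a \<oplus> a) (Sc 0)" .
  qed
qed
end

instantiation U :: monoid_mult
begin
lift_definition one_U :: U is "Sc 1" .
instance
proof
  fix a b c :: U
  show "1 * a = a" by transfer (rule ueq.mul_one_l)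
  show "a * 1 = a" by transfer (rule ueq.mul_one_r)
qed
end

lift_definition sc :: "fq \<Rightarrow> U" is Sc .

section \<open>Lusztig's automorphisms \<open>T_i\<close> (on generators, extended multiplicatively)\<close>

definition kpow :: "idx \<Rightarrow> int \<Rightarrow> expr" where
  "kpow i k = (if k \<ge> 0 then epow (eK i) (nat k) else epow (eKi i) (nat (- k)))"

fun Tgen :: "idx \<Rightarrow> gen \<Rightarrow> expr" where
  "Tgen i (GE j) = (if j = i then Sc (-1) \<odot> eKi i \<odot> eF i
     else esum (map (\<lambda>r. Sc ((-1) ^ r * qpow (- int r)) \<odot> dpow (eE i) r \<odot> eE j \<odot> dpow (eE i) (2 - r)) [0..<3]))"
| "Tgen i (GF j) = (if j = i then Sc (-1) \<odot> eE i \<odot> eK i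
     else esum (map (\<lambda>r. Sc ((-1) ^ r * qpow (int r)) \<odot> dpow (eF i) (2 - r) \<odot> eF j \<odot> dpow (eF i) r) [0..<3]))"
| "Tgen i (GK j) = eK j \<odot> kpow i (- cartan i j)"
| "Tgen i (GKi j) = kpow i (cartan i j) \<odot> eKi j"

fun Tx :: "idx \<Rightarrow> expr \<Rightarrow> expr" where
  "Tx i (Gen g) = Tgen i g"
| "Tx i (Sc c) = Sc c"
| "Tx i (x \<oplus> y) = Tx i x \<oplus> Tx i y"
| "Tx i (x \<odot> y) = Tx i x \<odot> Tx i y"

definition vexpr :: "nat \<Rightarrow> expr" where
  "vexpr i = (if i = 0 then eE I1
     else if i = 1 then Tx I1 (eE I2)
     else if i = 2 then Tx I1 (Tx I2 (eE I1))
     else Tx I1 (Tx I2 (Tx I1 (eE I2))))"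

definition v :: "nat \<Rightarrow> U" where "v i = abs_U (vexpr i)"

definition u :: "nat \<Rightarrow> U" where
  "u i = sc ((1 - qpow (-2)) powi (- 2 * int i)) * v i"

text \<open>index quadruples are written \<open>(a3, a2, a1, a0)\<close>\<close>
type_synonym nat4 = "nat \<times> nat \<times> nat \<times> nat"

fun bb :: "nat4 \<Rightarrow> int" where
  "bb (a3, a2, a1, a0) = int (a3 choose 2) + int (a2 choose 2) + int (a1 choose 2) + int (a0 choose 2)"

fun Nf :: "nat4 \<Rightarrow> int" where
  "Nf (a3, a2, a1, a0) = (int a3 + int a2 + int a1 + int a0)^2 - 7 * int a3 - 5 * int a2 - 3 * int a1 - int a0"

fun Epbw :: "nat4 \<Rightarrow> U" where
  "Epbw (a3, a2, a1, a0) = sc (qpow (bb (a3, a2, a1, a0))) * u 3 ^ a3 * u 2 ^ a2 * u 1 ^ a1 * u 0 ^ a0"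

text \<open>\<open>\<sigma>(E[a])\<close>, computed from \<open>\<sigma>(q)=q^-1\<close>, \<open>\<sigma>(u_i)=q^(2i) u_i\<close> and anti-multiplicativity\<close>
fun sigE :: "nat4 \<Rightarrow> U" where
  "sigE (a3, a2, a1, a0) = sc (qpow (- bb (a3, a2, a1, a0) + 2 * int a1 + 4 * int a2 + 6 * int a3))
      * u 0 ^ a0 * u 1 ^ a1 * u 2 ^ a2 * u 3 ^ a3"

fun tri :: "nat4 \<Rightarrow> nat4 \<Rightarrow> bool" where
  "tri (a3, a2, a1, a0) (b3, b2, b1, b0) \<longleftrightarrow> (\<exists>m k :: nat.
     int b3 = int a3 - int m \<and> int b2 = int a2 + 2 * int m - int k \<and>
     int b1 = int a1 - int m + 2 * int k \<and> int b0 = int a0 - int k)"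

definition Sset :: "nat4 \<Rightarrow> nat4 set" where
  "Sset a = {b. tri a b \<and> b \<noteq> a}"

text \<open>\<open>X\<close> satisfies the two defining conditions of the dual canonical basis element \<open>B[a]\<close>:
  \<open>X - E[a] \<in> \<Oplus>_{b\<in>S(a)} qZ[q] E[b]\<close> and \<open>\<sigma>(X) = q^(-N(a)) X\<close>
  (with \<open>\<sigma>\<close> applied termwise to the expansion).\<close>
definition is_dcb :: "nat4 \<Rightarrow> U \<Rightarrow> bool" where
  "is_dcb a X \<longleftrightarrow> (\<exists>c :: nat4 \<Rightarrow> int poly.
      (\<forall>b \<in> Sset a. coeff (c b) 0 = 0) \<and>
      X = Epbw a + (\<Sum>b \<in> Sset a. sc (evq (c b) qq) * Epbw b) \<and>
      sigE a + (\<Sum>b \<in> Sset a. sc (evq (c b) (inverse qq)) * sigE b) = sc (qpow (- Nf a)) * X)"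

definition B :: "int \<times> int \<times> int \<times> int \<Rightarrow> U" where
  "B a = (case a of (a3, a2, a1, a0) \<Rightarrow>
     if a3 < 0 \<or> a2 < 0 \<or> a1 < 0 \<or> a0 < 0 then 0
     else (THE X. is_dcb (nat a3, nat a2, nat a1, nat a0) X))"

end

(* Let y = E_2 E_1 - q^(-2) E_1 E_2 be the imaginary root vector. Since T_1 T_2 fixes y, one has
   [2] v_(k+1) = [y, v_k], so all straightening relations among the u_i follow from the Serre relations
   by applying the derivation [y, -] and, because that alone does not produce the relation
   v_2 v_1 = q^2 v_1 v_2, also [y_2, -] for the next imaginary root vector y_2, which commutes with y.

   The elements P = B[1,0,1,0] and p = B[0,1,0,1] commute with every u_i up to powers of q, and up to a
   power of q the element B[n,0,0,n] is the n-th Chebyshev-like polynomial W in z = B[1,0,0,1] and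
   c = p P. Every other element of the theorem is a combination of such polynomials with P, p and the u_i,
   and the identities reduce to the recursion for W and to relations of small degree. The
   recursions also preserve the lattice spanned by the q^k E[b], k > 0. Doing the same computation
   in the ring of pairs (x, sigma x) yields the condition on sigma.

   Uniqueness of the dual canonical basis elements needs the linear independence of the PBW monomials of
   a given weight. It is read off from a tensor product of two evaluation representations, in which
   u_0 and u_1 have their leading terms in the first factor, u_2 and u_3 in the second. *)

theory Submission
  imports Defs
begin

text \<open>The T_i act on formal expressions, so images are computed through maps from expressions
  to \<open>U\<close> that are additive, multiplicative and fix scalars. For such a map the image of
  T_i(E_j), with i and j distinct, is a nested q-commutator. The equation T_1 T_2 (y) = y is a
  direct computation with the images of E_1 and E_2; this is where the F_i and K_i enter. The
  ring-theoretic part asks of the scalars only a central family q^k. It can therefore be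
  instantiated in \<open>U\<close>, in the opposite ring with the four generators in reverse order,
  which yields the mirror half of all formulas, and in the ring of pairs, where q becomes the
  central element (q, q^-1). The price is that integer coefficients appear as repeated summands and
  divisions as cancellation hypotheses. Triangularity is controlled through left multiplication on
  the E[b] by x_3, x_2 and P, where the result is explicit. Right multiplications are covered by the
  mirror symmetry.\<close>

locale central_powers =
  fixes Q :: "int \<Rightarrow> 'a :: {ring, monoid_mult}"
  assumes Q_add: "Q (j + k) = Q j * Q k"
    and Q_zero: "Q 0 = 1"
    and Q_central: "x * Q k = Q k * x"
begin

definition S :: "int \<Rightarrow> 'a \<Rightarrow> 'a" where "S k x = Q k * x"

lemma S_add: "S k (x + y) = S k x + S k y"
  and S_diff: "S k (x - y) = S k x - S k y"
  and S_minus: "S k (- x) = - S k x"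
  and S_zero: "S k 0 = 0"
  and S_0: "S 0 x = x"
  and S_S: "S j (S k x) = S (j + k) x"
  and S_mult_left: "S k x * y = S k (x * y)"
  by (simp_all add: S_def algebra_simps Q_zero Q_add)

lemma S_mult_right: "x * S k y = S k (x * y)"
  unfolding S_def by (metis Q_central mult.assoc)

lemmas S_simps = S_add S_diff S_minus S_zero S_0 S_S S_mult_left S_mult_right

text \<open>Multiplying a relation from the right makes it usable inside longer words.\<close>
lemma rewrite_right:
  "a * b = x \<Longrightarrow> a * (b * d) = x * (d :: 'a)"
  by (simp add: mult.assoc [symmetric])

end

section \<open>Straightening relations for real root vectors\<close>

text \<open>The elements \<open>x k\<close>, \<open>e k\<close> and \<open>y\<close> are root vectors (up to scalars) for $\alpha_1 + k \delta$,
  $\alpha_2 + k \delta$ and $\delta$.\<close>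
locale derivation_chain = central_powers Q for Q :: "int \<Rightarrow> 'a :: {ring, monoid_mult}" +
  fixes x e :: "nat \<Rightarrow> 'a" and y :: 'a
  assumes x_Suc: "x (Suc k) = y * x k - x k * y"
    and e_Suc: "e (Suc k) = e k * y - y * e k"
    and y_eq: "y = e 0 * x 0 - S (-2) (x 0 * e 0)"
    and x1_x0: "x 1 * x 0 = S 2 (x 0 * x 1)"
    and e0_e1: "e 0 * e 1 = S 2 (e 1 * e 0)"
    and cancel3: "S 2 a + a + S (-2) a = 0 \<Longrightarrow> a = 0"
    and cancel2: "S 2 a + S (-2) a = 0 \<Longrightarrow> a = 0"
begin

definition y2 :: 'a where "y2 = e 0 * x 1 - S (-2) (x 1 * e 0)"

lemma e0_x0: "e 0 * x 0 = y + S (-2) (x 0 * e 0)"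
  by (simp add: y_eq S_simps)

lemma x_y: "x k * y = y * x k - x (Suc k)"
  by (simp add: x_Suc)

lemma e_y: "e k * y = y * e k + e (Suc k)"
  by (simp add: e_Suc)

text \<open>The derivation [y, -] kills y itself. The Leibniz rule on y = e_0 x_0 - q^-2 x_0 e_0
  then identifies the two candidates for the next imaginary root vector: one suits
  \<open>y2_x0\<close>, the other \<open>e0_y2\<close>.\<close>

lemma y2_eq: "y2 = e 1 * x 0 - S (-2) (x 0 * e 1)"
proof -
  have "y * (e 0 * x 0 - S (-2) (x 0 * e 0)) = (e 0 * x 0 - S (-2) (x 0 * e 0)) * y"
    using y_eq by simp
  then show ?thesis
    unfolding y2_def One_nat_def x_Suc e_Suc
    by (simp add: algebra_simps S_simps)
qed

lemma e0_x1: "e 0 * x 1 = y2 + S (-2) (x 1 * e 0)"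
  by (simp add: y2_def)

lemma e1_x0: "e 1 * x 0 = y2 + S (-2) (x 0 * e 1)"
  by (simp add: y2_eq)

lemma y2_x0: "y2 * x 0 - x 0 * y2 = S 2 (y * x 1) - S (-2) (x 1 * y)"
proof -
  have *: "e 0 * (x 1 * x 0) = S 2 (e 0 * x 0 * x 1)"
    using x1_x0 by (simp add: S_simps mult.assoc)
  have **: "x 1 * (x 0 * e 0) = S 2 (x 0 * (x 1 * e 0))"
    using rewrite_right[OF x1_x0] by (simp add: S_simps mult.assoc)
  have "x 1 * (e 0 * x 0) = x 1 * y + S (-2) (x 1 * (x 0 * e 0))"
    using e0_x0 by (simp add: S_simps algebra_simps)
  moreover have "e 0 * x 0 * x 1 = y * x 1 + S (-2) (x 0 * e 0 * x 1)"
    using e0_x0 by (simp add: S_simps algebra_simps)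
  ultimately show ?thesis
    unfolding y2_def using * ** by (simp add: S_simps algebra_simps)
qed

lemma e0_y2: "e 0 * y2 - y2 * e 0 = S 2 (e 1 * y) - S (-2) (y * e 1)"
proof -
  have *: "e 0 * (e 1 * x 0) = S 2 (e 1 * (e 0 * x 0))"
    using rewrite_right[OF e0_e1] by (simp add: S_simps mult.assoc)
  have **: "x 0 * (e 0 * e 1) = S 2 (x 0 * (e 1 * e 0))"
    using e0_e1 by (simp add: S_simps mult.assoc)
  have "e 1 * (e 0 * x 0) = e 1 * y + S (-2) (e 1 * (x 0 * e 0))"
    using e0_x0 by (simp add: S_simps algebra_simps)
  moreover have "e 0 * (x 0 * e 1) = y * e 1 + S (-2) (x 0 * (e 0 * e 1))"
    using rewrite_right[OF e0_x0] by (simp add: S_simps algebra_simps)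
  ultimately show ?thesis
    unfolding y2_eq using * ** by (simp add: S_simps algebra_simps)
qed

text \<open>Write y as the q-commutator of e_0 and x_0 and move \<open>y2\<close> through both
  factors by \<open>y2_x0\<close> and \<open>e0_y2\<close>. The commutator A of y and
  \<open>y2\<close> reappears on the right with factor q^2 + q^-2, so that [3] A = 0.\<close>

lemma y2_y: "y2 * y = y * y2"
proof -
  define A where "A = y * y2 - y2 * y"
  have A1: "A = (e 1 * x 1 - S (-2) (x 1 * e 1)) - (e 2 * x 0 - S (-2) (x 0 * e 2))"
    unfolding A_def y2_eq numeral_2_eq_2 One_nat_def x_Suc e_Suc
    by (simp add: algebra_simps S_simps)
  have a1: "y2 * (e 0 * x 0) = e 0 * (y2 * x 0) - S 2 (e 1 * (y * x 0)) + S (-2) (y * (e 1 * x 0))"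
    using arg_cong[OF e0_y2, of "\<lambda>t. t * x 0"] by (simp add: algebra_simps S_simps)
  have a2: "e 0 * (y2 * x 0) = e 0 * (x 0 * y2) + S 2 (e 0 * (y * x 1)) - S (-2) (e 0 * (x 1 * y))"
    using arg_cong[OF y2_x0, of "\<lambda>t. e 0 * t"] by (simp add: algebra_simps S_simps)
  have a3: "y2 * (x 0 * e 0) = x 0 * (y2 * e 0) + S 2 (y * (x 1 * e 0)) - S (-2) (x 1 * (y * e 0))"
    using arg_cong[OF y2_x0, of "\<lambda>t. t * e 0"] by (simp add: algebra_simps S_simps)
  have a4: "x 0 * (y2 * e 0) = x 0 * (e 0 * y2) - S 2 (x 0 * (e 1 * y)) + S (-2) (x 0 * (y * e 1))"
    using arg_cong[OF e0_y2, of "\<lambda>t. x 0 * t"] by (simp add: algebra_simps S_simps)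
  have "y2 * y = y2 * (e 0 * x 0) - S (-2) (y2 * (x 0 * e 0))"
    by (subst y_eq) (simp add: algebra_simps S_simps)
  also have "\<dots> = (e 0 * x 0 - S (-2) (x 0 * e 0)) * y2
     - S 2 (e 1 * (y * x 0)) + S (-2) (y * (e 1 * x 0))
     + S 2 (e 0 * (y * x 1)) - S (-2) (e 0 * (x 1 * y))
     - y * (x 1 * e 0) + S (-4) (x 1 * (y * e 0))
     + x 0 * (e 1 * y) - S (-4) (x 0 * (y * e 1))"
    unfolding a1 a2 a3 a4 by (simp add: algebra_simps S_simps)
  finally have b: "- A = - S 2 (e 1 * (y * x 0)) + S (-2) (y * (e 1 * x 0))
     + S 2 (e 0 * (y * x 1)) - S (-2) (e 0 * (x 1 * y))
     - y * (x 1 * e 0) + S (-4) (x 1 * (y * e 0))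
     + x 0 * (e 1 * y) - S (-4) (x 0 * (y * e 1))"
    unfolding A_def y_eq [symmetric] by (simp add: algebra_simps)
  have r1: "e 1 * (y * x 0) = y * (y2 + S (-2) (x 0 * e 1)) + e 2 * x 0"
    unfolding rewrite_right[OF e_y] mult.assoc distrib_right e1_x0 by (simp add: numeral_2_eq_2)
  have r2: "y * (e 1 * x 0) = y * (y2 + S (-2) (x 0 * e 1))"
    using e1_x0 by simp
  have r3: "e 0 * (y * x 1) = y * (y2 + S (-2) (x 1 * e 0)) + e 1 * x 1"
    unfolding rewrite_right[OF e_y] mult.assoc distrib_right e0_x1 by simp
  have r4: "x 1 * (y * e 0) = y * (x 1 * e 0) - x 2 * e 0"
    unfolding rewrite_right[OF x_y] mult.assoc left_diff_distrib by (simp add: numeral_2_eq_2)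
  have r5: "e 0 * (x 1 * y) = y2 * y + S (-2) (y * (x 1 * e 0) - x 2 * e 0 + x 1 * e 1)"
    unfolding rewrite_right[OF e0_x1] distrib_right S_mult_left mult.assoc e_y distrib_left r4 by simp
  have r6: "x 0 * (y * e 1) = y * (x 0 * e 1) - x 1 * e 1"
    unfolding rewrite_right[OF x_y] mult.assoc left_diff_distrib by simp
  have r7: "x 0 * (e 1 * y) = y * (x 0 * e 1) - x 1 * e 1 + x 0 * e 2"
    unfolding e_y distrib_left r6 by (simp add: numeral_2_eq_2)
  \<comment> \<open>A appears in two guises: q^-2 A as the commutator of y and \<open>y2\<close>,
    and q^2 A as the combination of products of e's and x's given by \<open>A1\<close>.\<close>
  have c: "- A = S (-2) A + S 2 A"
    by (subst b, subst (2) A1, unfold A_def r1 r2 r3 r4 r5 r6 r7) (simp add: algebra_simps S_simps)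
  have "S 2 A + A + S (-2) A = A + (S (-2) A + S 2 A)"
    by (simp only: ac_simps)
  also have "\<dots> = 0"
    unfolding c [symmetric] by simp
  finally have "A = 0"
    by (rule cancel3)
  then show ?thesis
    by (simp add: A_def)
qed

text \<open>As \<open>y2\<close> commutes with y, the derivations [y2, -] and [y, -] commute, so the
  case k = 0 propagates along the chain.\<close>

lemma y2_x: "y2 * x k - x k * y2 = S 2 (y * x (Suc k)) - S (-2) (x (Suc k) * y)"
proof (induction k)
  case 0
  show ?case using y2_x0 by simp
next
  case (Suc k)
  have "y2 * x (Suc k) - x (Suc k) * y2
      = y * (y2 * x k - x k * y2) - (y2 * x k - x k * y2) * y"
    using y2_y rewrite_right[OF y2_y] by (simp add: x_Suc algebra_simps)
  then show ?case
    unfolding Suc.IH x_Suc[of "Suc k"] by (simp add: algebra_simps S_simps)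
qed

text \<open>The double commutator with \<open>y\<close> and the commutator with \<open>y2\<close> of the relation for \<open>k\<close> both express
  $q^{-2} x_{k+3} x_k - x_k x_{k+3}$ in terms of $x_{k+2} x_{k+1}$ and $x_{k+1} x_{k+2}$; comparing them gives the relation
  for \<open>k + 1\<close>.\<close>
lemma x_Suc_x: "x (Suc k) * x k = S 2 (x k * x (Suc k))"
proof (induction k)
  case 0
  show ?case using x1_x0 by simp
next
  case (Suc k)
  define r where "r = x (Suc k) * x k - S 2 (x k * x (Suc k))"
  have r: "r = 0"
    using Suc.IH by (simp add: r_def)
  have d: "y * r - r * y = x (k+2) * x k + x (k+1) * x (k+1)
     - S 2 (x (k+1) * x (k+1)) - S 2 (x k * x (k+2))" (is "_ = ?d")
    unfolding r_def by (simp add: algebra_simps S_simps x_Suc)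
  have d0: "?d = 0"
    unfolding d [symmetric] r by simp
  have d1: "y * ?d - ?d * y = x (k+3) * x k + x (k+2) * x (k+1) + (x (k+2) * x (k+1) + x (k+1) * x (k+2))
     - S 2 (x (k+2) * x (k+1) + x (k+1) * x (k+2)) - S 2 (x (k+1) * x (k+2) + x k * x (k+3))"
    unfolding numeral_3_eq_3 numeral_2_eq_2 by (simp add: algebra_simps S_simps x_Suc)
  have "x (k+3) * x k - (S 2 (x k * x (k+3)) + S 2 (x (k+2) * x (k+1)) - x (k+2) * x (k+1)
      - x (k+2) * x (k+1) + S 2 (x (k+1) * x (k+2)) + S 2 (x (k+1) * x (k+2)) - x (k+1) * x (k+2))
      = y * ?d - ?d * y"
    unfolding d1 by (simp add: algebra_simps S_simps)
  also have "\<dots> = 0"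
    unfolding d0 by simp
  finally have d2: "x (k+3) * x k = S 2 (x k * x (k+3)) + S 2 (x (k+2) * x (k+1)) - x (k+2) * x (k+1)
      - x (k+2) * x (k+1) + S 2 (x (k+1) * x (k+2)) + S 2 (x (k+1) * x (k+2)) - x (k+1) * x (k+2)"
    by (rule eq_iff_diff_eq_0 [THEN iffD2])
  have a: "y2 * x j = x j * y2 + S 2 (y * x (Suc j)) - S (-2) (y * x (Suc j)) + S (-2) (x (Suc (Suc j)))" for j
  proof -
    have "y2 * x j = x j * y2 + (y2 * x j - x j * y2)" by simp
    then show ?thesis unfolding y2_x x_y by (simp add: algebra_simps S_simps)
  qed
  have "0 = y2 * r - r * y2"
    using r by simp
  also have "\<dots> = (S 2 (y * x (k+2)) - S (-2) (y * x (k+2)) + S (-2) (x (k+3))) * x k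
     + x (k+1) * (S 2 (y * x (k+1)) - S (-2) (y * x (k+1)) + S (-2) (x (k+2)))
     - S 2 ((S 2 (y * x (k+1)) - S (-2) (y * x (k+1)) + S (-2) (x (k+2))) * x (k+1))
     - S 2 (x k * (S 2 (y * x (k+2)) - S (-2) (y * x (k+2)) + S (-2) (x (k+3))))"
    unfolding r_def by (simp add: algebra_simps S_simps numeral_3_eq_3 a rewrite_right[OF a])
  \<comment> \<open>All terms that still contain y collect to a multiple of \<open>?d\<close>, which
    is the commutator of y with the vanishing r.\<close>
  also have "\<dots> = y * (S 2 ?d - S (-2) ?d) + S (-2) (x (k+3) * x k) - x k * x (k+3)
     - S 2 (x (k+2) * x (k+1)) + S (-2) (x (k+2) * x (k+1)) + S (-2) (x (k+1) * x (k+2))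
     - x (k+2) * x (k+1) + S 4 (x (k+1) * x (k+2)) - x (k+1) * x (k+2)"
    by (simp add: algebra_simps S_simps numeral_3_eq_3 x_y rewrite_right[OF x_y])
  also note d0
  also have "y * (S 2 0 - S (-2) 0) + S (-2) (x (k+3) * x k) - x k * x (k+3)
     - S 2 (x (k+2) * x (k+1)) + S (-2) (x (k+2) * x (k+1)) + S (-2) (x (k+1) * x (k+2))
     - x (k+2) * x (k+1) + S 4 (x (k+1) * x (k+2)) - x (k+1) * x (k+2)
     = - (S 2 (x (k+2) * x (k+1) - S 2 (x (k+1) * x (k+2)))
                   + S (-2) (x (k+2) * x (k+1) - S 2 (x (k+1) * x (k+2))))"
    unfolding d2 by (simp add: algebra_simps S_simps)
  finally have "x (k+2) * x (k+1) - S 2 (x (k+1) * x (k+2)) = 0"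
    by - (rule cancel2, rule neg_equal_0_iff_equal [THEN iffD1], rule HOL.sym)
  then show ?case
    unfolding right_minus_eq by simp
qed

text \<open>Apply [y, -] to \<open>x_Suc_x\<close>. A second application, followed by reordering of
  neighbouring root vectors, gives the relation at distance three.\<close>

lemma x_Suc_Suc_x:
  "x (Suc (Suc k)) * x k = S 2 (x k * x (Suc (Suc k))) + S 2 (x (Suc k) * x (Suc k)) - x (Suc k) * x (Suc k)"
    (is "?l = ?r")
proof -
  have "?l - ?r = y * (x (Suc k) * x k - S 2 (x k * x (Suc k))) - (x (Suc k) * x k - S 2 (x k * x (Suc k))) * y"
    by (simp add: algebra_simps S_simps x_Suc)
  also have "\<dots> = 0"
    unfolding x_Suc_x by simp
  finally show ?thesis
    by (rule eq_iff_diff_eq_0 [THEN iffD2])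
qed

lemma x_Suc_Suc_Suc_x:
  "x (Suc (Suc (Suc k))) * x k = S 2 (x k * x (Suc (Suc (Suc k))))
     + S 2 (x (Suc (Suc k)) * x (Suc k)) - S (-2) (x (Suc (Suc k)) * x (Suc k))"
    (is "?l = ?r")
proof -
  define d where "d = x (Suc (Suc k)) * x k
     - (S 2 (x k * x (Suc (Suc k))) + S 2 (x (Suc k) * x (Suc k)) - x (Suc k) * x (Suc k))"
  define r where "r = x (Suc (Suc k)) * x (Suc k) - S 2 (x (Suc k) * x (Suc (Suc k)))"
  have "?l - ?r = y * d - d * y - r - r + S (-2) r"
    unfolding d_def r_def by (simp add: algebra_simps S_simps x_Suc)
  also have "\<dots> = 0"
    unfolding d_def r_def x_Suc_x x_Suc_Suc_x by (simp add: S_zero)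
  finally show ?thesis
    by (rule eq_iff_diff_eq_0 [THEN iffD2])
qed

end

section \<open>Chebyshev recursions\<close>

text \<open>Each relation is homogeneous in the sum of the indices, hence stable under x_k -> s^k
  x_k. The list is also stable under reversing products together with the order of the x_k.\<close>

locale pbw = central_powers Q for Q :: "int \<Rightarrow> 'a :: {ring, monoid_mult}" +
  fixes x0 x1 x2 x3 :: 'a
  assumes x1_x0: "x1 * x0 = S 2 (x0 * x1)"
    and x2_x1: "x2 * x1 = S 2 (x1 * x2)"
    and x3_x2: "x3 * x2 = S 2 (x2 * x3)"
    and x2_x0: "x2 * x0 = S 2 (x0 * x2) + S 2 (x1 * x1) - x1 * x1"
    and x3_x1: "x3 * x1 = S 2 (x1 * x3) + S 2 (x2 * x2) - x2 * x2"
    and x3_x0: "x3 * x0 = S 2 (x0 * x3) + S 2 (x2 * x1) - S (-2) (x2 * x1)"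
begin

lemma straighten:
  "x0 * x1 = S (-2) (x1 * x0)"
  "x1 * x2 = S (-2) (x2 * x1)"
  "x2 * x3 = S (-2) (x3 * x2)"
  "x0 * x2 = S (-2) (x2 * x0) - x1 * x1 + S (-2) (x1 * x1)"
  "x1 * x3 = S (-2) (x3 * x1) - x2 * x2 + S (-2) (x2 * x2)"
  "x0 * x3 = S (-2) (x3 * x0) - x2 * x1 + S (-4) (x2 * x1)"
  by (simp_all add: x1_x0 x2_x1 x3_x2 x2_x0 x3_x1 x3_x0 S_simps)

lemmas normal_order = straighten straighten [THEN rewrite_right] S_simps algebra_simps

text \<open>In terms of the dual PBW basis, \<open>p\<close> = E[0,1,0,1] - q E[0,0,2,0],
  \<open>P\<close> = E[1,0,1,0] - q E[0,2,0,0] and \<open>z\<close> = E[1,0,0,1] - q^2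
  E[0,1,1,0].\<close>

definition p where "p = x2 * x0 - S 2 (x1 * x1)"
definition P where "P = x3 * x1 - S 2 (x2 * x2)"
definition z where "z = x3 * x0 - S 2 (x2 * x1)"
definition c where "c = p * P"

lemma z_eq: "z = S 2 (x0 * x3) - x1 * x2"
  unfolding z_def by (simp add: normal_order)

lemma P_comm: "P * x3 = S (-2) (x3 * P)" "P * x2 = x2 * P" "P * x1 = S 2 (x1 * P)" "P * x0 = S 4 (x0 * P)"
  and p_comm: "x3 * p = S 4 (p * x3)" "x2 * p = S 2 (p * x2)" "x1 * p = p * x1" "x0 * p = S (-2) (p * x0)"
  unfolding P_def p_def by (simp_all add: normal_order)

lemma P_p: "P * p = S 4 (p * P)"
proof -
  have "P * p = P * x2 * x0 - S 2 (P * x1 * x1)"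
    by (simp add: p_def algebra_simps S_simps)
  also have "\<dots> = S 4 (p * P)"
    unfolding p_def by (simp add: P_comm P_comm [THEN rewrite_right] algebra_simps S_simps)
  finally show ?thesis .
qed

lemma P_z: "P * z = S 2 (z * P)"
  unfolding z_def by (simp add: P_comm P_comm [THEN rewrite_right] algebra_simps S_simps)

lemma z_p: "z * p = S 2 (p * z)"
  unfolding z_def by (simp add: p_comm p_comm [THEN rewrite_right] algebra_simps S_simps)

lemma c_z: "c * z = z * c"
  unfolding c_def by (simp add: P_z z_p rewrite_right[OF z_p] mult.assoc S_simps)

lemma P_c: "P * c = S 4 (c * P)"
  unfolding c_def by (simp add: rewrite_right[OF P_p] mult.assoc S_simps)

lemma c_p: "c * p = S 4 (p * c)"
  unfolding c_def by (simp add: P_p mult.assoc S_simps)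

lemma x3_c: "x3 * c = S 6 (c * x3)"
  unfolding c_def by (simp add: p_comm P_comm rewrite_right[OF p_comm(1)] mult.assoc S_simps)

lemma x2_c: "x2 * c = S 2 (c * x2)"
  unfolding c_def by (simp add: p_comm P_comm rewrite_right[OF p_comm(2)] mult.assoc S_simps)

text \<open>The index is shifted: $W_{n+1}$ has degree $n$, and $W_0 = 0$.\<close>
fun W :: "nat \<Rightarrow> 'a" where
  "W 0 = 0"
| "W (Suc 0) = 1"
| "W (Suc (Suc n)) = W (Suc n) * z - S 2 (W n * c)"

lemma W_z: "W n * z = z * W n"
  and W_c: "W n * c = c * W n"
proof (induction n rule: W.induct)
  case (3 n)
  { case 1 show ?case
      by (simp add: 3 3 [THEN rewrite_right] c_z rewrite_right[OF c_z] algebra_simps S_simps) }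
  { case 2 show ?case
      by (simp add: 3 3 [THEN rewrite_right] c_z rewrite_right[OF c_z] algebra_simps S_simps) }
qed simp_all

lemma W_left: "W (Suc (Suc n)) = z * W (Suc n) - S 2 (c * W n)"
  by (simp add: W_z W_c)

text \<open>W_{n+1} is homogeneous of degree n if z has degree 1 and c degree 2, and passing
  \<open>P\<close> multiplies z by q^2 and c by q^4. The same holds for \<open>p\<close> on the
  other side.\<close>

lemma P_W: "P * W (Suc n) = S (2 * int n) (W (Suc n) * P)"
proof (induction n rule: induct_nat_012)
  case 1
  show ?case by (simp add: P_z S_zero)
next
  case (ge2 n)
  have "P * W (Suc (Suc (Suc n))) = S 2 (z * (P * W (Suc (Suc n)))) - S 6 (c * (P * W (Suc n)))"
    unfolding W_left [of "Suc n"]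
    by (simp add: P_z P_c rewrite_right[OF P_z] rewrite_right[OF P_c] algebra_simps S_simps del: W.simps)
  also have "\<dots> = S (2 * int (Suc (Suc n))) (W (Suc (Suc (Suc n))) * P)"
    unfolding W_left [of "Suc n"] ge2
    by (simp add: algebra_simps S_simps del: W.simps)
  finally show ?case .
qed (simp add: S_simps)

lemma W_p: "W (Suc n) * p = S (2 * int n) (p * W (Suc n))"
proof (induction n rule: induct_nat_012)
  case 1
  show ?case by (simp add: z_p S_zero)
next
  case (ge2 n)
  have "W (Suc (Suc (Suc n))) * p = S 2 ((W (Suc (Suc n)) * p) * z) - S 6 ((W (Suc n) * p) * c)"
    by (simp add: z_p c_p algebra_simps S_simps del: W.simps(3) add: W.simps(3) [of "Suc n"])
  also have "\<dots> = S (2 * int (Suc (Suc n))) (p * W (Suc (Suc (Suc n))))"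
    unfolding W.simps(3) [of "Suc n"] ge2
    by (simp add: algebra_simps S_simps del: W.simps)
  finally show ?case .
qed (simp add: S_simps)

text \<open>Up to a power of q this is B[n+1,0,0,n]. The formula is the first identity of the
  theorem, normalised so that its coefficients do not depend on n.\<close>

definition L :: "nat \<Rightarrow> 'a" where
  "L n = x3 * W (Suc n) - S 2 (x2 * P * W n)"

text \<open>The value at $0$ is the one that continues the recursion of $L_{n-1} p$ downwards.\<close>
fun Lp :: "nat \<Rightarrow> 'a" where
  "Lp 0 = x2"
| "Lp (Suc n) = L n * p"

lemma L_0: "L 0 = x3"
  and L_1: "L (Suc 0) = x3 * z - S 2 (x2 * P)"
  by (simp_all add: L_def S_simps)

lemma L_1': "L (Suc 0) = S 2 (z * x3) - x2 * P"
  unfolding L_1 z_def P_def by (simp add: normal_order)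

lemma L_right: "L (Suc (Suc n)) = L (Suc n) * z - S 2 (L n * c)"
  by (simp add: L_def algebra_simps S_simps)

text \<open>Moving z past \<open>x3\<close> leaves a term in \<open>x2 * P\<close> (compare
  \<open>L_1\<close> with \<open>L_1'\<close>), so this is not formal from the recursion of
  \<open>W\<close>. The cases 0 and 1 are computed; \<open>L_right\<close> carries them on because
  left and right multiplications commute.\<close>

lemma L_left: "L (Suc (Suc n)) = S 2 (z * L (Suc n)) - S 6 (c * L n)"
proof -
  have 0: "L (Suc (Suc 0)) = S 2 (z * L (Suc 0)) - S 6 (c * L 0)"
  proof -
    have k: "S 4 (z * x2) = S 2 (x2 * z) + S 6 (p * x3) - S 4 (p * x3)"
      unfolding z_def p_def by (simp add: normal_order)
    have "L (Suc (Suc 0)) - (S 2 (z * L (Suc 0)) - S 6 (c * L 0))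
       = (S 2 (z * x3) - x2 * P) * z - S 2 (x3 * c) - S 2 (z * (x3 * z - S 2 (x2 * P))) + S 6 (c * x3)"
      unfolding L_right [of 0] L_1' [symmetric] L_1 [symmetric] L_0 by simp
    also have "\<dots> = S 4 (z * x2) * P - S 2 (x2 * z * P) - S 8 (c * x3) + S 6 (c * x3)"
      by (simp add: algebra_simps S_simps P_z x3_c)
    also have "\<dots> = 0"
      unfolding k c_def by (simp add: algebra_simps S_simps P_comm)
    finally show ?thesis by (rule eq_iff_diff_eq_0 [THEN iffD2])
  qed
  have 1: "L (Suc (Suc (Suc 0))) = S 2 (z * L (Suc (Suc 0))) - S 6 (c * L (Suc 0))"
  proof -
    have "L (Suc (Suc (Suc 0))) - (S 2 (z * L (Suc (Suc 0))) - S 6 (c * L (Suc 0)))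
       = (S 2 (z * L (Suc 0)) - S 6 (c * L 0)) * z - S 2 (L (Suc 0) * c)
         - S 2 (z * (L (Suc 0) * z - S 2 (L 0 * c))) + S 6 (c * L (Suc 0))"
      unfolding L_right [of "Suc 0"] by (subst (1) 0, subst (1) L_right) simp
    also have "\<dots> = S 2 ((S 2 (z * x3) - L (Suc 0)) * c) - S 6 (c * (x3 * z - L (Suc 0)))"
      unfolding L_0 by (simp add: algebra_simps S_simps)
    also have "\<dots> = S 2 (x2 * P * c) - S 8 (c * x2 * P)"
      by (subst L_1', subst L_1) (simp add: algebra_simps S_simps)
    also have "\<dots> = 0"
      by (simp add: P_c rewrite_right[OF x2_c] algebra_simps S_simps)
    finally show ?thesis by (rule eq_iff_diff_eq_0 [THEN iffD2])
  qed
  show ?thesis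
  proof (induction n rule: induct_nat_012)
    case (ge2 n)
    have "L (Suc (Suc (Suc (Suc n)))) = L (Suc (Suc (Suc n))) * z - S 2 (L (Suc (Suc n)) * c)"
      by (rule L_right)
    also have "\<dots> = (S 2 (z * L (Suc (Suc n))) - S 6 (c * L (Suc n))) * z
        - S 2 ((S 2 (z * L (Suc n)) - S 6 (c * L n)) * c)"
      unfolding ge2 [symmetric] ..
    also have "\<dots> = S 2 (z * (L (Suc (Suc n)) * z - S 2 (L (Suc n) * c))) - S 6 (c * (L (Suc n) * z - S 2 (L n * c)))"
      by (simp add: algebra_simps S_simps)
    finally show ?case
      unfolding L_right [symmetric] .
  qed (fact 0 1)+
qed

text \<open>Both sides satisfy the recursion of \<open>L_left\<close> and agree for n = 0 and n = 1.
  The reversed form supplies the second formula for B[n+1,0,0,n] and the image of \<open>L\<close>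
  under sigma.\<close>

lemma L_mirror: "L n = S (2 * int n) (W (Suc n) * x3) - P * W n * x2"
proof (induction n rule: induct_nat_012)
  case 0
  show ?case by (simp add: L_0 S_simps)
next
  case 1
  show ?case unfolding L_1' by (simp add: P_comm S_zero)
next
  case (ge2 n)
  have *: "P * W (Suc (Suc n)) = S 2 (z * (P * W (Suc n))) - S 6 (c * (P * W n))"
    unfolding W_left
    by (simp add: P_z P_c rewrite_right[OF P_z] rewrite_right[OF P_c] algebra_simps S_simps del: W.simps)
  show ?case
    unfolding L_left [of n] ge2 W_left [of "Suc n"] *
    by (simp add: algebra_simps S_simps del: W.simps)
qed

lemma Lp_right: "Lp (Suc (Suc n)) = S 2 (Lp (Suc n) * z) - S 6 (Lp n * c)"
proof (cases n)
  case 0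
  then show ?thesis
    by (simp add: L_0 L_1 z_p P_p rewrite_right[OF P_p] c_def algebra_simps S_simps rewrite_right[OF p_comm(2)])
next
  case (Suc k)
  then show ?thesis
    by (simp add: L_right z_p c_p algebra_simps S_simps)
qed

lemma Lp_left: "Lp (Suc (Suc n)) = S 2 (z * Lp (Suc n)) - S 6 (c * Lp n)"
proof (cases n)
  case 0
  then show ?thesis
    by (simp add: L_0 L_1' P_p c_def algebra_simps S_simps rewrite_right[OF p_comm(2)] P_comm)
next
  case (Suc k)
  then show ?thesis
    by (simp add: L_left algebra_simps S_simps)
qed

text \<open>x_0 and x_1 stand on the left, so the right recursions pass through; the factor q^(-2n)
  turns the coefficients of \<open>Lp_right\<close> into those of \<open>W\<close>.\<close>

lemma W_x0_L: "W (Suc (Suc n)) = S 2 (x0 * L n) - S (- 2 * int n) (x1 * Lp n)"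
proof (induction n rule: induct_nat_012)
  case 0
  show ?case by (simp add: L_0 z_eq S_simps)
next
  case 1
  show ?case
    unfolding L_1 by (simp add: L_0 z_def P_def p_def c_def normal_order)
next
  case (ge2 n)
  show ?case
    unfolding L_right Lp_right W.simps(3) [of "Suc (Suc n)"] ge2
    by (simp add: algebra_simps S_simps del: W.simps Lp.simps)
qed

text \<open>Here x_0 and x_1 stand on the right and the left recursions are used. Scaling
  \<open>W\<close> by q^(2n) gives it the coefficients q^2 and q^6 of \<open>L_left\<close> and
  \<open>Lp_left\<close>.\<close>

lemma W_L_x0: "S (2 * int n) (W (Suc (Suc n))) = L n * x0 - S 2 (Lp n * x1)"
proof (induction n rule: induct_nat_012)
  case 0
  show ?case by (simp add: L_0 z_def S_simps)
next
  case 1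
  show ?case
    unfolding L_1 by (simp add: L_0 z_def P_def p_def c_def normal_order)
next
  case (ge2 n)
  have "S (2 * int (Suc (Suc n))) (W (Suc (Suc (Suc (Suc n)))))
     = S 2 (z * S (2 * int (Suc n)) (W (Suc (Suc (Suc n))))) - S 6 (c * S (2 * int n) (W (Suc (Suc n))))"
    unfolding W_left [of "Suc (Suc n)"]
    by (simp add: algebra_simps S_simps del: W.simps)
  then show ?case
    unfolding ge2 L_left Lp_left
    by (simp add: algebra_simps S_simps del: W.simps Lp.simps)
qed

end

section \<open>Expansions in the dual PBW basis\<close>

datatype 'a opp = Opp (unopp: 'a)

instantiation opp :: ("{ring, monoid_mult}") "{ring, monoid_mult}"
begin
definition "0 = Opp 0"
definition "1 = Opp 1"
definition "a + b = Opp (unopp a + unopp b)"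
definition "a - b = Opp (unopp a - unopp b)"
definition "- a = Opp (- unopp a)"
definition "a * b = Opp (unopp b * unopp a)"
instance
  by standard
     (simp_all add: zero_opp_def one_opp_def plus_opp_def minus_opp_def uminus_opp_def times_opp_def algebra_simps)
end

lemma unopp_simps [simp]:
  "unopp 0 = 0" "unopp 1 = 1" "unopp (a + b) = unopp a + unopp b" "unopp (a - b) = unopp a - unopp b"
  "unopp (- a) = - unopp a" "unopp (a * b) = unopp b * unopp a"
  by (simp_all add: zero_opp_def one_opp_def plus_opp_def minus_opp_def uminus_opp_def times_opp_def)

lemma unopp_power [simp]: "unopp (a ^ n) = unopp a ^ n"
  by (induction n) (simp_all add: power_commutes)

lemma opp_eq_iff: "a = b \<longleftrightarrow> unopp a = unopp b"
  by (cases a; cases b) simp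

text \<open>An element of the following ring is a pair of an element and its image under an
  anti-automorphism; the second component is multiplied in the opposite order.\<close>
datatype 'a paired = Paired (pfst: 'a) (psnd: 'a)

instantiation paired :: ("{ring, monoid_mult}") "{ring, monoid_mult}"
begin
definition "0 = Paired 0 0"
definition "1 = Paired 1 1"
definition "a + b = Paired (pfst a + pfst b) (psnd a + psnd b)"
definition "a - b = Paired (pfst a - pfst b) (psnd a - psnd b)"
definition "- a = Paired (- pfst a) (- psnd a)"
definition "a * b = Paired (pfst a * pfst b) (psnd b * psnd a)"
instance
  by standard
     (simp_all add: zero_paired_def one_paired_def plus_paired_def minus_paired_def uminus_paired_def
        times_paired_def algebra_simps)
end

lemma pfst_simps [simp]:
  "pfst 0 = 0" "pfst 1 = 1" "pfst (a + b) = pfst a + pfst b" "pfst (a - b) = pfst a - pfst b"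
  "pfst (- a) = - pfst a" "pfst (a * b) = pfst a * pfst b"
  and psnd_simps [simp]:
  "psnd 0 = 0" "psnd 1 = 1" "psnd (a + b) = psnd a + psnd b" "psnd (a - b) = psnd a - psnd b"
  "psnd (- a) = - psnd a" "psnd (a * b) = psnd b * psnd a"
  by (simp_all add: zero_paired_def one_paired_def plus_paired_def minus_paired_def uminus_paired_def
        times_paired_def)

lemma pfst_power [simp]: "pfst (a ^ n) = pfst a ^ n"
  and psnd_power [simp]: "psnd (a ^ n) = psnd a ^ n"
  by (induction n) (simp_all add: power_commutes)

lemma paired_eq_iff: "a = b \<longleftrightarrow> pfst a = pfst b \<and> psnd a = psnd b"
  by (cases a; cases b) simp

lemma int_Suc_choose_2: "int (Suc n choose 2) = int n + int (n choose 2)"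
  by (simp add: numeral_2_eq_2)

section \<open>The order on exponents and triangular expansions\<close>

fun rev4 :: "nat4 \<Rightarrow> nat4" where "rev4 (a3, a2, a1, a0) = (a0, a1, a2, a3)"

lemma SsetI:
  fixes i k :: nat
  assumes "int b3 = int a3 - int i" "int b2 = int a2 + 2 * int i - int k"
    "int b1 = int a1 - int i + 2 * int k" "int b0 = int a0 - int k" "(b3, b2, b1, b0) \<noteq> (a3, a2, a1, a0)"
  shows "(b3, b2, b1, b0) \<in> Sset (a3, a2, a1, a0)"
  using assms unfolding Sset_def tri.simps mem_Collect_eq by blast

lemma rev4_rev4 [simp]: "rev4 (rev4 a) = a"
  by (cases a) simp

text \<open>Reversal swaps (-1,2,-1,0) and (0,-1,2,-1), so the two multiplicities trade
  places.\<close>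

lemma tri_rev4: "tri a b \<Longrightarrow> tri (rev4 a) (rev4 b)"
proof (cases a, cases b)
  fix a3 a2 a1 a0 b3 b2 b1 b0
  assume ab: "a = (a3, a2, a1, a0)" "b = (b3, b2, b1, b0)" and "tri a b"
  then obtain i k :: nat where "int b3 = int a3 - int i" "int b2 = int a2 + 2 * int i - int k"
    "int b1 = int a1 - int i + 2 * int k" "int b0 = int a0 - int k"
    by auto
  then show ?thesis
    unfolding ab rev4.simps tri.simps by (intro exI[of _ k] exI[of _ i] conjI) linarith+
qed

lemma Sset_rev4: "rev4 ` Sset a = Sset (rev4 a)"
proof (intro equalityI subsetI)
  fix b assume "b \<in> rev4 ` Sset a"
  then obtain b' where b': "b = rev4 b'" "tri a b'" "b' \<noteq> a"
    by (auto simp: Sset_def)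
  moreover have "rev4 b' \<noteq> rev4 a"
    using b'(3) by (metis rev4_rev4)
  ultimately show "b \<in> Sset (rev4 a)"
    using tri_rev4 by (simp add: Sset_def)
next
  fix b assume "b \<in> Sset (rev4 a)"
  then have "rev4 b \<in> Sset a"
    unfolding Sset_def using tri_rev4[of "rev4 a" b] rev4_rev4 by auto
  then show "b \<in> rev4 ` Sset a"
    by (metis imageI rev4_rev4)
qed

context pbw
begin

fun E :: "nat4 \<Rightarrow> 'a" where
  "E (a3, a2, a1, a0) = S (bb (a3, a2, a1, a0)) (x3 ^ a3 * x2 ^ a2 * x1 ^ a1 * x0 ^ a0)"

text \<open>The additive group generated by the $q^k E[b]$ with $k \ge d$ and $b \in T$.\<close>
inductive_set lat :: "int \<Rightarrow> nat4 set \<Rightarrow> 'a set" for d T where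
  zero: "0 \<in> lat d T"
| gen: "b \<in> T \<Longrightarrow> k \<ge> d \<Longrightarrow> S k (E b) \<in> lat d T"
| add: "a \<in> lat d T \<Longrightarrow> b \<in> lat d T \<Longrightarrow> a + b \<in> lat d T"
| minus: "a \<in> lat d T \<Longrightarrow> - a \<in> lat d T"

lemma lat_diff: "a \<in> lat d T \<Longrightarrow> b \<in> lat d T \<Longrightarrow> a - b \<in> lat d T"
  using lat.add[OF _ lat.minus, of a d T b] by simp

lemma lat_mono: "a \<in> lat d T \<Longrightarrow> e \<le> d \<Longrightarrow> T \<subseteq> T' \<Longrightarrow> a \<in> lat e T'"
  by (induction rule: lat.induct) (auto intro: lat.intros)

lemma lat_S: "a \<in> lat d T \<Longrightarrow> S k a \<in> lat (k + d) T"
  by (induction rule: lat.induct) (auto intro!: lat.intros simp: S_simps)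

lemma lat_mult:
  assumes "a \<in> lat d T" "\<And>b. b \<in> T \<Longrightarrow> S j (y * E b) \<in> lat e T'"
  shows "S j (y * a) \<in> lat (d + e) T'"
  using assms(1)
proof (induction rule: lat.induct)
  case (gen b k)
  have "S k (S j (y * E b)) \<in> lat (k + e) T'"
    using assms(2) gen by (intro lat_S) auto
  then have "S k (S j (y * E b)) \<in> lat (d + e) T'"
    by (rule lat_mono) (use gen in auto)
  then show ?case
    by (simp add: S_simps add.commute)
qed (auto intro: lat.intros simp: S_simps algebra_simps)

text \<open>The triangularity half of the characterisation of B[a]; lattice level 1 encodes
  coefficients in q Z[q].\<close>

definition leads :: "nat4 \<Rightarrow> 'a \<Rightarrow> bool" where
  "leads a y \<longleftrightarrow> y - E a \<in> lat 1 (Sset a)"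

lemma leads_lat: "leads a y \<Longrightarrow> y \<in> lat 0 {b. tri a b}"
proof -
  assume "leads a y"
  then have "y - E a \<in> lat 0 {b. tri a b}"
    unfolding leads_def by (rule lat_mono) (auto simp: Sset_def)
  moreover have "tri a a"
    by (cases a) (auto intro!: exI[of _ "0 :: nat"])
  then have "S 0 (E a) \<in> lat 0 {b. tri a b}"
    by (intro lat.gen) auto
  ultimately show ?thesis
    using lat.add by (fastforce simp: S_simps)
qed

lemma x2_x3_power: "x2 * x3 ^ n = S (- 2 * int n) (x3 ^ n * x2)"
proof (induction n)
  case (Suc n)
  then show ?case
    by (simp add: rewrite_right[OF straighten(3)] S_simps algebra_simps)
qed (simp add: S_simps)

lemma P_x3_power: "P * x3 ^ n = S (- 2 * int n) (x3 ^ n * P)"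
proof (induction n)
  case (Suc n)
  then show ?case
    by (simp add: rewrite_right[OF P_comm(1)] S_simps algebra_simps)
qed (simp add: S_simps)

lemma P_x2_power: "P * x2 ^ n = x2 ^ n * P"
proof (induction n)
  case (Suc n)
  then show ?case
    by (simp add: rewrite_right[OF P_comm(2)] S_simps algebra_simps)
qed (simp add: S_simps)

lemma x2_power_x3: "x2 ^ n * x3 = S (- 2 * int n) (x3 * x2 ^ n)"
proof (induction n)
  case (Suc n)
  then show ?case
    by (simp add: rewrite_right[OF straighten(3)] S_simps algebra_simps)
qed (simp add: S_simps)

lemma x3_E: "x3 * E (a3, a2, a1, a0) = S (- int a3) (E (Suc a3, a2, a1, a0))"
  by (simp add: S_simps int_Suc_choose_2 algebra_simps)

lemma x2_E: "x2 * E (a3, a2, a1, a0) = S (- 2 * int a3 - int a2) (E (a3, Suc a2, a1, a0))"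
  by (simp add: S_simps int_Suc_choose_2 rewrite_right[OF x2_x3_power] algebra_simps)

text \<open>\<open>P\<close> q-commutes with \<open>x3\<close> and \<open>x2\<close>; it is moved up
  to the power of \<open>x1\<close> and expanded only there.\<close>

lemma P_E: "P * E (a3, a2, a1, a0) = S (- 3 * int a3 - 2 * int a2 - int a1) (E (Suc a3, a2, Suc a1, a0))
   - S (1 - 2 * int a3 - 2 * int a2) (E (a3, Suc (Suc a2), a1, a0))"
proof -
  have "P * (x3 ^ a3 * x2 ^ a2 * x1 ^ a1 * x0 ^ a0)
     = S (- 2 * int a3) (x3 ^ a3 * x2 ^ a2 * P * x1 ^ a1 * x0 ^ a0)"
    by (simp add: S_simps rewrite_right[OF P_x3_power] rewrite_right[OF P_x2_power] algebra_simps)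
  also have "x3 ^ a3 * x2 ^ a2 * P * x1 ^ a1 * x0 ^ a0
     = S (- 2 * int a2) (x3 ^ Suc a3 * x2 ^ a2 * x1 ^ Suc a1 * x0 ^ a0)
       - S 2 (x3 ^ a3 * x2 ^ Suc (Suc a2) * x1 ^ a1 * x0 ^ a0)"
    unfolding P_def
    by (simp add: S_simps rewrite_right[OF x2_power_x3] power_commutes rewrite_right[OF power_commutes] algebra_simps)
  finally have *: "P * (x3 ^ a3 * x2 ^ a2 * x1 ^ a1 * x0 ^ a0)
     = S (- 2 * int a3) (S (- 2 * int a2) (x3 ^ Suc a3 * x2 ^ a2 * x1 ^ Suc a1 * x0 ^ a0)
       - S 2 (x3 ^ a3 * x2 ^ Suc (Suc a2) * x1 ^ a1 * x0 ^ a0))" .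
  show ?thesis
    unfolding E.simps S_mult_right * by (simp add: S_simps int_Suc_choose_2 algebra_simps del: power_Suc)
qed

lemma leads_P:
  assumes "leads (n, 0, 0, m) y"
  shows "leads (Suc n, 0, 1, m) (S (3 * int n) (P * y))"
proof -
  have "S (3 * int n) (P * E b) \<in> lat 0 (Sset (Suc n, 0, 1, m))" if "b \<in> Sset (n, 0, 0, m)" for b
  proof -
    obtain b3 b2 b1 b0 where b: "b = (b3, b2, b1, b0)" by (cases b)
    have t: "tri (n, 0, 0, m) (b3, b2, b1, b0)" "b \<noteq> (n, 0, 0, m)"
      using that b by (auto simp: Sset_def)
    then obtain i k where ik: "int b3 = int n - int i" "int b2 = 2 * int i - int k"
      "int b1 = - int i + 2 * int k" "int b0 = int m - int k"
      by auto
    have 1: "(Suc b3, b2, Suc b1, b0) \<in> Sset (Suc n, 0, 1, m)"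
      using ik t b by (intro SsetI[of _ _ i _ _ k]) auto
    have 2: "(b3, Suc (Suc b2), b1, b0) \<in> Sset (Suc n, 0, 1, m)"
      using ik by (intro SsetI[of _ _ "Suc i" _ _ k]) auto
    \<comment> \<open>The first exponent is 0, because 3 b3 + 2 b2 + b1 is constant along the order;
      the second one is b3 + b1 + 1.\<close>
    have 3: "3 * int n - 3 * int b3 - 2 * int b2 - int b1 \<ge> 0" "3 * int n + 1 - 2 * int b3 - 2 * int b2 \<ge> 0"
      using ik by linarith+
    have "S (3 * int n) (P * E b) = S (3 * int n - 3 * int b3 - 2 * int b2 - int b1) (E (Suc b3, b2, Suc b1, b0))
      - S (3 * int n + 1 - 2 * int b3 - 2 * int b2) (E (b3, Suc (Suc b2), b1, b0))"
      unfolding b P_E by (simp add: S_simps algebra_simps del: E.simps)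
    then show ?thesis
      using 1 2 3 by (auto intro!: lat_diff lat.gen simp del: E.simps)
  qed
  then have "S (3 * int n) (P * (y - E (n, 0, 0, m))) \<in> lat (1 + 0) (Sset (Suc n, 0, 1, m))"
    using assms unfolding leads_def by (intro lat_mult)
  moreover have "S (3 * int n) (P * E (n, 0, 0, m)) - E (Suc n, 0, 1, m) \<in> lat 1 (Sset (Suc n, 0, 1, m))"
  proof -
    have "(n, 2, 0, m) \<in> Sset (Suc n, 0, 1, m)"
      by (intro SsetI[of _ _ "Suc 0" _ _ 0]) auto
    then have "- S (int n + 1) (E (n, 2, 0, m)) \<in> lat 1 (Sset (Suc n, 0, 1, m))"
      by (intro lat.minus lat.gen) auto
    then show ?thesis
      unfolding P_E by (simp add: S_simps algebra_simps numeral_2_eq_2 del: E.simps)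
  qed
  ultimately show ?thesis
    unfolding leads_def using lat.add by (fastforce simp: S_simps algebra_simps simp del: E.simps)
qed

lemma leads_x3:
  assumes "leads (n, 0, 0, m) y"
  shows "leads (Suc n, 0, 0, m) (S (int n) (x3 * y))"
proof -
  have "S (int n) (x3 * E b) \<in> lat 0 (Sset (Suc n, 0, 0, m))" if "b \<in> Sset (n, 0, 0, m)" for b
  proof -
    obtain b3 b2 b1 b0 where b: "b = (b3, b2, b1, b0)" by (cases b)
    have t: "tri (n, 0, 0, m) (b3, b2, b1, b0)" "b \<noteq> (n, 0, 0, m)"
      using that b by (auto simp: Sset_def)
    then obtain i k where ik: "int b3 = int n - int i" "int b2 = 2 * int i - int k"
      "int b1 = - int i + 2 * int k" "int b0 = int m - int k"
      by auto
    have "(Suc b3, b2, b1, b0) \<in> Sset (Suc n, 0, 0, m)"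
      using ik t b by (intro SsetI[of _ _ i _ _ k]) auto
    moreover have "int n - int b3 \<ge> 0"
      using ik by linarith
    ultimately show ?thesis
      unfolding b x3_E using lat.gen[of "(Suc b3, b2, b1, b0)" _ 0 "int n - int b3"]
      by (simp add: S_simps del: E.simps)
  qed
  then have "S (int n) (x3 * (y - E (n, 0, 0, m))) \<in> lat (1 + 0) (Sset (Suc n, 0, 0, m))"
    using assms unfolding leads_def by (intro lat_mult)
  then show ?thesis
    unfolding leads_def by (simp add: x3_E S_simps algebra_simps del: E.simps)
qed

text \<open>The common induction step for \<open>L\<close> and \<open>A\<close>. If b arises from
  (n, 0, 1, m) with j steps (0,-1,2,-1), then \<open>x2\<close> sends q^k E[b] to a term with
  exponent k - 2n + j, so k > 2n keeps the correction in q Z[q].\<close>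

lemma leads_x3_x2:
  assumes "leads (n, 0, 0, Suc m) y" "leads (n, 0, 1, m) y'" "k \<ge> 2 * int n + 1"
  shows "leads (Suc n, 0, 0, Suc m) (S (int n) (x3 * y) - S k (x2 * y'))"
proof -
  have "S k (x2 * E b) \<in> lat 1 (Sset (Suc n, 0, 0, Suc m))" if "b \<in> {b. tri (n, 0, 1, m) b}" for b
  proof -
    obtain b3 b2 b1 b0 where b: "b = (b3, b2, b1, b0)" by (cases b)
    from that obtain i j where ij: "int b3 = int n - int i" "int b2 = 2 * int i - int j"
      "int b1 = 1 - int i + 2 * int j" "int b0 = int m - int j"
      unfolding b by auto
    have "(b3, Suc b2, b1, b0) \<in> Sset (Suc n, 0, 0, Suc m)"
      using ij by (intro SsetI[of _ _ "Suc i" _ _ "Suc j"]) auto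
    moreover have "k - 2 * int b3 - int b2 \<ge> 1"
      using ij assms(3) by linarith
    ultimately show ?thesis
      unfolding b x2_E using lat.gen[of "(b3, Suc b2, b1, b0)" _ 1 "k - 2 * int b3 - int b2"]
      by (simp add: S_simps algebra_simps del: E.simps)
  qed
  then have "S k (x2 * y') \<in> lat (0 + 1) (Sset (Suc n, 0, 0, Suc m))"
    by (intro lat_mult[OF leads_lat[OF assms(2)]])
  then show ?thesis
    using leads_x3[OF assms(1)] lat_diff unfolding leads_def by (fastforce simp: algebra_simps simp del: E.simps)
qed

text \<open>Up to lower terms z^n is q^(-n(n-1)) x_3^n x_0^n, that is q^(-2n(n-1)) E[n,0,0,n]; the
  factor makes the leading coefficient 1.\<close>

definition A :: "nat \<Rightarrow> 'a" where "A n = S (2 * int n * (int n - 1)) (W (Suc n))"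

lemma A_0: "A 0 = 1"
  by (simp add: A_def S_simps)

lemma leads_A_0: "leads (0, 0, 0, 0) (A 0)"
  unfolding leads_def A_0 by (simp add: S_simps lat.zero binomial_eq_0)

lemma leads_L:
  assumes "leads (n, 0, 0, n) (A n)" "\<And>k. n = Suc k \<Longrightarrow> leads (k, 0, 0, k) (A k)"
  shows "leads (Suc n, 0, 0, n) (S (int n * (2 * int n - 1)) (L n))"
proof (cases n)
  case 0
  then show ?thesis
    using leads_x3[OF assms(1)] by (simp add: L_0 A_0 S_simps)
next
  case (Suc k)
  have "leads (Suc n, 0, 0, Suc k) (S (int n) (x3 * A n) - S (2 * int n + 1) (x2 * S (3 * int k) (P * A k)))"
    using assms leads_P[of k k "A k"] Suc by (intro leads_x3_x2) auto
  also have "S (int n) (x3 * A n) - S (2 * int n + 1) (x2 * S (3 * int k) (P * A k))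
      = S (int n * (2 * int n - 1)) (L n)"
    by (simp add: A_def L_def S_simps algebra_simps Suc del: W.simps)
  finally show ?thesis by (simp add: Suc)
qed


section \<open>Mirror images, transported from the opposite ring\<close>

definition R :: "nat \<Rightarrow> 'a" where
  "R n = W (Suc n) * x0 - S 2 (W n * p * x1)"

fun Rp :: "nat \<Rightarrow> 'a" where
  "Rp 0 = x1"
| "Rp (Suc n) = P * R n"

text \<open>Reversing products and exchanging x_i with x_{3-i} permutes the six relations and leaves
  q alone. This symmetry fixes z and c, swaps \<open>P\<close> with \<open>p\<close>, and turns
  \<open>L\<close> into \<open>R\<close>.\<close>

lemma pbw_opp: "pbw (\<lambda>k. Opp (Q k)) (Opp x3) (Opp x2) (Opp x1) (Opp x0)"
proof -
  interpret o: central_powers "\<lambda>k. Opp (Q k)"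
  proof
    show "Opp (Q (j + k)) = Opp (Q j) * Opp (Q k)" for j k
      by (simp add: opp_eq_iff Q_add [symmetric] add.commute)
    show "y * Opp (Q k) = Opp (Q k) * y" for y k
      unfolding opp_eq_iff unopp_simps opp.sel by (rule Q_central [symmetric])
  qed (simp add: opp_eq_iff Q_zero)
  have o_S: "o.S k y = Opp (S k (unopp y))" for k y
    unfolding o.S_def S_def opp_eq_iff unopp_simps opp.sel by (rule Q_central)
  show ?thesis
    by unfold_locales (simp_all add: opp_eq_iff o_S normal_order)
qed

interpretation opp: pbw "\<lambda>k. Opp (Q k)" "Opp x3" "Opp x2" "Opp x1" "Opp x0"
  by (rule pbw_opp)

lemma unopp_S [simp]: "unopp (opp.S k y) = S k (unopp y)"
  unfolding opp.S_def S_def unopp_simps opp.sel by (rule Q_central)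

lemma unopp_z [simp]: "unopp opp.z = z"
  and unopp_p [simp]: "unopp opp.p = P"
  and unopp_P [simp]: "unopp opp.P = p"
  and unopp_c [simp]: "unopp opp.c = c"
  by (simp_all add: opp.z_def z_def opp.p_def p_def opp.P_def P_def opp.c_def c_def)

lemma unopp_W [simp]: "unopp (opp.W n) = W n"
  by (induction n rule: W.induct) (simp_all add: W_z W_c)

lemma unopp_L [simp]: "unopp (opp.L n) = R n"
  by (simp add: opp.L_def R_def mult.assoc)

lemma unopp_Lp [simp]: "unopp (opp.Lp n) = Rp n"
  by (cases n) simp_all

lemma unopp_A [simp]: "unopp (opp.A n) = A n"
  by (simp add: opp.A_def A_def)

lemma unopp_E [simp]: "unopp (opp.E a) = E (rev4 a)"
  by (cases a) (simp add: algebra_simps)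

lemma R_mirror: "R n = S (2 * int n) (x0 * W (Suc n)) - x1 * W n * p"
  using arg_cong[OF opp.L_mirror[of n], of unopp] by (simp add: mult.assoc)

lemma W_R_x3: "W (Suc (Suc n)) = S 2 (R n * x3) - S (- 2 * int n) (Rp n * x2)"
  using arg_cong[OF opp.W_x0_L[of n], of unopp] by (simp add: mult.assoc W_z W_c)

lemma W_x3_R: "S (2 * int n) (W (Suc (Suc n))) = x3 * R n - S 2 (x2 * Rp n)"
  using arg_cong[OF opp.W_L_x0[of n], of unopp] by (simp add: mult.assoc W_z W_c)

lemma unopp_lat: "y \<in> opp.lat d T \<Longrightarrow> unopp y \<in> lat d (rev4 ` T)"
  by (induction rule: opp.lat.induct) (auto intro!: lat.intros simp del: E.simps opp.E.simps)

lemma opp_lat: "y \<in> lat d T \<Longrightarrow> Opp y \<in> opp.lat d (rev4 ` T)"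
proof (induction rule: lat.induct)
  case zero
  then show ?case using opp.lat.zero by (simp add: zero_opp_def)
next
  case (gen b k)
  have "Opp (S k (E b)) = opp.S k (opp.E (rev4 b))"
    by (simp add: opp_eq_iff del: E.simps opp.E.simps)
  then show ?case
    using opp.lat.gen[of "rev4 b" "rev4 ` T" d k] gen by (simp del: E.simps opp.E.simps)
next
  case (add a b)
  have "Opp (a + b) = Opp a + Opp b" by (simp add: opp_eq_iff)
  then show ?case using add opp.lat.add by simp
next
  case (minus a)
  have "Opp (- a) = - Opp a" by (simp add: opp_eq_iff)
  then show ?case using minus opp.lat.minus by simp
qed

lemma leads_unopp: "opp.leads a y \<Longrightarrow> leads (rev4 a) (unopp y)"
  unfolding opp.leads_def leads_def using unopp_lat[of "y - opp.E a" 1 "Sset a"]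
  by (simp add: Sset_rev4 del: E.simps opp.E.simps)

lemma leads_opp: "leads a y \<Longrightarrow> opp.leads (rev4 a) (Opp y)"
proof -
  assume "leads a y"
  then have "Opp (y - E a) \<in> opp.lat 1 (Sset (rev4 a))"
    unfolding leads_def using opp_lat by (fastforce simp: Sset_rev4)
  also have "Opp (y - E a) = Opp y - opp.E (rev4 a)"
    by (simp add: opp_eq_iff del: E.simps opp.E.simps)
  finally show ?thesis
    unfolding opp.leads_def .
qed

lemma leads_R:
  assumes "leads (n, 0, 0, n) (A n)" "\<And>k. n = Suc k \<Longrightarrow> leads (k, 0, 0, k) (A k)"
  shows "leads (n, 0, 0, Suc n) (S (int n * (2 * int n - 1)) (R n))"
proof -
  have "Opp (A k) = opp.A k" for k
    by (simp add: opp_eq_iff)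
  then have "opp.leads (Suc n, 0, 0, n) (opp.S (int n * (2 * int n - 1)) (opp.L n))"
    using assms leads_opp[of "(k, 0, 0, k)" "A k" for k] by (intro opp.leads_L) auto
  from leads_unopp[OF this] show ?thesis
    by simp
qed

lemma leads_x1: "leads (0, 0, 1, 0) x1"
  unfolding leads_def by (simp add: S_simps lat.zero binomial_eq_0)

lemma leads_Rp:
  assumes "\<And>k. n = Suc k \<Longrightarrow> leads (k, 0, 0, Suc k) (S (int k * (2 * int k - 1)) (R k))"
  shows "leads (n, 0, 1, n) (S (2 * int n * (int n - 1)) (Rp n))"
proof (cases n)
  case 0
  then show ?thesis using leads_x1 by (simp add: S_simps)
next
  case (Suc k)
  have "2 * int n * (int n - 1) = 3 * int k + int k * (2 * int k - 1)"
    by (simp add: Suc algebra_simps)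
  then show ?thesis
    using leads_P[OF assms[OF Suc]] by (simp add: Suc S_simps)
qed

text \<open>\<open>W_x3_R\<close> has its new factors \<open>x3\<close> and \<open>x2\<close> on the
  left, as \<open>leads_x3_x2\<close> requires. \<open>R k\<close> and \<open>Rp k\<close> in turn
  depend on \<open>A j\<close> with j at most k only, hence the strong induction.\<close>

lemma leads_A: "leads (n, 0, 0, n) (A n)"
proof (induction n rule: less_induct)
  case (less n)
  show ?case
  proof (cases n)
    case 0
    then show ?thesis using leads_A_0 by simp
  next
    case (Suc k)
    have R: "leads (j, 0, 0, Suc j) (S (int j * (2 * int j - 1)) (R j))" if "j \<le> k" for j
      using less Suc that by (intro leads_R) auto
    have "leads (Suc k, 0, 0, Suc k) (S (int k) (x3 * S (int k * (2 * int k - 1)) (R k))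
       - S (2 * int k + 2) (x2 * S (2 * int k * (int k - 1)) (Rp k)))"
      using R by (intro leads_x3_x2 leads_Rp) auto
    also have "S (int k) (x3 * S (int k * (2 * int k - 1)) (R k))
       - S (2 * int k + 2) (x2 * S (2 * int k * (int k - 1)) (Rp k))
       = S (2 * int k * int k) (S (2 * int k) (W (Suc (Suc k))))"
      unfolding W_x3_R by (simp add: S_simps algebra_simps)
    also have "\<dots> = A (Suc k)"
      by (simp add: A_def S_simps algebra_simps del: W.simps)
    finally show ?thesis by (simp add: Suc)
  qed
qed

lemmas leads_L' = leads_L [OF leads_A leads_A]
  and leads_R' = leads_R [OF leads_A leads_A]
  and leads_PA = leads_P [OF leads_A]
  and leads_Rp' = leads_Rp [OF leads_R [OF leads_A leads_A]]

end

section \<open>Further mirror images, and the effect of sigma\<close>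

context pbw
begin

interpretation opp: pbw "\<lambda>k. Opp (Q k)" "Opp x3" "Opp x2" "Opp x1" "Opp x0"
  by (rule pbw_opp)

lemma unopp_R [simp]: "unopp (opp.R n) = L n"
  by (simp add: opp.R_def L_def mult.assoc)

lemma unopp_Rp [simp]: "unopp (opp.Rp n) = Lp n"
  by (cases n) simp_all

lemma leads_Ap: "leads (n, 1, 0, Suc n) (S (3 * int n) (A n * p))"
  using leads_unopp[OF opp.leads_PA[of n]] by simp

lemma leads_Lp: "leads (n, 1, 0, n) (S (2 * int n * (int n - 1)) (Lp n))"
  using leads_unopp[OF opp.leads_Rp'[of n]] by simp

text \<open>In second components these are the six relations with q inverted, products reversed and
  x_i replaced by q^(2i) x_i: they express that sigma is compatible with the relations. Every
  identity in this ring thus comes with its sigma-image.\<close>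

lemma pbw_paired:
  "pbw (\<lambda>k. Paired (Q k) (Q (- k))) (Paired x0 x0) (Paired x1 (S 2 x1)) (Paired x2 (S 4 x2)) (Paired x3 (S 6 x3))"
proof -
  interpret o: central_powers "\<lambda>k. Paired (Q k) (Q (- k))"
  proof
    show "Paired (Q (j + k)) (Q (- (j + k))) = Paired (Q j) (Q (- j)) * Paired (Q k) (Q (- k))" for j k
      by (simp only: paired_eq_iff pfst_simps psnd_simps paired.sel minus_add Q_add simp_thms)
    show "y * Paired (Q k) (Q (- k)) = Paired (Q k) (Q (- k)) * y" for y k
      unfolding paired_eq_iff pfst_simps psnd_simps paired.sel
      by (intro conjI Q_central Q_central [symmetric])
  qed (simp add: paired_eq_iff Q_zero)
  have o_S: "o.S k y = Paired (S k (pfst y)) (S (- k) (psnd y))" for k y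
    unfolding o.S_def S_def paired_eq_iff pfst_simps psnd_simps paired.sel by (intro conjI Q_central HOL.refl)
  show ?thesis
    by unfold_locales (simp_all add: paired_eq_iff o_S normal_order)
qed

interpretation paired: pbw "\<lambda>k. Paired (Q k) (Q (- k))"
    "Paired x0 x0" "Paired x1 (S 2 x1)" "Paired x2 (S 4 x2)" "Paired x3 (S 6 x3)"
  by (rule pbw_paired)

lemma pfst_S [simp]: "pfst (paired.S k y) = S k (pfst y)"
  and psnd_S [simp]: "psnd (paired.S k y) = S (- k) (psnd y)"
  unfolding paired.S_def S_def pfst_simps psnd_simps paired.sel by - (rule HOL.refl Q_central)+

lemma pfst_z [simp]: "pfst paired.z = z" and psnd_z [simp]: "psnd paired.z = S 4 z"
  and pfst_p [simp]: "pfst paired.p = p" and psnd_p [simp]: "psnd paired.p = S 2 p"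
  and pfst_P [simp]: "pfst paired.P = P" and psnd_P [simp]: "psnd paired.P = S 6 P"
  by (simp_all add: paired.z_def z_def paired.p_def p_def paired.P_def P_def normal_order)

lemma pfst_c [simp]: "pfst paired.c = c" and psnd_c [simp]: "psnd paired.c = S 12 c"
  by (simp_all add: paired.c_def c_def P_p S_simps)

lemma pfst_W [simp]: "pfst (paired.W n) = W n"
  and psnd_W [simp]: "psnd (paired.W n) = S (4 * (int n - 1)) (W n)"
proof (induction n rule: W.induct)
  case (3 n)
  { case 1 show ?case by (simp add: 3) }
  { case 2 show ?case unfolding W_left by (simp add: 3 S_simps algebra_simps) }
qed (simp_all add: S_simps)

lemma W_P: "W n * P = S (- 2 * (int n - 1)) (P * W n)"
  by (cases n) (simp_all add: P_W S_simps del: W.simps(3))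

lemma p_W: "p * W n = S (- 2 * (int n - 1)) (W n * p)"
  by (cases n) (simp_all add: W_p S_simps del: W.simps(3))

lemma pfst_L [simp]: "pfst (paired.L n) = L n"
  by (simp add: paired.L_def L_def del: W.simps paired.W.simps)

text \<open>The reversal of products turns the defining formula of \<open>L\<close> into a multiple
  of the right-hand side of \<open>L_mirror\<close>.\<close>

lemma psnd_L [simp]: "psnd (paired.L n) = S (2 * int n + 6) (L n)"
  unfolding L_mirror
  by (simp add: paired.L_def rewrite_right[OF W_P] S_simps algebra_simps del: W.simps paired.W.simps)

lemma pfst_R [simp]: "pfst (paired.R n) = R n"
  by (simp add: paired.R_def R_def del: W.simps paired.W.simps)

lemma psnd_R [simp]: "psnd (paired.R n) = S (2 * int n) (R n)"
  unfolding R_mirror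
  by (simp add: paired.R_def p_W S_simps algebra_simps del: W.simps paired.W.simps)

lemma P_W': "P * W n = S (2 * (int n - 1)) (W n * P)"
  by (simp add: W_P S_simps)

lemma W_p': "W n * p = S (2 * (int n - 1)) (p * W n)"
  by (simp add: p_W S_simps)

lemma L_p: "L n * p = S (2 * int n + 4) (p * L n)"
  by (simp add: L_def W_p' p_comm p_comm [THEN rewrite_right] P_p rewrite_right[OF P_p]
      S_simps algebra_simps del: W.simps)

lemma P_R: "P * R n = S (2 * int n + 4) (R n * P)"
  by (simp add: R_def rewrite_right[OF P_W'] P_comm P_comm [THEN rewrite_right] rewrite_right[OF P_p]
      S_simps algebra_simps del: W.simps)

lemma pfst_Lp [simp]: "pfst (paired.Lp n) = Lp n"
  and psnd_Lp [simp]: "psnd (paired.Lp n) = S 4 (Lp n)"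
  by (cases n; simp add: L_p S_simps)+

lemma pfst_Rp [simp]: "pfst (paired.Rp n) = Rp n"
  and psnd_Rp [simp]: "psnd (paired.Rp n) = S 2 (Rp n)"
  by (cases n; simp add: P_R S_simps)+

text \<open>The exponent for the second component is -N(n,0,0,n) = 8n - 4n^2.\<close>

lemma pfst_A [simp]: "pfst (paired.A n) = A n"
  and psnd_A [simp]: "psnd (paired.A n) = S (4 * int n - 4 * int n * (int n - 1)) (A n)"
  by (simp_all add: paired.A_def A_def S_simps algebra_simps del: W.simps paired.W.simps)

end

section \<open>The root vectors in $U_q(\mathfrak g)$\<close>

text \<open>The elements \<open>F1\<close> and \<open>F2\<close> stand for the generators rescaled by $q - q^{-1}$, which removes
  the denominators from the defining relations.\<close>
locale quantum_affine_sl2 = central_powers Q for Q :: "int \<Rightarrow> 'a :: {ring, monoid_mult}" +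
  fixes E1 E2 F1 F2 K1 K2 K1i K2i :: 'a
  assumes E_F: "E1 * F1 = F1 * E1 + K1 - K1i" "E2 * F2 = F2 * E2 + K2 - K2i"
      "E1 * F2 = F2 * E1" "E2 * F1 = F1 * E2"
    and E_K: "E1 * K1 = S (-2) (K1 * E1)" "E1 * K2 = S 2 (K2 * E1)"
      "E2 * K1 = S 2 (K1 * E2)" "E2 * K2 = S (-2) (K2 * E2)"
    and F_K: "F1 * K1 = S 2 (K1 * F1)" "F1 * K2 = S (-2) (K2 * F1)"
      "F2 * K1 = S (-2) (K1 * F2)" "F2 * K2 = S 2 (K2 * F2)"
    and K_inv: "K1 * K1i = 1" "K1i * K1 = 1" "K2 * K2i = 1" "K2i * K2 = 1"
    and K2_K1: "K2 * K1 = K1 * K2"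
    and serre_E: "E1 * (E1 * (E1 * E2)) - S 2 (E1 * (E1 * (E2 * E1))) - E1 * (E1 * (E2 * E1)) - S (-2) (E1 * (E1 * (E2 * E1)))
        + S 2 (E1 * (E2 * (E1 * E1))) + E1 * (E2 * (E1 * E1)) + S (-2) (E1 * (E2 * (E1 * E1))) = E2 * (E1 * (E1 * E1))"
      "E2 * (E2 * (E2 * E1)) - S 2 (E2 * (E2 * (E1 * E2))) - E2 * (E2 * (E1 * E2)) - S (-2) (E2 * (E2 * (E1 * E2)))
        + S 2 (E2 * (E1 * (E2 * E2))) + E2 * (E1 * (E2 * E2)) + S (-2) (E2 * (E1 * (E2 * E2))) = E1 * (E2 * (E2 * E2))"
    and serre_F: "F1 * (F1 * (F1 * F2)) - S 2 (F1 * (F1 * (F2 * F1))) - F1 * (F1 * (F2 * F1)) - S (-2) (F1 * (F1 * (F2 * F1)))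
        + S 2 (F1 * (F2 * (F1 * F1))) + F1 * (F2 * (F1 * F1)) + S (-2) (F1 * (F2 * (F1 * F1))) = F2 * (F1 * (F1 * F1))"
    and S_cancel3: "S 2 a + a + S (-2) a = 0 \<Longrightarrow> a = 0"
    and S_cancel2: "S 2 a + S (-2) a = 0 \<Longrightarrow> a = 0"
begin

lemma inverse_commute:
  assumes "a * k = S j (k * a)" "k * k' = 1" "k' * k = (1 :: 'a)"
  shows "a * k' = S (- j) (k' * a)"
proof -
  have "S (- j) (k' * (a * k) * k') = S (- j) (k' * S j (k * a) * k')"
    by (simp add: assms(1))
  then show ?thesis
    using assms(2) rewrite_right[OF assms(2)] rewrite_right[OF assms(3)]
    by (simp add: S_simps mult.assoc)
qed

lemma E_Ki: "E1 * K1i = S 2 (K1i * E1)" "E1 * K2i = S (-2) (K2i * E1)"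
    "E2 * K1i = S (-2) (K1i * E2)" "E2 * K2i = S 2 (K2i * E2)"
  and F_Ki: "F1 * K1i = S (-2) (K1i * F1)" "F1 * K2i = S 2 (K2i * F1)"
    "F2 * K1i = S 2 (K1i * F2)" "F2 * K2i = S (-2) (K2i * F2)"
  using E_K [THEN inverse_commute] F_K [THEN inverse_commute] K_inv by simp_all

lemma K_comm: "K2 * K1i = K1i * K2" "K2i * K1 = K1 * K2i" "K2i * K1i = K1i * K2i"
proof -
  show *: "K2 * K1i = K1i * K2"
    using inverse_commute[of K2 K1 0 K1i] K2_K1 K_inv by (simp add: S_0)
  show "K2i * K1 = K1 * K2i"
    using inverse_commute[of K1 K2 0 K2i] K2_K1 K_inv by (simp add: S_0)
  show "K2i * K1i = K1i * K2i"
    using inverse_commute[of K1i K2 0 K2i] * K_inv by (simp add: S_0)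
qed

lemmas pbw_rules = E_F E_K E_Ki F_K F_Ki K_inv K2_K1 K_comm
lemmas normal_order = pbw_rules pbw_rules [THEN rewrite_right] S_simps algebra_simps

definition y where "y = E2 * E1 - S (-2) (E1 * E2)"

fun x :: "nat \<Rightarrow> 'a" where "x 0 = E1" | "x (Suc k) = y * x k - x k * y"
fun e :: "nat \<Rightarrow> 'a" where "e 0 = E2" | "e (Suc k) = e k * y - y * e k"

text \<open>The cubic Serre relation is a nested q-commutator: y is a q-commutator of E_2 and E_1,
  \<open>x 1\<close> is the commutator of y with E_1, and the last step is the stated
  q^2-commutation.\<close>

lemma x1_E1: "x 1 * x 0 = S 2 (x 0 * x 1)"
  using serre_E(1) by (simp add: y_def S_simps algebra_simps)

lemma E2_e1: "e 0 * e 1 = S 2 (e 1 * e 0)"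
  using serre_E(2) by (simp add: y_def S_simps algebra_simps)

sublocale derivation_chain Q x e y
proof
  show "y = e 0 * x 0 - S (-2) (x 0 * e 0)"
    by (simp add: y_def)
qed (fact x1_E1 E2_e1 S_cancel3 S_cancel2 | simp)+

lemma x1_F1: "x 1 * F1 = F1 * x 1 + S 2 (y * K1) - S (-2) (y * K1)"
  by (simp add: y_def normal_order)

lemma y_K1: "y * K1 = K1 * y" "y * K1i = K1i * y"
  by (simp_all add: y_def normal_order)

lemma x1_K: "x 1 * K1 = S (-2) (K1 * x 1)" "x 1 * K1i = S 2 (K1i * x 1)" "x 1 * K2 = S 2 (K2 * x 1)" "x 1 * K2i = S (-2) (K2i * x 1)"
  by (simp_all add: y_def normal_order)

definition TF2 where "TF2 = F1 * F1 * F2 - S 2 (F1 * F2 * F1) - F1 * F2 * F1 + S 2 (F2 * F1 * F1)"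

text \<open>This is a multiple of the T_1-image of the relation between E_2 and F_2. The element
  K_1^2 K_2 is T_1(K_2), and the coefficient q^4 - 2 + q^-4 is (q^2 - q^-2)^2.\<close>

lemma x1_TF2: "x 1 * TF2 = TF2 * x 1 + S 4 (K1 * K1 * K2 - K1i * K1i * K2i)
   - (K1 * K1 * K2 - K1i * K1i * K2i) - (K1 * K1 * K2 - K1i * K1i * K2i) + S (-4) (K1 * K1 * K2 - K1i * K1i * K2i)"
  by (simp add: y_def TF2_def normal_order)

lemma F1_TF2: "F1 * TF2 = S (-2) (TF2 * F1)"
  using serre_F by (simp add: TF2_def S_simps algebra_simps)

lemma TF2_K: "TF2 * K1 = S 2 (K1 * TF2)" "TF2 * K1i = S (-2) (K1i * TF2)"
    "TF2 * K2 = S (-2) (K2 * TF2)" "TF2 * K2i = S 2 (K2i * TF2)"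
  by (simp_all add: TF2_def normal_order)

text \<open>\<open>TE1\<close> is $(q - q^{-1}) T_1(E_1)$; \<open>TF2\<close>, \<open>TTE1\<close> and \<open>TTE2\<close> are multiples of $T_1(F_2)$,
  $T_1 T_2 (E_1)$ and $T_1 T_2 (E_2)$.\<close>
definition TE1 where "TE1 = - (K1i * F1)"
definition TTE1 where "TTE1 = TE1 * x 1 * x 1 - x 1 * TE1 * x 1 - S (-2) (x 1 * TE1 * x 1) + S (-2) (x 1 * x 1 * TE1)"
definition TTE2 where "TTE2 = - (K1i * K1i * K2i * TF2)"

text \<open>The q-commutator of \<open>TE1\<close> and \<open>x 1\<close> is (q^2 - q^-2) y, so the
  double q-commutator is this multiple of [y, x_1] = x_2.\<close>

lemma TTE1_eq: "TTE1 = S 2 (x 2) - S (-2) (x 2)"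
proof -
  define w where "w = x 1"
  have w: "w * F1 = F1 * w + S 2 (K1 * y) - S (-2) (K1 * y)" "w * K1 = S (-2) (K1 * w)" "w * K1i = S 2 (K1i * w)"
    using x1_F1 x1_K y_K1 by (simp_all add: w_def)
  have x2: "x 2 = y * w - w * y"
    by (simp add: w_def numeral_2_eq_2)
  show ?thesis
    unfolding TTE1_def TE1_def x2 w_def [symmetric]
    by (simp add: w w [THEN rewrite_right] K_inv K_inv [THEN rewrite_right] S_simps algebra_simps)
qed

lemma TE1_TF2: "TE1 * TF2 = TF2 * TE1"
  unfolding TE1_def
  by (simp add: F1_TF2 F1_TF2 [THEN rewrite_right] TF2_K TF2_K [THEN rewrite_right] S_simps algebra_simps)

text \<open>Up to scalars this is T_1 T_2 (y) = y. The right-hand side is the binomial expansion of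
  (q^2 - q^-2)^4 y.\<close>

lemma TTE2_TTE1: "TTE2 * TTE1 - S (-2) (TTE1 * TTE2)
    = S 8 y - S 4 y - S 4 y - S 4 y - S 4 y + y + y + y + y + y + y - S (-4) y - S (-4) y - S (-4) y - S (-4) y + S (-8) y"
proof -
  define w where "w = x 1"
  define k where "k = K1 * K1 * K2"
  define k' where "k' = K1i * K1i * K2i"
  have w: "w * TF2 = TF2 * w + S 4 k - S 4 k' - k - k + k' + k' + S (-4) k - S (-4) k'"
    using x1_TF2 by (simp add: w_def k_def k'_def S_simps algebra_simps)
  have kk: "k' * k = 1"
    by (simp add: k_def k'_def normal_order)
  have kk': "w * k = S (-2) (k * w)" "w * k' = S 2 (k' * w)"
    "TE1 * k = S 2 (k * TE1)" "TE1 * k' = S (-2) (k' * TE1)"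
    unfolding w_def k_def k'_def TE1_def
    by (simp_all add: x1_K [unfolded One_nat_def] x1_K [unfolded One_nat_def, THEN rewrite_right] normal_order del: x.simps)
  define t where "t = TE1 * w - S (-2) (w * TE1)"
  have t: "t = S 2 y - S (-2) y"
    unfolding t_def TE1_def w_def
    by (simp add: x1_F1 [unfolded One_nat_def] x1_K [unfolded One_nat_def] x1_K [unfolded One_nat_def, THEN rewrite_right]
      y_K1 y_K1 [THEN rewrite_right] K_inv K_inv [THEN rewrite_right] S_simps algebra_simps del: x.simps)
  \<comment> \<open>The terms with \<open>TF2\<close> and those with a product of two copies of
    \<open>k'\<close> cancel; since \<open>k' * k\<close> is 1, only words in \<open>TE1\<close> and
    w remain, and these regroup into multiples of t.\<close>
  have "TTE2 * TTE1 - S (-2) (TTE1 * TTE2)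
     = k' * k * (S 6 (TE1 * w) - S 4 (w * TE1) - S 2 (TE1 * w) - S 2 (TE1 * w) - S 2 (TE1 * w)
       + w * TE1 + w * TE1 + w * TE1 + S (-2) (TE1 * w) + S (-2) (TE1 * w) + S (-2) (TE1 * w)
       - S (-4) (w * TE1) - S (-4) (w * TE1) - S (-4) (w * TE1) - S (-6) (TE1 * w) + S (-8) (w * TE1))"
    unfolding TTE2_def TTE1_def k'_def [symmetric] w_def [symmetric]
    by (simp add: w w [THEN rewrite_right] kk' kk' [THEN rewrite_right] TE1_TF2 TE1_TF2 [THEN rewrite_right] S_simps algebra_simps)
  also have "\<dots> = S 6 t - S 2 t - S 2 t - S 2 t + S (-2) t + S (-2) t + S (-2) t - S (-6) t"
    unfolding t_def kk by (simp add: S_simps algebra_simps)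
  finally show ?thesis
    unfolding t by (simp add: S_simps)
qed

end

section \<open>Arithmetic in Q(q)\<close>

lemma Fract_of_int: "(of_int k :: 'a :: idom fract) = Fraction_Field.Fract (of_int k) 1"
proof -
  have n: "(of_nat n :: 'a fract) = Fraction_Field.Fract (of_nat n) 1" for n
    by (induction n) (simp_all add: Zero_fract_def One_fract_def)
  show ?thesis
    by (cases k) (simp_all add: n One_fract_def)
qed

lemma evq_qq: "evq p qq = Fraction_Field.Fract (map_poly of_int p) 1"
proof (induction p)
  case (pCons a p)
  have "evq (pCons a p) qq = of_int a + qq * evq p qq"
    using pCons(1) by (simp add: evq_def map_poly_pCons)
  also have "\<dots> = Fraction_Field.Fract (pCons (of_int a) (map_poly of_int p)) 1"
    unfolding pCons.IH by (simp add: Fract_of_int qq_def of_int_poly)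
  finally show ?case
    using pCons(1) by (simp add: map_poly_pCons)
qed (simp add: evq_def Zero_fract_def)

lemma evq_qq_eq_iff: "evq p qq = evq r qq \<longleftrightarrow> p = r"
proof
  assume "evq p qq = evq r qq"
  then have "(map_poly of_int p :: rat poly) = map_poly of_int r"
    by (simp add: evq_qq eq_fract)
  then show "p = r"
    by (metis coeff_map_poly of_int_0 of_int_eq_iff poly_eqI)
qed simp

lemma evq_diff: "evq (p - r) x = evq p x - evq r x"
proof -
  have "map_poly of_int (p - r) = (map_poly of_int p - map_poly of_int r :: fq poly)"
    by (intro poly_eqI) (simp add: coeff_map_poly)
  then show ?thesis by (simp add: evq_def)
qed

lemma evq_add: "evq (p + r) x = evq p x + evq r x"
  using evq_diff[of "p + r" r x] by simp

lemma evq_mult: "evq (p * r) x = evq p x * evq r x"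
proof -
  have "map_poly of_int (p * r) = (map_poly of_int p * map_poly of_int r :: fq poly)"
    by (intro poly_eqI) (simp add: coeff_map_poly coeff_mult)
  then show ?thesis by (simp add: evq_def)
qed

lemma evq_0: "evq 0 x = 0"
  and evq_monom: "evq (monom 1 n) x = x ^ n"
  by (simp_all add: evq_def map_poly_monom poly_monom)

lemma qq_nonzero: "qq \<noteq> 0"
  by (simp add: qq_def Zero_fract_def eq_fract)

lemma qpow_add: "qpow (j + k) = qpow j * qpow k"
  using qq_nonzero by (simp add: qpow_def power_int_add)

lemma qpow_0: "qpow 0 = 1"
  by (simp add: qpow_def)

lemma qpow_nonzero: "qpow k \<noteq> 0"
  using qq_nonzero by (simp add: qpow_def)

lemma evq_inverse_qq: "qq ^ degree p * evq p (inverse qq) = evq (reflect_poly p) qq"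
proof -
  have "map_poly of_int (reflect_poly p) = reflect_poly (map_poly of_int p :: fq poly)"
    by (intro poly_eqI) (simp add: coeff_map_poly coeff_reflect_poly degree_map_poly)
  then show ?thesis
    unfolding evq_def using qq_nonzero by (simp add: poly_reflect_poly_nz degree_map_poly)
qed

text \<open>Bar invariance makes q^(deg p) p(q) the reversed polynomial of p, whose degree is at
  most deg p. Hence p is constant, and its constant term vanishes.\<close>

lemma evq_bar_invariant:
  assumes "coeff p 0 = 0" "evq p (inverse qq) = evq p qq"
  shows "p = 0"
proof (rule ccontr)
  assume "p \<noteq> 0"
  have "evq (monom 1 (degree p) * p) qq = evq (reflect_poly p) qq"
    using assms(2) evq_inverse_qq[of p] by (simp add: evq_mult evq_monom)
  then have *: "monom 1 (degree p) * p = reflect_poly p"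
    by (simp only: evq_qq_eq_iff)
  have "degree p + degree p = degree (monom 1 (degree p) * p)"
    using \<open>p \<noteq> 0\<close> by (simp add: degree_mult_eq degree_monom_eq)
  also have "\<dots> \<le> degree p"
    unfolding * by (rule degree_reflect_poly_le)
  finally have "degree p = 0" by simp
  then show False
    using assms(1) \<open>p \<noteq> 0\<close> by (metis leading_coeff_0_iff)
qed

text \<open>A power of q turns each expression into a nonzero integer polynomial in q. The name
  \<open>quantum_4_nonzero\<close> refers to q^2 + q^-2 = [4]/[2].\<close>

lemma quantum_3_nonzero: "qpow 2 + 1 + qpow (-2) \<noteq> 0"
  and quantum_4_nonzero: "qpow 2 + qpow (-2) \<noteq> 0"
  and qq_minus_inverse_nonzero: "qq - inverse qq \<noteq> 0"
  and quantum_2_nonzero: "qq + inverse qq \<noteq> 0"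
proof -
  have nz: "evq p qq \<noteq> 0" if "p \<noteq> 0" for p
    using evq_qq_eq_iff[of p 0] that by (simp add: evq_0)
  have "qq ^ 4 + qq ^ 2 + 1 \<noteq> 0"
    using nz[of "[:1,0,1,0,1:]"] by (simp add: evq_def map_poly_pCons algebra_simps power2_eq_square power4_eq_xxxx)
  then show "qpow 2 + 1 + qpow (-2) \<noteq> 0"
    using qq_nonzero by (auto simp: qpow_def power_int_minus field_simps power2_eq_square power4_eq_xxxx)
  have "qq ^ 4 + 1 \<noteq> 0"
    using nz[of "[:1,0,0,0,1:]"] by (simp add: evq_def map_poly_pCons algebra_simps power2_eq_square power4_eq_xxxx)
  then show "qpow 2 + qpow (-2) \<noteq> 0"
    using qq_nonzero by (auto simp: qpow_def power_int_minus field_simps power2_eq_square power4_eq_xxxx)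
  have "qq ^ 2 - 1 \<noteq> 0"
    using nz[of "[:-1,0,1:]"] by (simp add: evq_def map_poly_pCons algebra_simps power2_eq_square)
  then show "qq - inverse qq \<noteq> 0"
    using qq_nonzero by (auto simp: field_simps power2_eq_square)
  have "qq ^ 2 + 1 \<noteq> 0"
    using nz[of "[:1,0,1:]"] by (simp add: evq_def map_poly_pCons algebra_simps power2_eq_square)
  then show "qq + inverse qq \<noteq> 0"
    using qq_nonzero by (auto simp: field_simps power2_eq_square)
qed

lemma qint_1: "qint 1 = 1"
  using qq_minus_inverse_nonzero by (simp add: qint_def qpow_def)

lemma qint_2: "qint 2 = qq + inverse qq"
proof -
  have "qpow 2 - qpow (-2) = (qq + inverse qq) * (qq - inverse qq)"
    using qq_nonzero by (simp add: qpow_def power_int_minus field_simps power2_eq_square)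
  then show ?thesis
    unfolding qint_def using qq_minus_inverse_nonzero by simp
qed

lemma qint_3: "qint 3 = qpow 2 + 1 + qpow (-2)"
proof -
  have "qpow 3 - qpow (-3) = (qpow 2 + 1 + qpow (-2)) * (qq - inverse qq)"
    using qq_nonzero by (simp add: qpow_def power_int_minus field_simps power2_eq_square power3_eq_cube)
  then show ?thesis
    unfolding qint_def using qq_minus_inverse_nonzero by simp
qed

lemma qfact_small: "qfact 0 = 1" "qfact 1 = 1" "qfact 2 = qint 2"
  by (simp_all add: qfact_def qint_1 numeral_2_eq_2)

section \<open>The quotient \<open>U\<close> as an algebra over Q(q)\<close>

lemma sc_add: "sc (a + b) = sc a + sc b"
  by transfer (rule ueq.sym, rule ueq.sc_add)

lemma sc_mult: "sc (a * b) = sc a * sc b"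
  by transfer (rule ueq.sym, rule ueq.sc_mul)

lemma sc_0: "sc 0 = 0"
  by transfer (rule ueq.refl)

lemma sc_1: "sc 1 = 1"
  by transfer (rule ueq.refl)

lemma sc_minus: "sc (- a) = - sc a"
  using sc_add[of a "- a"] by (simp add: sc_0 eq_neg_iff_add_eq_0 add.commute)

lemma sc_diff: "sc (a - b) = sc a - sc b"
  using sc_add[of a "- b"] by (simp add: sc_minus)

lemma sc_commute: "x * sc a = sc a * x"
  by transfer (rule ueq.sym, rule ueq.sc_central)

lemma sc_left_commute: "x * (sc a * y) = sc a * (x * y)"
  by (metis sc_commute mult.assoc)

lemma sc_sc: "sc a * (sc b * x) = sc (a * b) * x"
  by (simp add: sc_mult mult.assoc)

lemma sc_cancel: "a \<noteq> 0 \<Longrightarrow> sc a * x = sc a * y \<longleftrightarrow> x = y"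
  by (metis sc_sc left_inverse sc_1 mult_1_left)

lemma abs_U_simps [simp]:
  "abs_U (a \<oplus> b) = abs_U a + abs_U b" "abs_U (a \<odot> b) = abs_U a * abs_U b" "abs_U (Sc r) = sc r"
  by (simp_all add: plus_U.abs_eq times_U.abs_eq sc.abs_eq)

lemma abs_U_esub: "abs_U (esub a b) = abs_U a - abs_U b"
  by (simp add: esub_def minus_U.abs_eq)

lemma ueq_abs_U: "ueq a b \<Longrightarrow> abs_U a = abs_U b"
  by (simp add: U.abs_eq_iff)

abbreviation "UE i \<equiv> abs_U (eE i)"
abbreviation "UF i \<equiv> abs_U (eF i)"
abbreviation "UK i \<equiv> abs_U (eK i)"
abbreviation "UKi i \<equiv> abs_U (eKi i)"

definition qd :: fq where "qd = qq - inverse qq"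

abbreviation "UFs i \<equiv> sc qd * UF i"

lemma qd_nonzero: "qd \<noteq> 0"
  using qq_minus_inverse_nonzero by (simp add: qd_def)

interpretation US: central_powers "\<lambda>k. sc (qpow k)"
  by unfold_locales (simp_all only: qpow_add sc_mult qpow_0 sc_1, rule sc_commute)

lemma US_S: "US.S k x = sc (qpow k) * x"
  by (simp add: US.S_def)

lemma U_EF: "UE i * UFs j = UFs j * UE i + (if i = j then UK i - UKi i else 0)"
proof -
  have "UE i * UF j - UF j * UE i = (if i = j then sc (inverse qd) * (UK i - UKi i) else 0)"
    using ueq_abs_U[OF ueq.rel_EF[of i j]] by (auto simp: abs_U_esub qd_def sc_0)
  then have "UE i * UF j = UF j * UE i + (if i = j then sc (inverse qd) * (UK i - UKi i) else 0)"
    by (simp add: algebra_simps)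
  then have "sc qd * (UE i * UF j) = sc qd * (UF j * UE i) + (if i = j then UK i - UKi i else 0)"
    using qd_nonzero by (simp add: distrib_left sc_sc sc_1 del: sc_cancel)
  then show ?thesis
    by (simp add: sc_left_commute [of "UE i"] mult.assoc)
qed

lemma U_Kinv: "UK i * UKi i = 1" "UKi i * UK i = 1"
  using ueq_abs_U[OF ueq.rel_Kinv1] ueq_abs_U[OF ueq.rel_Kinv2] by (simp_all add: sc_1)

lemma commute_from_conjugation:
  assumes "k * a * k' = sc (qpow j) * a" "k' * k = 1"
  shows "a * k = US.S (- j) (k * a)"
proof -
  have "k * a = (k * a * k') * k"
    using assms(2) by (simp add: mult.assoc)
  also have "\<dots> = sc (qpow j) * (a * k)"
    unfolding assms(1) by (simp add: mult.assoc)
  finally show ?thesis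
    by (simp add: US_S sc_sc qpow_add [symmetric] qpow_0 sc_1)
qed

lemma U_EK: "UE j * UK i = US.S (- cartan i j) (UK i * UE j)"
  and U_FK: "UFs j * UK i = US.S (cartan i j) (UK i * UFs j)"
proof -
  show "UE j * UK i = US.S (- cartan i j) (UK i * UE j)"
    using ueq_abs_U[OF ueq.rel_KE[of i j]] U_Kinv by (intro commute_from_conjugation) simp_all
  have "UF j * UK i = US.S (- (- cartan i j)) (UK i * UF j)"
    using ueq_abs_U[OF ueq.rel_KF[of i j]] U_Kinv by (intro commute_from_conjugation) simp_all
  then have "sc qd * (UF j * UK i) = sc (qd * qpow (cartan i j)) * (UK i * UF j)"
    by (simp add: US_S sc_sc)
  then show "UFs j * UK i = US.S (cartan i j) (UK i * UFs j)"
    unfolding US_S mult.assoc sc_left_commute [of "UK i"] sc_sc by (simp only: mult.commute)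
qed

lemma U_serre:
  assumes "abs_U (serre a b) = 0"
  shows "abs_U a * (abs_U a * (abs_U a * abs_U b)) - US.S 2 (abs_U a * (abs_U a * (abs_U b * abs_U a)))
      - abs_U a * (abs_U a * (abs_U b * abs_U a)) - US.S (-2) (abs_U a * (abs_U a * (abs_U b * abs_U a)))
      + US.S 2 (abs_U a * (abs_U b * (abs_U a * abs_U a))) + abs_U a * (abs_U b * (abs_U a * abs_U a))
      + US.S (-2) (abs_U a * (abs_U b * (abs_U a * abs_U a))) = abs_U b * (abs_U a * (abs_U a * abs_U a))"
  using assms
  by (simp add: serre_def esum_def numeral_3_eq_3 numeral_2_eq_2 US_S sc_minus sc_diff sc_1 sc_0 qint_3 [unfolded numeral_3_eq_3 numeral_2_eq_2] sc_add algebra_simps)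


lemma scaled_word4: "(sc r * a) * ((sc r * b) * ((sc r * d) * (sc r * f))) = sc (r ^ 4) * (a * (b * (d * f)))"
  by (simp add: mult.assoc sc_left_commute [of a] sc_left_commute [of b] sc_left_commute [of d] sc_sc power4_eq_xxxx)

interpretation UQ: quantum_affine_sl2 "\<lambda>k. sc (qpow k)" "UE I1" "UE I2" "UFs I1" "UFs I2" "UK I1" "UK I2" "UKi I1" "UKi I2"
proof
  show "UE I1 * UFs I1 = UFs I1 * UE I1 + UK I1 - UKi I1" "UE I2 * UFs I2 = UFs I2 * UE I2 + UK I2 - UKi I2"
    "UE I1 * UFs I2 = UFs I2 * UE I1" "UE I2 * UFs I1 = UFs I1 * UE I2"
    by (subst U_EF; simp)+
  show "UE I1 * UK I1 = US.S (-2) (UK I1 * UE I1)" "UE I1 * UK I2 = US.S 2 (UK I2 * UE I1)"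
    "UE I2 * UK I1 = US.S 2 (UK I1 * UE I2)" "UE I2 * UK I2 = US.S (-2) (UK I2 * UE I2)"
    by (subst U_EK; simp add: cartan_def)+
  show "UFs I1 * UK I1 = US.S 2 (UK I1 * UFs I1)" "UFs I1 * UK I2 = US.S (-2) (UK I2 * UFs I1)"
    "UFs I2 * UK I1 = US.S (-2) (UK I1 * UFs I2)" "UFs I2 * UK I2 = US.S 2 (UK I2 * UFs I2)"
    by (subst U_FK; simp add: cartan_def)+
  show "UK I1 * UKi I1 = 1" "UKi I1 * UK I1 = 1" "UK I2 * UKi I2 = 1" "UKi I2 * UK I2 = 1"
    by (rule U_Kinv)+
  show "UK I2 * UK I1 = UK I1 * UK I2"
    using ueq_abs_U[OF ueq.rel_KK] by simp
  show "UE I1 * (UE I1 * (UE I1 * UE I2)) - US.S 2 (UE I1 * (UE I1 * (UE I2 * UE I1))) -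
    UE I1 * (UE I1 * (UE I2 * UE I1)) - US.S (- 2) (UE I1 * (UE I1 * (UE I2 * UE I1))) +
    US.S 2 (UE I1 * (UE I2 * (UE I1 * UE I1))) + UE I1 * (UE I2 * (UE I1 * UE I1)) +
    US.S (- 2) (UE I1 * (UE I2 * (UE I1 * UE I1))) = UE I2 * (UE I1 * (UE I1 * UE I1))"
    using ueq_abs_U[OF ueq.rel_serreE[of I1 I2]] by (intro U_serre) (simp add: sc_0)
  show "UE I2 * (UE I2 * (UE I2 * UE I1)) - US.S 2 (UE I2 * (UE I2 * (UE I1 * UE I2))) -
    UE I2 * (UE I2 * (UE I1 * UE I2)) - US.S (- 2) (UE I2 * (UE I2 * (UE I1 * UE I2))) +
    US.S 2 (UE I2 * (UE I1 * (UE I2 * UE I2))) + UE I2 * (UE I1 * (UE I2 * UE I2)) +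
    US.S (- 2) (UE I2 * (UE I1 * (UE I2 * UE I2))) = UE I1 * (UE I2 * (UE I2 * UE I2))"
    using ueq_abs_U[OF ueq.rel_serreE[of I2 I1]] by (intro U_serre) (simp add: sc_0)
  show "UFs I1 * (UFs I1 * (UFs I1 * UFs I2)) - US.S 2 (UFs I1 * (UFs I1 * (UFs I2 * UFs I1))) -
    UFs I1 * (UFs I1 * (UFs I2 * UFs I1)) - US.S (- 2) (UFs I1 * (UFs I1 * (UFs I2 * UFs I1))) +
    US.S 2 (UFs I1 * (UFs I2 * (UFs I1 * UFs I1))) + UFs I1 * (UFs I2 * (UFs I1 * UFs I1)) +
    US.S (- 2) (UFs I1 * (UFs I2 * (UFs I1 * UFs I1))) = UFs I2 * (UFs I1 * (UFs I1 * UFs I1))"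
  proof -
    have "abs_U (serre (eF I1) (eF I2)) = 0"
      using ueq_abs_U[OF ueq.rel_serreF[of I1 I2]] by (simp add: sc_0)
    from arg_cong[OF U_serre[OF this], of "\<lambda>t. sc (qd ^ 4) * t"] show ?thesis
      unfolding scaled_word4 by (simp only: distrib_left right_diff_distrib US.S_mult_right)
  qed
  show "a = 0" if "US.S 2 a + a + US.S (- 2) a = 0" for a
  proof -
    have "sc (qpow 2 + 1 + qpow (-2)) * a = sc (qpow 2 + 1 + qpow (-2)) * 0"
      using that by (simp add: US_S sc_add sc_1 distrib_right)
    then show ?thesis
      by (simp only: sc_cancel [OF quantum_3_nonzero])
  qed
  show "a = 0" if "US.S 2 a + US.S (- 2) a = 0" for a
  proof -
    have "sc (qpow 2 + qpow (-2)) * a = sc (qpow 2 + qpow (-2)) * 0"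
      using that by (simp add: US_S sc_add sc_1 distrib_right)
    then show ?thesis
      by (simp only: sc_cancel [OF quantum_4_nonzero])
  qed
qed


section \<open>Root vectors obtained from Lusztig's automorphisms\<close>

text \<open>The map h ranges over \<open>abs_U\<close> preceded by no, one or two of the T_i, so one
  computation covers T_1(E_2), T_1 T_2 (E_1) and T_1 T_2 T_1 (E_2). The factor [2] clears the
  divided squares.\<close>

lemma reflect_T_E:
  assumes "\<And>a b. h (a \<oplus> b) = h a + h b" "\<And>a b. h (a \<odot> b) = h a * h b" "\<And>r. h (Sc r) = sc r" "i \<noteq> j"
  shows "sc (qint 2) * h (Tx i (eE j)) = (h (eE j) * h (eE i) - US.S (-2) (h (eE i) * h (eE j))) * h (eE i)
     - h (eE i) * (h (eE j) * h (eE i) - US.S (-2) (h (eE i) * h (eE j)))"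
proof -
  have l: "[0..<3] = [0, 1, 2]"
    by (simp add: upt_rec)
  have c1: "qint 2 * qpow (-1) = 1 + qpow (-2)"
    using qq_nonzero by (simp add: qint_2 qpow_def power_int_minus field_simps power2_eq_square)
  have c2: "qint 2 * inverse (qint 2) = 1"
    using quantum_2_nonzero by (simp add: qint_2)
  have c3: "qint 2 * (qpow (-2) * inverse (qint 2)) = qpow (-2)"
    using quantum_2_nonzero by (simp add: qint_2)
  have qf: "qfact 0 = 1" "qfact (Suc 0) = 1" "qfact (Suc (Suc 0)) = qint 2"
    using qfact_small by (simp_all add: numeral_2_eq_2)
  define a where "a = h (eE i)"
  define b where "b = h (eE j)"
  have "h (Tx i (eE j)) = sc (inverse (qint 2)) * (b * (a * a)) - sc (qpow (-1)) * (a * (b * a))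
      + sc (qpow (-2) * inverse (qint 2)) * (a * (a * b))"
    using assms(4) unfolding a_def b_def
    by (simp add: eE_def [of j] assms(1-3) l esum_def dpow_def qf qpow_0 sc_1 sc_0 sc_minus sc_sc
        sc_left_commute [of "h (eE i)"] sc_left_commute [of "h (Gen (GE j))"] numeral_2_eq_2 mult.assoc)
  then have "sc (qint 2) * h (Tx i (eE j)) = b * (a * a) - a * (b * a) - US.S (-2) (a * (b * a)) + US.S (-2) (a * (a * b))"
    by (simp add: distrib_left right_diff_distrib sc_sc c1 c2 c3 sc_add distrib_right sc_1 US_S)
  then show ?thesis
    by (simp add: a_def b_def US.S_simps algebra_simps)
qed

lemma reflect_T_F:
  assumes "\<And>a b. h (a \<oplus> b) = h a + h b" "\<And>a b. h (a \<odot> b) = h a * h b" "\<And>r. h (Sc r) = sc r" "i \<noteq> j"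
  shows "sc (qint 2) * h (Tx i (eF j)) = h (eF i) * (h (eF i) * h (eF j)) - US.S 2 (h (eF i) * (h (eF j) * h (eF i)))
     - h (eF i) * (h (eF j) * h (eF i)) + US.S 2 (h (eF j) * (h (eF i) * h (eF i)))"
proof -
  have l: "[0..<3] = [0, 1, 2]"
    by (simp add: upt_rec)
  have c1: "qint 2 * qpow 1 = 1 + qpow 2"
    using qq_nonzero by (simp add: qint_2 qpow_def power_int_minus field_simps power2_eq_square)
  have c2: "qint 2 * inverse (qint 2) = 1"
    using quantum_2_nonzero by (simp add: qint_2)
  have c3: "qint 2 * (qpow 2 * inverse (qint 2)) = qpow 2"
    using quantum_2_nonzero by (simp add: qint_2)
  have qf: "qfact 0 = 1" "qfact (Suc 0) = 1" "qfact (Suc (Suc 0)) = qint 2"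
    using qfact_small by (simp_all add: numeral_2_eq_2)
  define a where "a = h (eF i)"
  define b where "b = h (eF j)"
  have "h (Tx i (eF j)) = sc (inverse (qint 2)) * (a * (a * b)) - sc (qpow 1) * (a * (b * a))
      + sc (qpow 2 * inverse (qint 2)) * (b * (a * a))"
    using assms(4) unfolding a_def b_def
    by (simp add: eF_def [of j] assms(1-3) l esum_def dpow_def qf qpow_0 sc_1 sc_0 sc_minus sc_sc
        sc_left_commute [of "h (eF i)"] sc_left_commute [of "h (Gen (GF j))"] numeral_2_eq_2 mult.assoc)
  then have "sc (qint 2) * h (Tx i (eF j)) = a * (a * b) - a * (b * a) - US.S 2 (a * (b * a)) + US.S 2 (b * (a * a))"
    by (simp add: distrib_left right_diff_distrib sc_sc c1 c2 c3 sc_add distrib_right sc_1 US_S)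
  then show ?thesis
    by (simp add: a_def b_def US.S_simps algebra_simps)
qed

lemma US_S_sc: "US.S k (sc r * a) = sc r * US.S k a"
  by (simp add: US_S sc_sc mult.commute)

lemma sc_mult_sc: "(sc r * a) * (sc t * b) = sc (r * t) * (a * b)"
  by (simp only: mult.assoc sc_left_commute [of a] sc_sc)

lemma qpow_2_diff: "qpow 2 - qpow (-2) = qd * qint 2"
  using qq_nonzero by (simp add: qint_2 qd_def qpow_def power_int_minus field_simps power2_eq_square)

lemma qint_2_nonzero: "qint 2 \<noteq> 0"
  using quantum_2_nonzero by (simp add: qint_2)

lemma v_0: "v 0 = UQ.x 0"
  by (simp add: v_def vexpr_def)

lemma v_1: "UQ.x 1 = sc (qint 2) * v 1"
  using reflect_T_E[of abs_U I1 I2] by (simp add: v_def vexpr_def UQ.y_def)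

definition T1 :: "expr \<Rightarrow> U" where "T1 a = abs_U (Tx I1 a)"

lemma T1_simps [simp]: "T1 (a \<oplus> b) = T1 a + T1 b" "T1 (a \<odot> b) = T1 a * T1 b" "T1 (Sc r) = sc r"
  by (simp_all add: T1_def)

lemma T1_E1: "UQ.TE1 = sc qd * T1 (eE I1)"
proof -
  have "T1 (eE I1) = - (UKi I1 * UF I1)"
    by (simp add: T1_def eE_def eKi_def eF_def sc_minus sc_1)
  then show ?thesis
    unfolding UQ.TE1_def by (simp add: sc_left_commute [of "UKi I1"])
qed

lemma T1_E2: "T1 (eE I2) = v 1"
  by (simp add: T1_def v_def vexpr_def)

lemma T1_F2: "UQ.TF2 = sc (qd ^ 3 * qint 2) * T1 (eF I2)"
proof -
  have "sc (qd ^ 3) * (sc (qint 2) * T1 (eF I2)) = UQ.TF2"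
    unfolding T1_def UQ.TF2_def
    by (subst reflect_T_F[of abs_U I1 I2])
       (simp_all add: distrib_left right_diff_distrib mult.assoc sc_left_commute [of "UF i" for i] sc_sc US_S mult.commute
          power3_eq_cube)
  then show ?thesis
    by (simp add: sc_sc)
qed

text \<open>The factor q - q^-1 comes from \<open>TE1\<close>, two factors [2] from the two copies
  of \<open>x 1\<close> = [2] v_1, and the third from \<open>reflect_T_E\<close>.\<close>

lemma T1_T2_E1: "UQ.TTE1 = sc (qd * qint 2 ^ 3) * v 2"
proof -
  have v: "v 2 = T1 (Tx I2 (eE I1))"
    by (simp add: v_def vexpr_def T1_def)
  define a where "a = T1 (eE I1)"
  have "sc (qd * qint 2 ^ 3) * v 2 = sc (qd * qint 2 ^ 2) * (sc (qint 2) * v 2)"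
    by (simp add: sc_sc power2_eq_square power3_eq_cube mult.assoc)
  also have "sc (qint 2) * v 2 = (a * v 1 - US.S (-2) (v 1 * a)) * v 1 - v 1 * (a * v 1 - US.S (-2) (v 1 * a))"
    unfolding v a_def T1_E2 [symmetric] by (rule reflect_T_E) simp_all
  finally have r: "sc (qd * qint 2 ^ 3) * v 2 = sc (qd * qint 2 ^ 2)
      * ((a * v 1 - US.S (-2) (v 1 * a)) * v 1 - v 1 * (a * v 1 - US.S (-2) (v 1 * a)))" .
  have e: "qd * qint 2 * qint 2 = qd * qint 2 ^ 2" "qint 2 * qd * qint 2 = qd * qint 2 ^ 2"
    "qint 2 * qint 2 * qd = qd * qint 2 ^ 2"
    by (simp_all add: power2_eq_square)
  show ?thesis
    unfolding UQ.TTE1_def v_1 T1_E1 r a_def [symmetric] sc_mult_sc e US_S_sc right_diff_distrib [symmetric] distrib_left [symmetric]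
    by (intro arg_cong [of _ _ "\<lambda>t. sc (qd * qint 2 ^ 2) * t"]) (simp add: US.S_simps algebra_simps)
qed

lemma v_2: "UQ.x 2 = sc (qint 2 ^ 2) * v 2"
proof -
  have "sc (qd * qint 2) * UQ.x 2 = sc (qd * qint 2) * (sc (qint 2 ^ 2) * v 2)"
    using UQ.TTE1_eq unfolding T1_T2_E1 US_S left_diff_distrib [symmetric] sc_diff [symmetric] qpow_2_diff
    by (simp add: sc_sc power2_eq_square power3_eq_cube mult.assoc)
  then show ?thesis
    using qd_nonzero qint_2_nonzero by (simp add: sc_cancel)
qed

lemma T1_T2_E2: "UQ.TTE2 = sc (qd ^ 3 * qint 2) * T1 (Tx I2 (eE I2))"
proof -
  have "T1 (Tx I2 (eE I2)) = - (UKi I1 * UKi I1 * UKi I2 * T1 (eF I2))"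
    by (simp add: eE_def eKi_def eF_def T1_def sc_minus sc_1 kpow_def cartan_def mult.assoc numeral_2_eq_2)
  then show ?thesis
    unfolding UQ.TTE2_def T1_F2 by (simp add: sc_left_commute [of "UKi I1 * UKi I1 * UKi I2"])
qed

text \<open>The left-hand side is the image of y = E_2 E_1 - q^-2 E_1 E_2 under T_1 T_2; the common
  factor (q^2 - q^-2)^4 of \<open>TTE2_TTE1\<close> is cancelled.\<close>

lemma T1_T2_y: "T1 (Tx I2 (eE I2)) * v 2 - US.S (-2) (v 2 * T1 (Tx I2 (eE I2))) = UQ.y"
proof -
  have "(qpow 2 - qpow (-2)) ^ 4 = qpow 8 - qpow 4 - qpow 4 - qpow 4 - qpow 4 + (1 + 1 + 1 + 1 + 1 + 1) - qpow (-4) - qpow (-4)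
     - qpow (-4) - qpow (-4) + qpow (-8)"
    using qq_nonzero by (simp add: qpow_def power_int_minus field_simps power4_eq_xxxx eval_nat_numeral)
  then have "sc ((qd * qint 2) ^ 4) * UQ.y = UQ.TTE2 * UQ.TTE1 - US.S (-2) (UQ.TTE1 * UQ.TTE2)"
    unfolding UQ.TTE2_TTE1 qpow_2_diff [symmetric]
    by (simp only: sc_add sc_diff distrib_right left_diff_distrib US_S sc_1 mult_1_left add.assoc [symmetric] add_diff_eq)
  also have "\<dots> = sc ((qd * qint 2) ^ 4) * (T1 (Tx I2 (eE I2)) * v 2 - US.S (-2) (v 2 * T1 (Tx I2 (eE I2))))"
  proof -
    have "qd ^ 3 * qint 2 * (qd * qint 2 ^ 3) = (qd * qint 2) ^ 4" "qd * qint 2 ^ 3 * (qd ^ 3 * qint 2) = (qd * qint 2) ^ 4"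
      by (simp_all add: power3_eq_cube power4_eq_xxxx)
    then show ?thesis
      unfolding T1_T2_E1 T1_T2_E2 by (simp only: sc_mult_sc US_S_sc right_diff_distrib)
  qed
  finally show ?thesis
    using qd_nonzero qint_2_nonzero by (simp add: sc_cancel)
qed

text \<open>T_1 T_2 is applied to [2] T_1(E_2) = [y, E_1]: it fixes y and sends E_1 to v_2.\<close>

lemma v_3: "UQ.x 3 = sc (qint 2 ^ 3) * v 3"
proof -
  have v: "v 3 = abs_U (Tx I1 (Tx I2 (Tx I1 (eE I2))))" "v 2 = T1 (Tx I2 (eE I1))"
    by (simp_all add: v_def vexpr_def T1_def)
  have "sc (qint 2) * v 3 = UQ.y * v 2 - v 2 * UQ.y"
    unfolding T1_T2_y [symmetric] using reflect_T_E[of "\<lambda>a. abs_U (Tx I1 (Tx I2 a))" I1 I2]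
    by (simp add: v T1_def)
  then have "sc (qint 2 ^ 2) * (sc (qint 2) * v 3) = UQ.y * UQ.x 2 - UQ.x 2 * UQ.y"
    unfolding v_2 by (simp add: sc_left_commute [of UQ.y] sc_left_commute [of "v 2"] mult.assoc right_diff_distrib)
  moreover have "UQ.x 3 = UQ.y * UQ.x 2 - UQ.x 2 * UQ.y"
    using UQ.x.simps(2) [of 2] by (simp only: eval_nat_numeral)
  moreover have "qint 2 ^ 3 = qint 2 ^ 2 * qint 2"
    by (simp add: power3_eq_cube power2_eq_square)
  ultimately show ?thesis
    by (simp only: sc_sc)
qed

definition u_scale :: fq where "u_scale = (1 - qpow (-2)) powi (-2) * inverse (qint 2)"

lemma u_eq: "i \<le> 3 \<Longrightarrow> u i = sc (u_scale ^ i) * UQ.x i"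
proof -
  assume "i \<le> 3"
  then consider "i = 0" | "i = 1" | "i = 2" | "i = 3" by linarith
  then have "UQ.x i = sc (qint 2 ^ i) * v i"
    using v_0 v_1 v_2 v_3 by cases (simp_all add: sc_1)
  moreover have "(1 - qpow (-2)) powi (- 2 * int i) = ((1 - qpow (-2)) powi (-2)) ^ i"
    by (simp only: power_int_mult power_int_of_nat)
  ultimately show ?thesis
    using qint_2_nonzero by (simp add: u_def u_scale_def sc_sc power_mult_distrib power_inverse mult.assoc)
qed

text \<open>u_k is \<open>u_scale\<close> to the power k times x_k, and the relations are
  homogeneous in the sum of the indices, so the scale drops out.\<close>

interpretation UP: pbw "\<lambda>k. sc (qpow k)" "u 0" "u 1" "u 2" "u 3"
proof
  have s: "(sc (u_scale ^ j) * a) * (sc (u_scale ^ k) * b) = sc (u_scale ^ (j + k)) * (a * b)" for j k a b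
    by (simp only: sc_mult_sc power_add)
  have x: "UQ.x 1 * UQ.x 0 = US.S 2 (UQ.x 0 * UQ.x 1)" "UQ.x 2 * UQ.x 1 = US.S 2 (UQ.x 1 * UQ.x 2)"
    "UQ.x 3 * UQ.x 2 = US.S 2 (UQ.x 2 * UQ.x 3)"
    "UQ.x 2 * UQ.x 0 = US.S 2 (UQ.x 0 * UQ.x 2) + US.S 2 (UQ.x 1 * UQ.x 1) - UQ.x 1 * UQ.x 1"
    "UQ.x 3 * UQ.x 1 = US.S 2 (UQ.x 1 * UQ.x 3) + US.S 2 (UQ.x 2 * UQ.x 2) - UQ.x 2 * UQ.x 2"
    "UQ.x 3 * UQ.x 0 = US.S 2 (UQ.x 0 * UQ.x 3) + US.S 2 (UQ.x 2 * UQ.x 1) - US.S (-2) (UQ.x 2 * UQ.x 1)"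
    using UQ.x_Suc_x[of 0] UQ.x_Suc_x[of 1] UQ.x_Suc_x[of 2] UQ.x_Suc_Suc_x[of 0] UQ.x_Suc_Suc_x[of 1]
      UQ.x_Suc_Suc_Suc_x[of 0]
    by (simp_all only: numeral_3_eq_3 numeral_2_eq_2 One_nat_def)
  have u: "u 0 = sc (u_scale ^ 0) * UQ.x 0" "u 1 = sc (u_scale ^ 1) * UQ.x 1"
    "u 2 = sc (u_scale ^ 2) * UQ.x 2" "u 3 = sc (u_scale ^ 3) * UQ.x 3"
    by (rule u_eq; simp)+
  show "u 1 * u 0 = US.S 2 (u 0 * u 1)" "u 2 * u 1 = US.S 2 (u 1 * u 2)" "u 3 * u 2 = US.S 2 (u 2 * u 3)"
    unfolding u s US_S_sc x by (simp_all add: add.commute del: UQ.x.simps)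
  show "u 2 * u 0 = US.S 2 (u 0 * u 2) + US.S 2 (u 1 * u 1) - u 1 * u 1"
    "u 3 * u 1 = US.S 2 (u 1 * u 3) + US.S 2 (u 2 * u 2) - u 2 * u 2"
    "u 3 * u 0 = US.S 2 (u 0 * u 3) + US.S 2 (u 2 * u 1) - US.S (-2) (u 2 * u 1)"
    unfolding u s US_S_sc x distrib_left right_diff_distrib by (simp_all add: power2_eq_square del: UQ.x.simps)
qed

section \<open>A representation separating PBW monomials\<close>

text \<open>The coordinates m and n label the weights of the two tensor factors, d the power of the
  evaluation parameter. Functions of arbitrary support on Z^3 make all shifts total.\<close>

typedef (overloaded) ('k :: field) lin = "{T :: (int \<Rightarrow> int \<Rightarrow> int \<Rightarrow> 'k) \<Rightarrow> int \<Rightarrow> int \<Rightarrow> int \<Rightarrow> 'k.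
    (\<forall>f h. T (\<lambda>m n d. f m n d + h m n d) = (\<lambda>m n d. T f m n d + T h m n d)) \<and>
    (\<forall>r f. T (\<lambda>m n d. r * f m n d) = (\<lambda>m n d. r * T f m n d))}"
  by (rule exI[of _ id]) simp

setup_lifting type_definition_lin

instantiation lin :: (field) "{ring, monoid_mult}"
begin
lift_definition zero_lin :: "'a lin" is "\<lambda>f m n d. 0" by simp
lift_definition one_lin :: "'a lin" is "\<lambda>f. f" by simp
lift_definition plus_lin :: "'a lin \<Rightarrow> 'a lin \<Rightarrow> 'a lin" is "\<lambda>S T f m n d. S f m n d + T f m n d"
  by (simp add: algebra_simps)
lift_definition minus_lin :: "'a lin \<Rightarrow> 'a lin \<Rightarrow> 'a lin" is "\<lambda>S T f m n d. S f m n d - T f m n d"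
  by (simp add: algebra_simps)
lift_definition uminus_lin :: "'a lin \<Rightarrow> 'a lin" is "\<lambda>T f m n d. - T f m n d"
  by simp
lift_definition times_lin :: "'a lin \<Rightarrow> 'a lin \<Rightarrow> 'a lin" is "\<lambda>S T f. S (T f)"
  by simp
instance
  by standard (transfer; simp add: algebra_simps fun_eq_iff)+
end

lift_definition lsc :: "'k :: field \<Rightarrow> 'k lin" is "\<lambda>r f m n d. r * f m n d"
  by (simp add: algebra_simps)

lift_definition weighted_shift :: "(int \<Rightarrow> int \<Rightarrow> 'k :: field) \<Rightarrow> int \<Rightarrow> int \<Rightarrow> int \<Rightarrow> 'k lin" is
  "\<lambda>w i j k f m n d. w m n * f (m - i) (n - j) (d - k)"
  by (simp add: algebra_simps)

text \<open>Monomials of a quantum torus, acting by shifts and by powers of $q$ depending on the position.\<close>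
definition mon :: "fq \<Rightarrow> int \<Rightarrow> int \<Rightarrow> int \<Rightarrow> int \<Rightarrow> int \<Rightarrow> fq lin" where
  "mon r i j k a b = weighted_shift (\<lambda>m n. r * qpow (a * m + b * n)) i j k"

lemma lsc_simps:
  "lsc (r + s) = lsc r + lsc s" "lsc (r * s) = lsc r * lsc s" "lsc 0 = 0" "lsc 1 = 1" "lsc (- r) = - lsc r" "lsc (r - s) = lsc r - lsc s"
  by (transfer; simp add: algebra_simps fun_eq_iff)+

lemma lsc_commute: "x * lsc r = lsc r * x"
  by transfer simp

lemma weighted_shift_mult: "weighted_shift w i j k * weighted_shift w' i' j' k'
    = weighted_shift (\<lambda>m n. w m n * w' (m - i) (n - j)) (i + i') (j + j') (k + k')"
  by transfer (simp add: fun_eq_iff algebra_simps)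

lemma lsc_weighted_shift: "lsc r * weighted_shift w i j k = weighted_shift (\<lambda>m n. r * w m n) i j k"
  by transfer (simp add: algebra_simps)

interpretation LS: central_powers "\<lambda>k. lsc (qpow k)"
  by unfold_locales (simp_all only: qpow_add lsc_simps qpow_0, rule lsc_commute)

lemma mon_mult: "mon r i j k a b * mon r' i' j' k' a' b'
    = LS.S (- a' * i - b' * j) (mon (r * r') (i + i') (j + j') (k + k') (a + a') (b + b'))"
proof -
  have e: "qpow (a * m + b * n) * qpow (a' * (m - i) + b' * (n - j))
      = qpow (- a' * i - b' * j) * qpow ((a + a') * m + (b + b') * n)" for m n
    by (simp add: qpow_add [symmetric] algebra_simps)
  have e2: "r * qpow (a * m + b * n) * (r' * qpow (a' * (m - i) + b' * (n - j)))
      = qpow (- a' * i - b' * j) * (r * r' * qpow ((a + a') * m + (b + b') * n))" for m n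
  proof -
    have "r * qpow (a * m + b * n) * (r' * qpow (a' * (m - i) + b' * (n - j)))
        = r * r' * (qpow (a * m + b * n) * qpow (a' * (m - i) + b' * (n - j)))"
      by (simp only: ac_simps)
    then show ?thesis
      unfolding e by (simp only: ac_simps)
  qed
  show ?thesis
    unfolding LS.S_def mon_def weighted_shift_mult lsc_weighted_shift by (simp only: e2)
qed

text \<open>With h(m) = \<open>g_plus\<close> q^(2m+2) + \<open>g_minus\<close> q^(-2m-2) as
  coefficient of the backward shift, these constants solve h(m-1) - h(m) = (q^(2m) - q^(-2m))/(q -
  q^-1), which is the relation between E_1 and F_1 in one factor.\<close>

definition g_plus :: fq where "g_plus = inverse ((1 - qpow 2) * qd)"
definition g_minus :: fq where "g_minus = - inverse ((1 - qpow (-2)) * qd)"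

text \<open>The tensor product of two evaluation representations. In each tensor factor \<open>K1\<close> is diagonal and
  \<open>E1\<close> is the shift; the evaluation parameter of the second factor is the shift in \<open>d\<close>.\<close>
fun rep_gen :: "gen \<Rightarrow> fq lin" where
  "rep_gen (GE I1) = mon 1 1 0 0 0 0 + mon 1 0 1 0 2 0"
| "rep_gen (GE I2) = mon (g_plus * qpow 2) (-1) 0 0 2 0 + mon (g_minus * qpow (-2)) (-1) 0 0 (-2) 0
     + mon (g_plus * qpow 2) 0 (-1) 1 (-2) 2 + mon (g_minus * qpow (-2)) 0 (-1) 1 (-2) (-2)"
| "rep_gen (GF I1) = mon (g_plus * qpow 2) (-1) 0 0 2 (-2) + mon (g_minus * qpow (-2)) (-1) 0 0 (-2) (-2)
     + mon (g_plus * qpow 2) 0 (-1) 0 0 2 + mon (g_minus * qpow (-2)) 0 (-1) 0 0 (-2)"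
| "rep_gen (GF I2) = mon 1 1 0 0 0 2 + mon 1 0 1 (-1) 0 0"
| "rep_gen (GK I1) = mon 1 0 0 0 2 2"
| "rep_gen (GK I2) = mon 1 0 0 0 (-2) (-2)"
| "rep_gen (GKi I1) = mon 1 0 0 0 (-2) (-2)"
| "rep_gen (GKi I2) = mon 1 0 0 0 2 2"

fun rep :: "expr \<Rightarrow> fq lin" where
  "rep (Gen g) = rep_gen g"
| "rep (Sc r) = lsc r"
| "rep (a \<oplus> b) = rep a + rep b"
| "rep (a \<odot> b) = rep a * rep b"

lemma rep_serre:
  "rep (serre a b) = rep a * (rep a * (rep a * rep b)) - LS.S 2 (rep a * (rep a * (rep b * rep a)))
      - rep a * (rep a * (rep b * rep a)) - LS.S (-2) (rep a * (rep a * (rep b * rep a)))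
      + LS.S 2 (rep a * (rep b * (rep a * rep a))) + rep a * (rep b * (rep a * rep a))
      + LS.S (-2) (rep a * (rep b * (rep a * rep a))) - rep b * (rep a * (rep a * rep a))"
  unfolding serre_def esum_def qint_3
  by (simp add: numeral_3_eq_3 numeral_2_eq_2 LS.S_def lsc_simps algebra_simps)

lemma rep_serre_E12: "rep (serre (eE I1) (eE I2)) = 0"
  unfolding rep_serre by (simp add: eE_def mon_mult LS.S_simps algebra_simps)

lemma rep_serre_E21: "rep (serre (eE I2) (eE I1)) = 0"
  unfolding rep_serre by (simp add: eE_def mon_mult LS.S_simps algebra_simps)

lemma rep_serre_F12: "rep (serre (eF I1) (eF I2)) = 0"
  unfolding rep_serre by (simp add: eF_def mon_mult LS.S_simps algebra_simps)

lemma rep_serre_F21: "rep (serre (eF I2) (eF I1)) = 0"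
  unfolding rep_serre by (simp add: eF_def mon_mult LS.S_simps algebra_simps)

lemma weighted_shift_one: "weighted_shift (\<lambda>m n. 1) 0 0 0 = 1"
  by transfer simp

lemma weighted_shift_add:
  "weighted_shift w i j k + weighted_shift w' i j k = weighted_shift (\<lambda>m n. w m n + w' m n) i j k"
  by transfer (simp add: algebra_simps)

lemma mon_one: "mon 1 0 0 0 0 0 = 1"
  unfolding mon_def by (simp add: qpow_0 weighted_shift_one)

lemma mon_add: "mon r i j k a b + mon s i j k a b = mon (r + s) i j k a b"
  unfolding mon_def weighted_shift_add by (simp add: algebra_simps)

lemma lsc_mon: "lsc s * mon r i j k a b = mon (s * r) i j k a b"
  unfolding mon_def lsc_weighted_shift by (simp only: mult.assoc)

lemma S_mon: "LS.S l (mon r i j k a b) = mon (qpow l * r) i j k a b"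
  unfolding LS.S_def mon_def lsc_weighted_shift by (simp only: mult.assoc)

lemma one_minus_qpow_2: "1 - qpow 2 \<noteq> 0" "1 - qpow (-2) \<noteq> 0"
proof -
  have "qpow 1 * (qpow 1 - qpow (-1)) = qpow 2 - 1" "qpow (-1) * (qpow 1 - qpow (-1)) = 1 - qpow (-2)"
    by (simp_all add: right_diff_distrib qpow_add [symmetric] qpow_0)
  moreover have "qpow 1 - qpow (-1) = qd"
    by (simp add: qd_def qpow_def)
  ultimately show "1 - qpow 2 \<noteq> 0" "1 - qpow (-2) \<noteq> 0"
    using qd_nonzero qpow_nonzero by (metis mult_eq_0_iff eq_iff_diff_eq_0)+
qed

text \<open>The difference equation for h, split into its two exponentials and oriented as rewrite
  rules for \<open>rep_EF\<close>.\<close>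

lemma g_relations:
  "LS.S (-2) (mon (g_plus * qpow 2) i j k a b) = mon (g_plus * qpow 2) i j k a b + mon (inverse qd) i j k a b"
  "LS.S 2 (mon (g_minus * qpow (-2)) i j k a b) = mon (g_minus * qpow (-2)) i j k a b - mon (inverse qd) i j k a b"
proof -
  have q: "qpow (-2) * (g_plus * qpow 2) = g_plus" "qpow 2 * (g_minus * qpow (-2)) = g_minus"
    by (simp_all add: mult.left_commute [of _ g_plus] mult.left_commute [of _ g_minus] qpow_add [symmetric] qpow_0)
  have g: "g_plus = g_plus * qpow 2 + inverse qd" "g_minus = g_minus * qpow (-2) - inverse qd"
  proof -
    have "g_plus * (1 - qpow 2) = inverse qd" "g_minus * (1 - qpow (-2)) = - inverse qd"
      unfolding g_plus_def g_minus_def using one_minus_qpow_2 qd_nonzero by simp_all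
    then show "g_plus = g_plus * qpow 2 + inverse qd" "g_minus = g_minus * qpow (-2) - inverse qd"
      by (simp_all add: algebra_simps)
  qed
  show "LS.S (-2) (mon (g_plus * qpow 2) i j k a b) = mon (g_plus * qpow 2) i j k a b + mon (inverse qd) i j k a b"
    unfolding S_mon q mon_add by (subst g(1)) (rule HOL.refl)
  have "mon (g_minus * qpow (-2)) i j k a b = mon g_minus i j k a b + mon (inverse qd) i j k a b"
    unfolding mon_add by (subst g(2)) simp
  then show "LS.S 2 (mon (g_minus * qpow (-2)) i j k a b) = mon (g_minus * qpow (-2)) i j k a b - mon (inverse qd) i j k a b"
    unfolding S_mon q by simp
qed

lemma rep_KE: "rep (eK i \<odot> eE j \<odot> eKi i) = rep (Sc (qpow (cartan i j)) \<odot> eE j)"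
  by (cases i; cases j)
     (simp_all add: eK_def eE_def eKi_def cartan_def mon_mult LS.S_def [symmetric] LS.S_simps algebra_simps)

lemma rep_KF: "rep (eK i \<odot> eF j \<odot> eKi i) = rep (Sc (qpow (- cartan i j)) \<odot> eF j)"
  by (cases i; cases j)
     (simp_all add: eK_def eF_def eKi_def cartan_def mon_mult LS.S_def [symmetric] LS.S_simps algebra_simps)

lemma rep_EF: "rep (esub (eE i \<odot> eF j) (eF j \<odot> eE i))
   = rep (if i = j then Sc (inverse (qq - inverse qq)) \<odot> esub (eK i) (eKi i) else Sc 0)"
  by (cases i; cases j)
     (simp_all add: eK_def eE_def eF_def eKi_def esub_def lsc_simps lsc_mon mon_mult qd_def [symmetric] LS.S_simps
        g_relations right_diff_distrib algebra_simps)

lemma rep_ueq: "ueq a b \<Longrightarrow> rep a = rep b"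
proof (induction rule: ueq.induct)
  case (rel_EF i j)
  then show ?case by (rule rep_EF)
next
  case (rel_KE i j)
  then show ?case by (rule rep_KE)
next
  case (rel_KF i j)
  then show ?case by (rule rep_KF)
next
  case rel_KK
  then show ?case by (simp add: eK_def mon_mult)
next
  case (rel_Kinv1 i)
  then show ?case by (cases i) (simp_all add: eK_def eKi_def mon_mult mon_one LS.S_simps lsc_simps)
next
  case (rel_Kinv2 i)
  then show ?case by (cases i) (simp_all add: eK_def eKi_def mon_mult mon_one LS.S_simps lsc_simps)
next
  case (rel_serreE i j)
  then show ?case by (cases i; cases j) (simp_all add: rep_serre_E12 rep_serre_E21 lsc_simps)
next
  case (rel_serreF i j)
  then show ?case by (cases i; cases j) (simp_all add: rep_serre_F12 rep_serre_F21 lsc_simps)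
next
  case (sc_central r a)
  then show ?case by (simp add: lsc_commute)
qed (simp_all add: lsc_simps algebra_simps)

lift_definition repU :: "U \<Rightarrow> fq lin" is rep
  by (rule rep_ueq)

lemma repU_simps:
  "repU (a + b) = repU a + repU b" "repU (a * b) = repU a * repU b" "repU (sc r) = lsc r"
  "repU 0 = 0" "repU 1 = 1"
proof -
  show "repU (a + b) = repU a + repU b" "repU (a * b) = repU a * repU b"
    by (transfer, simp)+
  show sc: "repU (sc r) = lsc r" for r
    by (simp only: sc.abs_eq repU.abs_eq rep.simps)
  show "repU 0 = 0" "repU 1 = 1"
    using sc[of 0] sc[of 1] by (simp_all add: sc_0 sc_1 lsc_simps)
qed

lemma repU_diff: "repU (a - b) = repU a - repU b"
  using repU_simps(1)[of "a - b" b] by (simp add: algebra_simps)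

section \<open>Leading terms of root vectors in the representation\<close>

abbreviation "app \<equiv> Rep_lin"

lemma app_simps:
  "app (S + T) f m n d = app S f m n d + app T f m n d"
  "app (S - T) f m n d = app S f m n d - app T f m n d"
  "app (S * T) f = app S (app T f)"
  "app (lsc r) f m n d = r * f m n d"
  by (simp_all add: plus_lin.rep_eq minus_lin.rep_eq times_lin.rep_eq lsc.rep_eq)

lemma app_mon: "app (mon r i j k a b) f m n d = r * qpow (a * m + b * n) * f (m - i) (n - j) (d - k)"
  by (simp add: mon_def weighted_shift.rep_eq)

definition supported :: "int \<Rightarrow> (int \<Rightarrow> int \<Rightarrow> int \<Rightarrow> fq) \<Rightarrow> bool" where
  "supported w f \<longleftrightarrow> (\<forall>m n d. f m n d \<noteq> 0 \<longrightarrow> 2 * d - 3 * n \<le> w)"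

text \<open>The factor gained by a leading coefficient under [y, -]: y scales a factor by c q^(2m)
  with c = \<open>g_plus\<close> (q^2 - q^-2), and a shift by one in m changes this by the relative
  amount 1 - q^-2.\<close>

definition kappa :: fq where "kappa = g_plus * (qpow 2 - qpow (-2)) * (1 - qpow (-2))"

lemma kappa_nonzero: "kappa \<noteq> 0"
  using one_minus_qpow_2 qd_nonzero qint_2_nonzero
  by (simp add: kappa_def g_plus_def qpow_2_diff)

lemma qpow_mult: "qpow j * qpow k = qpow (j + k)" "qpow j * (qpow k * x) = qpow (j + k) * x"
  by (simp_all add: qpow_add)

lemma qpow_diff: "qpow (j - k) = qpow j * qpow (- k)"
  by (simp add: qpow_add [symmetric])

text \<open>In each factor y acts by a diagonal operator, combined with a shift of d in the second.
  The last term mixes the factors. On the filtration 2d - 3n the three terms have degrees 0, 2 and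
  -3.\<close>

lemma repU_y:
  "app (repU UQ.y) f m n d = g_plus * (qpow 2 - qpow (-2)) * qpow (2 * m) * f m n d
     + g_plus * (qpow 2 - qpow (-2)) * qpow (2 * n) * f m n (d - 1)
     + (g_plus * (qpow 4 - 1) * qpow (4 * m) + g_minus * (1 - qpow (-4))) * f (m + 1) (n - 1) d"
proof -
  define E1 where "E1 = app (repU (UE I1))"
  define E2 where "E2 = app (repU (UE I2))"
  have E1: "E1 f m n d = f (m - 1) n d + qpow (2 * m) * f m (n - 1) d" for f m n d
    unfolding E1_def repU.abs_eq eE_def rep.simps rep_gen.simps by (simp add: app_simps app_mon qpow_0)
  have E2: "E2 f m n d = qpow (2 + 2 * m) * (g_plus * f (m + 1) n d) + qpow (- 2 - 2 * m) * (g_minus * f (m + 1) n d)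
     + qpow (2 + (2 * n - 2 * m)) * (g_plus * f m (n + 1) (d - 1)) + qpow (- (2 * m) - 2 * n - 2) * (g_minus * f m (n + 1) (d - 1))"
    for f m n d
  proof -
    have "qpow (2 + 2 * m) = qpow 2 * qpow (2 * m)" "qpow (- 2 - 2 * m) = qpow (-2) * qpow (- 2 * m)"
      "qpow (2 + (2 * n - 2 * m)) = qpow 2 * qpow (- 2 * m + 2 * n)"
      "qpow (- (2 * m) - 2 * n - 2) = qpow (-2) * qpow (- 2 * m + - 2 * n)"
      unfolding qpow_add [symmetric] by (rule arg_cong [of _ _ qpow], simp)+
    then show ?thesis
      unfolding E2_def repU.abs_eq eE_def rep.simps rep_gen.simps by (simp add: app_simps app_mon)
  qed
  have y: "app (repU UQ.y) f m n d = E2 (E1 f) m n d - qpow (-2) * E1 (E2 f) m n d"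
    unfolding UQ.y_def US_S repU_simps repU_diff by (simp add: app_simps E1_def E2_def)
  have c: "g_plus * (qpow j * a) = qpow j * (g_plus * a)" "g_minus * (qpow j * a) = qpow j * (g_minus * a)" for j a
    by (rule mult.left_commute)+
  show ?thesis
    unfolding y E1 E2
    by (simp add: ring_distribs mult.assoc c qpow_mult qpow_0) (auto simp: algebra_simps intro!: arg_cong [of _ _ qpow])
qed

text \<open>With respect to the filtration \<open>supported\<close>, the first displayed term dominates if $k \le 1$ and the
  second one if $2 \le k \le 3$; the filtration $2 d - 3 n$ is chosen to achieve this.\<close>
lemma lead_x:
  "\<exists>r. (\<forall>f w. supported w f \<longrightarrow> supported (w + 2 * int k - 5) (r f)) \<and>
       (\<forall>f m n d. app (repU (UQ.x k)) f m n d = kappa ^ k * qpow (2 * int k * m) * f (m - 1) n d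
           + kappa ^ k * qpow (2 * m + 2 * int k * n) * f m (n - 1) (d - int k) + r f m n d)"
proof (induction k)
  case 0
  have "app (repU (UQ.x 0)) f m n d = f (m - 1) n d + qpow (2 * m) * f m (n - 1) d" for f m n d
    unfolding UQ.x.simps
    unfolding repU.abs_eq eE_def rep.simps rep_gen.simps by (simp add: app_simps app_mon qpow_0)
  then show ?case
    by (intro exI[of _ "\<lambda>f m n d. 0"]) (simp add: supported_def qpow_0)
next
  case (Suc k)
  then obtain r where r: "\<And>f w. supported w f \<Longrightarrow> supported (w + 2 * int k - 5) (r f)"
    and x: "\<And>f m n d. app (repU (UQ.x k)) f m n d = kappa ^ k * qpow (2 * int k * m) * f (m - 1) n d
           + kappa ^ k * qpow (2 * m + 2 * int k * n) * f m (n - 1) (d - int k) + r f m n d"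
    by metis
  define c where "c = g_plus * (qpow 2 - qpow (-2))"
  define G where "G m = g_plus * (qpow 4 - 1) * qpow (4 * m) + g_minus * (1 - qpow (-4))" for m
  define K where "K = kappa ^ k"
  have kappa: "kappa ^ Suc k = c * (1 - qpow (-2)) * K"
    by (simp add: kappa_def c_def K_def)
  define Y where "Y = app (repU UQ.y)"
  have Y: "Y f m n d = c * qpow (2 * m) * f m n d + c * qpow (2 * n) * f m n (d - 1) + G m * f (m + 1) (n - 1) d" for f m n d
    by (simp add: Y_def repU_y c_def G_def)
  \<comment> \<open>The diagonal parts of y account for the two new leading terms. What is left are
    the commutators of y with the old remainder and of the mixed term with the old leading terms.
    Relative to degrees 0 and 2k - 3 of the leading terms, the remainder has degree at most 2k -
    5.\<close>
  define r' where "r' f = (\<lambda>m n d. Y (r f) m n d - r (Y f) m n d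
     + (G m * K * qpow (2 * int k * (m + 1)) - K * qpow (2 * int k * m) * G (m - 1)) * f m (n - 1) d
     + (G m * K * qpow (2 * (m + 1) + 2 * int k * (n - 1)) - K * qpow (2 * m + 2 * int k * n) * G m)
         * f (m + 1) (n - 2) (d - int k))" for f
  have "app (repU (UQ.x (Suc k))) f m n d = kappa ^ Suc k * qpow (2 * int (Suc k) * m) * f (m - 1) n d
       + kappa ^ Suc k * qpow (2 * m + 2 * int (Suc k) * n) * f m (n - 1) (d - int (Suc k)) + r' f m n d" for f m n d
  proof -
    have *: "app (repU (UQ.x (Suc k))) f m n d = Y (app (repU (UQ.x k)) f) m n d - app (repU (UQ.x k)) (Y f) m n d"
      by (simp add: repU_simps repU_diff app_simps Y_def)
    show ?thesis
      unfolding * kappa r'_def Y x K_def [symmetric]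
      by (simp add: algebra_simps qpow_add qpow_diff)
  qed
  moreover have "supported (w + 2 * int (Suc k) - 5) (r' f)" if "supported w f" for f w
  proof -
    have Ysup: "supported (w' + 2) (Y h)" if "supported w' h" for h w'
      using that unfolding supported_def Y by (smt (verit) add_cancel_right_left mult_zero_right)
    have 1: "supported (w + 2 * int k - 3) (Y (r f))"
      using Ysup[OF r[OF that]] by (simp add: algebra_simps)
    have 2: "supported (w + 2 * int k - 3) (r (Y f))"
      using r[OF Ysup[OF that]] by (simp add: algebra_simps)
    have "2 * d - 3 * n \<le> w + 2 * int k - 3" if "r' f m n d \<noteq> 0" for m n d
    proof -
      have "Y (r f) m n d \<noteq> 0 \<or> r (Y f) m n d \<noteq> 0 \<or> f m (n - 1) d \<noteq> 0 \<or> f (m + 1) (n - 2) (d - int k) \<noteq> 0"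
        using \<open>r' f m n d \<noteq> 0\<close> unfolding r'_def by auto
      then show ?thesis
        using 1 2 \<open>supported w f\<close> unfolding supported_def by fastforce
    qed
    then show ?thesis
      unfolding supported_def by simp
  qed
  ultimately show ?case
    by blast
qed

definition leading :: "int \<Rightarrow> int \<Rightarrow> int \<Rightarrow> fq \<Rightarrow> (int \<Rightarrow> int \<Rightarrow> int \<Rightarrow> fq) \<Rightarrow> bool" where
  "leading m n d r f \<longleftrightarrow> f m n d = r \<and>
     (\<forall>m' n' d'. (m', n', d') \<noteq> (m, n, d) \<longrightarrow> f m' n' d' \<noteq> 0 \<longrightarrow> 2 * d' - 3 * n' < 2 * d - 3 * n)"

lemma leading_supported: "leading m n d r f \<Longrightarrow> supported (2 * d - 3 * n) f"
  unfolding leading_def supported_def by (smt (verit) prod.inject)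

lemma leading_x_low:
  assumes "leading m n d r f" "k \<le> 1"
  shows "leading (m + 1) n d (kappa ^ k * qpow (2 * int k * (m + 1)) * r) (app (repU (UQ.x k)) f)"
proof -
  have k: "int k \<le> 1"
    using assms by simp_all
  obtain R where R: "\<And>f w. supported w f \<Longrightarrow> supported (w + 2 * int k - 5) (R f)"
    and x: "\<And>f m n d. app (repU (UQ.x k)) f m n d = kappa ^ k * qpow (2 * int k * m) * f (m - 1) n d
           + kappa ^ k * qpow (2 * m + 2 * int k * n) * f m (n - 1) (d - int k) + R f m n d"
    using lead_x[of k] by metis
  have s: "f m' n' d' \<noteq> 0 \<Longrightarrow> 2 * d' - 3 * n' \<le> 2 * d - 3 * n"
    and sR: "R f m' n' d' \<noteq> 0 \<Longrightarrow> 2 * d' - 3 * n' \<le> 2 * d - 3 * n + 2 * int k - 5" for m' n' d'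
    using leading_supported[OF assms(1)] R[OF leading_supported[OF assms(1)]] by (auto simp: supported_def)
  have "f (m + 1) (n - 1) (d - int k) = 0"
  proof (rule ccontr)
    assume "f (m + 1) (n - 1) (d - int k) \<noteq> 0"
    from s[OF this] k show False by (simp add: algebra_simps)
  qed
  moreover have "R f (m + 1) n d = 0"
  proof (rule ccontr)
    assume "R f (m + 1) n d \<noteq> 0"
    from sR[OF this] k show False by (simp add: algebra_simps)
  qed
  ultimately have "app (repU (UQ.x k)) f (m + 1) n d = kappa ^ k * qpow (2 * int k * (m + 1)) * r"
    using assms(1) by (simp add: x leading_def)
  moreover have "2 * d' - 3 * n' < 2 * d - 3 * n"
    if ne: "(m', n', d') \<noteq> (m + 1, n, d)" and nz: "app (repU (UQ.x k)) f m' n' d' \<noteq> 0" for m' n' d'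
  proof -
    from nz consider "f (m' - 1) n' d' \<noteq> 0" | "f m' (n' - 1) (d' - int k) \<noteq> 0" | "R f m' n' d' \<noteq> 0"
      unfolding x by fastforce
    then show ?thesis
    proof cases
      case 1
      then show ?thesis
        using assms(1) ne unfolding leading_def by (smt (verit) prod.inject)
    next
      case 2
      from s[OF 2] k show ?thesis by presburger
    next
      case 3
      from sR[OF 3] k show ?thesis by presburger
    qed
  qed
  ultimately show ?thesis
    unfolding leading_def by blast
qed

lemma leading_x_high:
  assumes "leading m n d r f" "2 \<le> k" "k \<le> 3"
  shows "leading m (n + 1) (d + int k) (kappa ^ k * qpow (2 * m + 2 * int k * (n + 1)) * r) (app (repU (UQ.x k)) f)"
proof -
  have k: "2 \<le> int k" "int k \<le> 3"
    using assms by simp_all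
  obtain R where R: "\<And>f w. supported w f \<Longrightarrow> supported (w + 2 * int k - 5) (R f)"
    and x: "\<And>f m n d. app (repU (UQ.x k)) f m n d = kappa ^ k * qpow (2 * int k * m) * f (m - 1) n d
           + kappa ^ k * qpow (2 * m + 2 * int k * n) * f m (n - 1) (d - int k) + R f m n d"
    using lead_x[of k] by metis
  have s: "f m' n' d' \<noteq> 0 \<Longrightarrow> 2 * d' - 3 * n' \<le> 2 * d - 3 * n"
    and sR: "R f m' n' d' \<noteq> 0 \<Longrightarrow> 2 * d' - 3 * n' \<le> 2 * d - 3 * n + 2 * int k - 5" for m' n' d'
    using leading_supported[OF assms(1)] R[OF leading_supported[OF assms(1)]] by (auto simp: supported_def)
  have "f (m - 1) (n + 1) (d + int k) = 0"
  proof (rule ccontr)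
    assume "f (m - 1) (n + 1) (d + int k) \<noteq> 0"
    from s[OF this] k show False by (simp add: algebra_simps)
  qed
  moreover have "R f m (n + 1) (d + int k) = 0"
  proof (rule ccontr)
    assume "R f m (n + 1) (d + int k) \<noteq> 0"
    from sR[OF this] k show False by (simp add: algebra_simps)
  qed
  ultimately have "app (repU (UQ.x k)) f m (n + 1) (d + int k) = kappa ^ k * qpow (2 * m + 2 * int k * (n + 1)) * r"
    using assms(1) by (simp add: x leading_def)
  moreover have "2 * d' - 3 * n' < 2 * (d + int k) - 3 * (n + 1)"
    if ne: "(m', n', d') \<noteq> (m, n + 1, d + int k)" and nz: "app (repU (UQ.x k)) f m' n' d' \<noteq> 0" for m' n' d'
  proof -
    from nz consider "f (m' - 1) n' d' \<noteq> 0" | "f m' (n' - 1) (d' - int k) \<noteq> 0" | "R f m' n' d' \<noteq> 0"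
      unfolding x by fastforce
    then show ?thesis
    proof cases
      case 1
      from s[OF 1] k show ?thesis by presburger
    next
      case 2
      have "(m', n' - 1, d' - int k) \<noteq> (m, n, d)"
        using ne by auto
      then have "2 * (d' - int k) - 3 * (n' - 1) < 2 * d - 3 * n"
        using 2 assms(1) unfolding leading_def by blast
      then show ?thesis by presburger
    next
      case 3
      from sR[OF 3] k show ?thesis by presburger
    qed
  qed
  ultimately show ?thesis
    unfolding leading_def by blast
qed

lemma u_scale_nonzero: "u_scale \<noteq> 0"
  using one_minus_qpow_2 qint_2_nonzero by (simp add: u_scale_def)

lemma leading_scale: "leading m n d r f \<Longrightarrow> s \<noteq> 0 \<Longrightarrow> leading m n d (s * r) (\<lambda>m n d. s * f m n d)"
  by (auto simp: leading_def)

definition lam :: fq where "lam = u_scale * kappa"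

lemma app_u: "i \<le> 3 \<Longrightarrow> app (repU (u i)) f = (\<lambda>m n d. u_scale ^ i * app (repU (UQ.x i)) f m n d)"
  by (intro ext) (simp add: u_eq repU_simps app_simps)

lemma leading_u_low:
  "leading m n d r f \<Longrightarrow> k \<le> 1 \<Longrightarrow> leading (m + 1) n d (lam ^ k * qpow (2 * int k * (m + 1)) * r) (app (repU (u k)) f)"
  using leading_scale[OF leading_x_low, of m n d r f k "u_scale ^ k"] u_scale_nonzero
  by (simp add: app_u lam_def power_mult_distrib mult.assoc)

lemma leading_u_high:
  "leading m n d r f \<Longrightarrow> 2 \<le> k \<Longrightarrow> k \<le> 3 \<Longrightarrow>
    leading m (n + 1) (d + int k) (lam ^ k * qpow (2 * m + 2 * int k * (n + 1)) * r) (app (repU (u k)) f)"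
  using leading_scale[OF leading_x_high, of m n d r f k "u_scale ^ k"] u_scale_nonzero
  by (simp add: app_u lam_def power_mult_distrib mult.assoc)

lemma app_power_Suc: "app (repU (x ^ Suc a)) f = app (repU x) (app (repU (x ^ a)) f)"
  by (simp add: repU_simps app_simps)

lemma leading_u_power_low:
  assumes "leading m n d r f" "k \<le> 1"
  shows "leading (m + int a) n d (lam ^ (k * a) * qpow (int k * int a * (2 * m + int a + 1)) * r) (app (repU (u k ^ a)) f)"
proof (induction a)
  case 0
  then show ?case using assms by (simp add: repU_simps one_lin.rep_eq qpow_0)
next
  case (Suc a)
  have e: "lam ^ k * q * (lam ^ (k * a) * q' * r) = lam ^ (k * Suc a) * (q * q') * r" for q q'
    by (simp add: power_add algebra_simps)
  have q: "qpow (2 * int k * (m + int a + 1)) * qpow (int k * int a * (2 * m + int a + 1))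
      = qpow (int k * int (Suc a) * (2 * m + int (Suc a) + 1))"
    unfolding qpow_add [symmetric] by (rule arg_cong [of _ _ qpow]) (simp add: algebra_simps)
  have "m + int a + 1 = m + int (Suc a)" by simp
  then show ?case
    using leading_u_low[OF Suc assms(2)] unfolding app_power_Suc e q by (simp only:)
qed

lemma leading_u_power_high:
  assumes "leading m n d r f" "2 \<le> k" "k \<le> 3"
  shows "leading m (n + int a) (d + int k * int a)
     (lam ^ (k * a) * qpow (int a * (2 * m + int k * (2 * n + int a + 1))) * r) (app (repU (u k ^ a)) f)"
proof (induction a)
  case 0
  then show ?case using assms by (simp add: repU_simps one_lin.rep_eq qpow_0)
next
  case (Suc a)
  have e: "lam ^ k * q * (lam ^ (k * a) * q' * r) = lam ^ (k * Suc a) * (q * q') * r" for q q'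
    by (simp add: power_add algebra_simps)
  have q: "qpow (2 * m + 2 * int k * (n + int a + 1)) * qpow (int a * (2 * m + int k * (2 * n + int a + 1)))
      = qpow (int (Suc a) * (2 * m + int k * (2 * n + int (Suc a) + 1)))"
    unfolding qpow_add [symmetric] by (rule arg_cong [of _ _ qpow]) (simp add: algebra_simps)
  have "n + int a + 1 = n + int (Suc a)" "d + int k * int a + int k = d + int k * int (Suc a)"
    by (simp_all add: algebra_simps)
  then show ?case
    using leading_u_high[OF Suc assms(2,3)] unfolding app_power_Suc e q by (simp only:)
qed

definition delta :: "int \<Rightarrow> int \<Rightarrow> int \<Rightarrow> fq" where
  "delta m n d = (if m = 0 \<and> n = 0 \<and> d = 0 then 1 else 0)"

lemma leading_delta: "leading 0 0 0 1 delta"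
  by (auto simp: leading_def delta_def)

text \<open>\<open>u 0\<close> and \<open>u 1\<close> raise m by one; \<open>u 2\<close> and
  \<open>u 3\<close> raise n by one and d by 2 and 3.\<close>

fun lead_pos :: "nat4 \<Rightarrow> int \<times> int \<times> int" where
  "lead_pos (a3, a2, a1, a0) = (int a0 + int a1, int a2 + int a3, 2 * int a2 + 3 * int a3)"

definition leads_at :: "int \<times> int \<times> int \<Rightarrow> fq \<Rightarrow> U \<Rightarrow> bool" where
  "leads_at p r x = (case p of (m, n, d) \<Rightarrow> leading m n d r (app (repU x) delta))"

lemma lam_nonzero: "lam \<noteq> 0"
  using u_scale_nonzero kappa_nonzero by (simp add: lam_def)

lemma two_choose_2: "2 * int (n choose 2) = int n * int n - int n"
  by (induction n) (simp_all add: int_Suc_choose_2 algebra_simps)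

text \<open>A product and its reversal lead at the same position. The powers of q picked up in the
  two orders differ by exactly q^(-N(a)), which is why sigma-invariance can be read off from leading
  coefficients.\<close>

lemma leads_at_E:
  "\<exists>r. r \<noteq> 0 \<and> leads_at (lead_pos a) r (Epbw a) \<and> leads_at (lead_pos a) (qpow (- Nf a) * r) (sigE a)"
proof (cases a)
  case (fields a3 a2 a1 a0)
  define l where "l = lam ^ (1 * a1) * lam ^ (2 * a2) * lam ^ (3 * a3)"
  \<comment> \<open>Exponents collected when \<open>u 0\<close> acts first. In \<open>e'\<close> the
    generator \<open>u 3\<close> acts first, so \<open>u 3\<close> and \<open>u 2\<close> act at m =
    0.\<close>
  define e where "e = int a1 * (2 * int a0 + int a1 + 1) + int a2 * (2 * (int a0 + int a1) + 2 * (int a2 + 1))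
    + int a3 * (2 * (int a0 + int a1) + 3 * (2 * int a2 + int a3 + 1))"
  define e' where "e' = int a3 * (3 * (int a3 + 1)) + int a2 * (2 * (2 * int a3 + int a2 + 1)) + int a1 * (int a1 + 1)"
  have 0: "leading (int a0) 0 0 1 (app (repU (u 0 ^ a0)) delta)"
    using leading_u_power_low[OF leading_delta, of 0 a0] by (simp add: qpow_0)
  note 1 = leading_u_power_low[OF 0, of 1 a1]
  note 2 = leading_u_power_high[OF 1, of 2 a2]
  note 3 = leading_u_power_high[OF 2, of 3 a3]
  have "leading (int a0 + int a1) (int a2 + int a3) (2 * int a2 + 3 * int a3) (qpow (bb a) * (l * qpow e))
      (\<lambda>m n d. qpow (bb a) * app (repU (u 3 ^ a3)) (app (repU (u 2 ^ a2)) (app (repU (u 1 ^ a1)) (app (repU (u 0 ^ a0)) delta))) m n d)"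
    using leading_scale[OF 3 qpow_nonzero[of "bb a"]]
    by (simp add: l_def e_def qpow_add ac_simps del: mult_cancel_left mult_cancel_right)
  moreover have "app (repU (Epbw a)) delta
     = (\<lambda>m n d. qpow (bb a) * app (repU (u 3 ^ a3)) (app (repU (u 2 ^ a2)) (app (repU (u 1 ^ a1)) (app (repU (u 0 ^ a0)) delta))) m n d)"
    by (intro ext) (simp add: fields repU_simps app_simps mult.assoc)
  ultimately have E: "leads_at (lead_pos a) (qpow (bb a) * (l * qpow e)) (Epbw a)"
    by (simp add: leads_at_def fields)
  have 3: "leading 0 (int a3) (3 * int a3) (lam ^ (3 * a3) * qpow (int a3 * (3 * (int a3 + 1)))) (app (repU (u 3 ^ a3)) delta)"
    using leading_u_power_high[OF leading_delta, of 3 a3] by simp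
  note 2 = leading_u_power_high[OF 3, of 2 a2]
  note 1 = leading_u_power_low[OF 2, of 1 a1]
  note 0 = leading_u_power_low[OF 1, of 0 a0]
  define s where "s = - bb a + 2 * int a1 + 4 * int a2 + 6 * int a3"
  have "leading (int a0 + int a1) (int a2 + int a3) (2 * int a2 + 3 * int a3) (qpow s * (l * qpow e'))
      (\<lambda>m n d. qpow s * app (repU (u 0 ^ a0)) (app (repU (u 1 ^ a1)) (app (repU (u 2 ^ a2)) (app (repU (u 3 ^ a3)) delta))) m n d)"
    using leading_scale[OF 0 qpow_nonzero[of s]]
    by (simp add: l_def e'_def qpow_add qpow_0 ac_simps del: mult_cancel_left mult_cancel_right)
  moreover have "app (repU (sigE a)) delta
     = (\<lambda>m n d. qpow s * app (repU (u 0 ^ a0)) (app (repU (u 1 ^ a1)) (app (repU (u 2 ^ a2)) (app (repU (u 3 ^ a3)) delta))) m n d)"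
    by (intro ext) (simp add: fields s_def repU_simps app_simps mult.assoc)
  ultimately have S: "leads_at (lead_pos a) (qpow s * (l * qpow e')) (sigE a)"
    by (simp add: leads_at_def fields)
  have "s + e' = - Nf a + (bb a + e)"
    unfolding s_def e'_def e_def fields
    using two_choose_2[of a3] two_choose_2[of a2] two_choose_2[of a1] two_choose_2[of a0]
    by (simp add: algebra_simps power2_eq_square)
  then have "qpow s * (l * qpow e') = qpow (- Nf a) * (qpow (bb a) * (l * qpow e))"
    by (metis qpow_add mult.assoc mult.left_commute)
  from S [unfolded this] E show ?thesis
    using lam_nonzero qpow_nonzero by (intro exI[of _ "qpow (bb a) * (l * qpow e)"]) (simp add: l_def)
qed

section \<open>Uniqueness of the dual canonical basis elements\<close>

lemma finite_Sset: "finite (Sset a)"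
proof (cases a)
  case (fields a3 a2 a1 a0)
  have "Sset a \<subseteq> {..a3} \<times> {..a2 + 2 * a3} \<times> {..a1 + 2 * a0} \<times> {..a0}"
    unfolding fields Sset_def by auto
  then show ?thesis
    by (rule finite_subset) simp
qed

lemma Nf_tri: "tri a b \<Longrightarrow> Nf b = Nf a"
proof (cases a, cases b)
  fix a3 a2 a1 a0 b3 b2 b1 b0
  assume ab: "a = (a3, a2, a1, a0)" "b = (b3, b2, b1, b0)" and "tri a b"
  then obtain i k :: nat where b: "int b3 = int a3 - int i" "int b2 = int a2 + 2 * int i - int k"
    "int b1 = int a1 - int i + 2 * int k" "int b0 = int a0 - int k"
    by auto
  have "int b3 + int b2 + int b1 + int b0 = int a3 + int a2 + int a1 + int a0"
    unfolding b by simp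
  moreover have "7 * int b3 + 5 * int b2 + 3 * int b1 + int b0 = 7 * int a3 + 5 * int a2 + 3 * int a1 + int a0"
    unfolding b by simp
  ultimately show ?thesis
    unfolding ab Nf.simps by (simp add: algebra_simps)
qed

text \<open>The last two coordinates determine b3 and b2, hence the two multiplicities in the order,
  hence b1 and b0. A common lower bound \<open>a\<close> matters, since \<open>u 0\<close> and
  \<open>u 1\<close> lead at the same position.\<close>

lemma lead_pos_inj:
  assumes "tri a b" "tri a b'" "lead_pos b = lead_pos b'"
  shows "b = b'"
proof (cases a, cases b, cases b')
  fix a3 a2 a1 a0 b3 b2 b1 b0 b3' b2' b1' b0'
  assume ab: "a = (a3, a2, a1, a0)" "b = (b3, b2, b1, b0)" "b' = (b3', b2', b1', b0')"
  obtain i k :: nat where b: "int b3 = int a3 - int i" "int b2 = int a2 + 2 * int i - int k"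
    "int b1 = int a1 - int i + 2 * int k" "int b0 = int a0 - int k"
    using assms(1) ab by auto
  obtain i' k' :: nat where b': "int b3' = int a3 - int i'" "int b2' = int a2 + 2 * int i' - int k'"
    "int b1' = int a1 - int i' + 2 * int k'" "int b0' = int a0 - int k'"
    using assms(2) ab by auto
  have p: "int b2 + int b3 = int b2' + int b3'" "2 * int b2 + 3 * int b3 = 2 * int b2' + 3 * int b3'"
    using assms(3) ab by auto
  have 1: "int b3 = int b3'" using p by presburger
  then have 2: "int b2 = int b2'" using p by presburger
  have 3: "int i = int i'" using 1 b(1) b'(1) by linarith
  have "int k = int k'" using 2 3 b(2) b'(2) by linarith
  with 3 have "int b1 = int b1'" "int b0 = int b0'" unfolding b b' by simp_all
  with 1 2 show ?thesis unfolding ab by simp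
qed

fun height :: "int \<times> int \<times> int \<Rightarrow> int" where "height (m, n, d) = 2 * d - 3 * n"

definition value_at :: "int \<times> int \<times> int \<Rightarrow> U \<Rightarrow> fq" where
  "value_at p x = (case p of (m, n, d) \<Rightarrow> app (repU x) delta m n d)"

lemma value_at_simps:
  "value_at p (x + y) = value_at p x + value_at p y"
  "value_at p (x - y) = value_at p x - value_at p y"
  "value_at p (sc r * x) = r * value_at p x"
  "value_at p 0 = 0"
  by (cases p; simp add: value_at_def repU_simps repU_diff app_simps zero_lin.rep_eq)+

lemma value_at_sum: "value_at p (\<Sum>b\<in>T. f b) = (\<Sum>b\<in>T. value_at p (f b))"
  by (induction T rule: infinite_finite_induct) (simp_all add: value_at_simps)

lemma leads_at_value:
  assumes "leads_at p r x"
  shows "value_at p x = r" "p' \<noteq> p \<Longrightarrow> height p \<le> height p' \<Longrightarrow> value_at p' x = 0"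
  using assms unfolding leads_at_def leading_def value_at_def
  by (cases p, simp, cases p, cases p', force)

text \<open>The coefficient of the highest monomial in a difference of two candidates is bar invariant and
  has no constant term.\<close>
lemma is_dcb_unique:
  assumes "is_dcb a X" "is_dcb a X'"
  shows "X = X'"
proof -
  obtain c where c: "\<forall>b\<in>Sset a. coeff (c b) 0 = 0" "X = Epbw a + (\<Sum>b\<in>Sset a. sc (evq (c b) qq) * Epbw b)"
    "sigE a + (\<Sum>b\<in>Sset a. sc (evq (c b) (inverse qq)) * sigE b) = sc (qpow (- Nf a)) * X"
    using assms(1) unfolding is_dcb_def by auto
  obtain c' where c': "\<forall>b\<in>Sset a. coeff (c' b) 0 = 0" "X' = Epbw a + (\<Sum>b\<in>Sset a. sc (evq (c' b) qq) * Epbw b)"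
    "sigE a + (\<Sum>b\<in>Sset a. sc (evq (c' b) (inverse qq)) * sigE b) = sc (qpow (- Nf a)) * X'"
    using assms(2) unfolding is_dcb_def by auto
  define d where "d b = c b - c' b" for b
  have D: "X - X' = (\<Sum>b\<in>Sset a. sc (evq (d b) qq) * Epbw b)"
    unfolding c(2) c'(2) d_def by (simp add: evq_diff sc_diff left_diff_distrib sum_subtractf)
  have D': "(\<Sum>b\<in>Sset a. sc (evq (d b) (inverse qq)) * sigE b) = sc (qpow (- Nf a)) * (X - X')"
    unfolding right_diff_distrib c(3) [symmetric] c'(3) [symmetric] d_def
    by (simp add: evq_diff sc_diff left_diff_distrib sum_subtractf)
  have "d b = 0" if "b \<in> Sset a" for b
  proof (rule ccontr)
    assume "d b \<noteq> 0"
    define T where "T = {b \<in> Sset a. d b \<noteq> 0}"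
    have "finite T"
      using finite_Sset by (simp add: T_def)
    have "b \<in> T"
      using that \<open>d b \<noteq> 0\<close> unfolding T_def by blast
    with \<open>finite T\<close> have "finite T" "T \<noteq> {}"
      by auto
    then have "Max ((height \<circ> lead_pos) ` T) \<in> (height \<circ> lead_pos) ` T"
      by (intro Max_in) auto
    then obtain t where "t \<in> T" "Max ((height \<circ> lead_pos) ` T) = height (lead_pos t)"
      by auto
    then have t: "t \<in> T" "\<And>b. b \<in> T \<Longrightarrow> height (lead_pos b) \<le> height (lead_pos t)"
      using Max_ge[of "(height \<circ> lead_pos) ` T"] \<open>finite T\<close> by fastforce+
    define p where "p = lead_pos t"
    obtain r where r: "r \<noteq> 0" "leads_at p r (Epbw t)" "leads_at p (qpow (- Nf t) * r) (sigE t)"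
      using leads_at_E[of t] by (auto simp: p_def)
    \<comment> \<open>Terms of no greater height lead elsewhere, so they vanish at p and isolate the
      coefficient of t.\<close>
    have other: "value_at p (Epbw b) = 0" "value_at p (sigE b) = 0" if "b \<in> T" "b \<noteq> t" for b
    proof -
      have ne: "p \<noteq> lead_pos b"
        using lead_pos_inj[of a b t] that t(1) by (auto simp: p_def T_def Sset_def)
      obtain r' where r': "leads_at (lead_pos b) r' (Epbw b)" "leads_at (lead_pos b) (qpow (- Nf b) * r') (sigE b)"
        using leads_at_E[of b] by auto
      show "value_at p (Epbw b) = 0" "value_at p (sigE b) = 0"
        using leads_at_value(2)[OF r'(1) ne] leads_at_value(2)[OF r'(2) ne] t(2)[OF that(1)] by (simp_all add: p_def)
    qed
    have single: "(\<Sum>b\<in>Sset a. h b * f b) = h t * f t"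
      if "\<And>b. d b = 0 \<Longrightarrow> h b = 0" "\<And>b. b \<in> T \<Longrightarrow> b \<noteq> t \<Longrightarrow> f b = 0" for h f :: "nat4 \<Rightarrow> fq"
    proof -
      have "(\<Sum>b\<in>Sset a. h b * f b) = (\<Sum>b\<in>{t}. h b * f b)"
      proof (rule sum.mono_neutral_right)
        show "\<forall>b\<in>Sset a - {t}. h b * f b = 0"
        proof
          fix b assume b: "b \<in> Sset a - {t}"
          show "h b * f b = 0"
          proof (cases "d b = 0")
            case True
            then show ?thesis using that(1)[of b] by simp
          next
            case False
            then have "b \<in> T" using b by (simp add: T_def)
            then show ?thesis using that(2)[of b] b by simp
          qed
        qed
      qed (use finite_Sset t(1) in \<open>simp_all add: T_def\<close>)
      then show ?thesis by simp
    qed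
    have 1: "value_at p (X - X') = evq (d t) qq * r"
      unfolding D value_at_sum value_at_simps using other leads_at_value(1)[OF r(2)]
      by (subst single) (simp_all add: evq_0)
    have 2: "value_at p (sc (qpow (- Nf a)) * (X - X')) = evq (d t) (inverse qq) * (qpow (- Nf t) * r)"
      unfolding D' [symmetric] value_at_sum value_at_simps using other leads_at_value(1)[OF r(3)]
      by (subst single) (simp_all add: evq_0)
    have "Nf t = Nf a"
      using t(1) by (intro Nf_tri) (simp add: T_def Sset_def)
    with 1 2 have "evq (d t) (inverse qq) = evq (d t) qq"
      using r(1) qpow_nonzero by (simp add: value_at_simps)
    moreover have "coeff (d t) 0 = 0"
      using c(1) c'(1) t(1) by (simp add: d_def T_def)
    ultimately have "d t = 0"
      by (intro evq_bar_invariant)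
    then show False
      using t(1) by (simp add: T_def)
  qed
  then have "X - X' = 0"
    unfolding D by (simp add: evq_0 sc_0)
  then show ?thesis by simp
qed

section \<open>Identification of the dual canonical basis elements\<close>

context pbw
begin

text \<open>\<open>PA n\<close>, \<open>Ap n\<close>, \<open>AL n\<close>, \<open>AR n\<close>,
  \<open>ALp n\<close> and \<open>ARp n\<close> are B[n+1,0,1,n], B[n,1,0,n+1], B[n+1,0,0,n],
  B[n,0,0,n+1], B[n,1,0,n] and B[n,0,1,n]; the powers of q are those making the leading coefficients
  1.\<close>

definition PA :: "nat \<Rightarrow> 'a" where "PA n = S (3 * int n) (P * A n)"
definition Ap :: "nat \<Rightarrow> 'a" where "Ap n = S (3 * int n) (A n * p)"
definition AL :: "nat \<Rightarrow> 'a" where "AL n = S (int n * (2 * int n - 1)) (L n)"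
definition AR :: "nat \<Rightarrow> 'a" where "AR n = S (int n * (2 * int n - 1)) (R n)"
definition ALp :: "nat \<Rightarrow> 'a" where "ALp n = S (2 * int n * (int n - 1)) (Lp n)"
definition ARp :: "nat \<Rightarrow> 'a" where "ARp n = S (2 * int n * (int n - 1)) (Rp n)"

lemma AL_0: "AL 0 = x3" and AR_0: "AR 0 = x0"
  by (simp_all add: AL_def AR_def L_def R_def S_simps)

lemma AL_x3: "AL (Suc n) = S (int n + 1) (x3 * A (Suc n)) - S (2 * int n + 3) (x2 * PA n)"
  by (simp add: AL_def L_def A_def PA_def S_simps algebra_simps del: W.simps)

lemma AL_x3_right: "AL (Suc n) = S (3 * int n + 3) (A (Suc n) * x3) - S (2 * int n + 1) (PA n * x2)"
  by (simp add: AL_def L_mirror A_def PA_def S_simps algebra_simps del: W.simps)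

lemma AR_x0: "AR (Suc n) = S (int n + 1) (A (Suc n) * x0) - S (2 * int n + 3) (Ap n * x1)"
  by (simp add: AR_def R_def A_def Ap_def S_simps algebra_simps del: W.simps)

lemma AR_x0_left: "AR (Suc n) = S (3 * int n + 3) (x0 * A (Suc n)) - S (2 * int n + 1) (x1 * Ap n)"
  by (simp add: AR_def R_mirror A_def Ap_def S_simps algebra_simps del: W.simps)

lemma A_AL_x0: "A (Suc n) = S (int n) (AL n * x0) - S (2 * int n + 2) (ALp n * x1)"
proof -
  have "A (Suc n) = S (2 * int n * int n) (S (2 * int n) (W (Suc (Suc n))))"
    by (simp add: A_def S_simps algebra_simps del: W.simps)
  then show ?thesis
    unfolding W_L_x0 by (simp add: AL_def ALp_def S_simps algebra_simps)
qed

lemma A_x0_AL: "A (Suc n) = S (3 * int n + 2) (x0 * AL n) - S (2 * int n) (x1 * ALp n)"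
  unfolding A_def W_x0_L by (simp add: AL_def ALp_def S_simps algebra_simps)

lemma A_x3_AR: "A (Suc n) = S (int n) (x3 * AR n) - S (2 * int n + 2) (x2 * ARp n)"
proof -
  have "A (Suc n) = S (2 * int n * int n) (S (2 * int n) (W (Suc (Suc n))))"
    by (simp add: A_def S_simps algebra_simps del: W.simps)
  then show ?thesis
    unfolding W_x3_R by (simp add: AR_def ARp_def S_simps algebra_simps)
qed

lemma A_AR_x3: "A (Suc n) = S (3 * int n + 2) (AR n * x3) - S (2 * int n) (ARp n * x2)"
  unfolding A_def W_R_x3 by (simp add: AR_def ARp_def S_simps algebra_simps)

end

text \<open>Otherwise the simplifier turns \<open>u 1\<close> into \<open>u (Suc 0)\<close> inside the parameters of the interpretations.\<close>
declare One_nat_def [simp del]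

interpretation PR: pbw "\<lambda>k. Paired (sc (qpow k)) (sc (qpow (- k)))"
    "Paired (u 0) (u 0)" "Paired (u 1) (US.S 2 (u 1))" "Paired (u 2) (US.S 4 (u 2))" "Paired (u 3) (US.S 6 (u 3))"
  by (rule UP.pbw_paired)

lemma pfst_E: "pfst (PR.E b) = Epbw b"
  by (cases b) (simp, simp add: US_S mult.assoc)

lemma US_S_power: "US.S k x ^ n = US.S (k * int n) (x ^ n)"
  by (induction n) (simp_all add: US.S_simps algebra_simps)

lemma psnd_E: "psnd (PR.E b) = sigE b"
proof (cases b)
  case (fields b3 b2 b1 b0)
  have "psnd (PR.E b) = US.S (- bb b) (u 0 ^ b0 * (US.S (2 * int b1) (u 1 ^ b1) * (US.S (4 * int b2) (u 2 ^ b2) * US.S (6 * int b3) (u 3 ^ b3))))"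
    by (simp add: fields US_S_power)
  also have "\<dots> = US.S (- bb b + 2 * int b1 + 4 * int b2 + 6 * int b3) (u 0 ^ b0 * (u 1 ^ b1 * (u 2 ^ b2 * u 3 ^ b3)))"
    by (simp add: US.S_simps algebra_simps)
  finally show ?thesis
    by (simp add: fields US_S mult.assoc)
qed

lemma evq_minus: "evq (- p) x = - evq p x"
  using evq_diff[of 0 p x] by (simp add: evq_0)

text \<open>In the ring of pairs the scalar q^k acts by q^k on the first and by q^(-k) on the second
  component, so one integer polynomial, evaluated at q and at its inverse, describes both.\<close>

lemma lat_coefficients:
  assumes "y \<in> PR.lat 1 T" "finite T"
  shows "\<exists>c. (\<forall>b\<in>T. coeff (c b) 0 = 0) \<and> pfst y = (\<Sum>b\<in>T. sc (evq (c b) qq) * Epbw b)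
    \<and> psnd y = (\<Sum>b\<in>T. sc (evq (c b) (inverse qq)) * sigE b)"
  using assms(1)
proof (induction rule: PR.lat.induct)
  case zero
  show ?case
    by (intro exI[of _ "\<lambda>b. 0"]) (simp add: evq_0 sc_0)
next
  case (gen b k)
  define c where "c b' = (if b' = b then monom (1 :: int) (nat k) else 0)" for b'
  \<comment> \<open>Lattice level 1 gives k >= 1, so the monomial has no constant term.\<close>
  have k: "qpow k = qq ^ nat k" "qpow (- k) = inverse qq ^ nat k"
    using gen by (simp_all add: qpow_def power_int_def power_int_minus power_inverse)
  have "(\<Sum>b'\<in>T. sc (evq (c b') x) * f b') = sc (x ^ nat k) * f b" for x f
  proof -
    have "(\<Sum>b'\<in>T. sc (evq (c b') x) * f b') = (\<Sum>b'\<in>T. if b' = b then sc (x ^ nat k) * f b else 0)"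
      by (intro sum.cong) (simp_all add: c_def evq_monom evq_0 sc_0)
    then show ?thesis
      using gen(1) assms(2) by simp
  qed
  then show ?case
    using gen(2) by (intro exI[of _ c])
      (simp add: c_def pfst_E psnd_E k del: PR.E.simps Epbw.simps sigE.simps, simp add: US_S k)
next
  case (add y y')
  then obtain c c' where "\<forall>b\<in>T. coeff (c b) 0 = 0" "pfst y = (\<Sum>b\<in>T. sc (evq (c b) qq) * Epbw b)"
    "psnd y = (\<Sum>b\<in>T. sc (evq (c b) (inverse qq)) * sigE b)"
    "\<forall>b\<in>T. coeff (c' b) 0 = 0" "pfst y' = (\<Sum>b\<in>T. sc (evq (c' b) qq) * Epbw b)"
    "psnd y' = (\<Sum>b\<in>T. sc (evq (c' b) (inverse qq)) * sigE b)"
    by auto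
  then show ?case
    by (intro exI[of _ "\<lambda>b. c b + c' b"]) (simp add: evq_add sc_add distrib_right sum.distrib)
next
  case (minus y)
  then obtain c where "\<forall>b\<in>T. coeff (c b) 0 = 0" "pfst y = (\<Sum>b\<in>T. sc (evq (c b) qq) * Epbw b)"
    "psnd y = (\<Sum>b\<in>T. sc (evq (c b) (inverse qq)) * sigE b)"
    by auto
  then show ?case
    by (intro exI[of _ "\<lambda>b. - c b"]) (simp add: evq_minus sc_minus sum_negf)
qed

text \<open>The expansion of a pair in the lattice contains both defining conditions at once;
  \<open>is_dcb_unique\<close> then evaluates the definite description.\<close>

lemma B_eq:
  assumes "PR.leads (a3, a2, a1, a0) y" "psnd y = US.S (- Nf (a3, a2, a1, a0)) (pfst y)"
  shows "B (int a3, int a2, int a1, int a0) = pfst y"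
proof -
  let ?a = "(a3, a2, a1, a0)"
  obtain c where c: "\<forall>b\<in>Sset ?a. coeff (c b) 0 = 0"
    "pfst (y - PR.E ?a) = (\<Sum>b\<in>Sset ?a. sc (evq (c b) qq) * Epbw b)"
    "psnd (y - PR.E ?a) = (\<Sum>b\<in>Sset ?a. sc (evq (c b) (inverse qq)) * sigE b)"
    using lat_coefficients[OF _ finite_Sset] assms(1) unfolding PR.leads_def by blast
  have y: "pfst y = Epbw ?a + (\<Sum>b\<in>Sset ?a. sc (evq (c b) qq) * Epbw b)"
    "psnd y = sigE ?a + (\<Sum>b\<in>Sset ?a. sc (evq (c b) (inverse qq)) * sigE b)"
    using c(2,3) pfst_E[of ?a] psnd_E[of ?a] by (simp_all add: algebra_simps del: PR.E.simps Epbw.simps sigE.simps)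
  have "is_dcb ?a (pfst y)"
    unfolding is_dcb_def
    by (intro exI[of _ c] conjI c(1) y(1) HOL.trans [OF y(2) [symmetric]]) (simp only: assms(2) US_S)
  then have "(THE X. is_dcb ?a X) = pfst y"
    using is_dcb_unique by blast
  then show ?thesis
    by (simp add: B_def)
qed

lemma B_A: "B (int n, 0, 0, int n) = UP.A n"
  using B_eq[OF PR.leads_A[of n]] by (simp add: US.S_simps algebra_simps power2_eq_square)

lemma B_AL: "B (int n + 1, 0, 0, int n) = UP.AL n"
  using B_eq[OF PR.leads_L'[of n]] by (simp add: UP.AL_def US.S_simps algebra_simps power2_eq_square)

lemma B_AR: "B (int n, 0, 0, int n + 1) = UP.AR n"
  using B_eq[OF PR.leads_R'[of n]] by (simp add: UP.AR_def US.S_simps algebra_simps power2_eq_square)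

lemma B_PA: "B (int n + 1, 0, 1, int n) = UP.PA n"
proof -
  have "UP.A n * UP.P = US.S (- 2 * int n) (UP.P * UP.A n)"
    by (simp add: UP.A_def UP.P_W US.S_simps del: UP.W.simps)
  then show ?thesis
    using B_eq[OF PR.leads_PA[of n]] by (simp add: UP.PA_def US.S_simps algebra_simps power2_eq_square)
qed

lemma B_Ap: "B (int n, 1, 0, int n + 1) = UP.Ap n"
proof -
  have "UP.p * UP.A n = US.S (- 2 * int n) (UP.A n * UP.p)"
    by (simp add: UP.A_def UP.W_p US.S_simps del: UP.W.simps)
  then show ?thesis
    using B_eq[OF PR.leads_Ap[of n]] by (simp add: UP.Ap_def US.S_simps algebra_simps power2_eq_square)
qed

lemma B_ALp: "B (int n, 1, 0, int n) = UP.ALp n"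
  using B_eq[OF PR.leads_Lp[of n]] by (simp add: UP.ALp_def US.S_simps algebra_simps power2_eq_square)

lemma B_ARp: "B (int n, 0, 1, int n) = UP.ARp n"
  using B_eq[OF PR.leads_Rp'[of n]] by (simp add: UP.ARp_def US.S_simps algebra_simps power2_eq_square)

lemma B_negative: "a3 < 0 \<or> a2 < 0 \<or> a1 < 0 \<or> a0 < 0 \<Longrightarrow> B (a3, a2, a1, a0) = 0"
  by (simp add: B_def)

theorem mainTheorem2:
  fixes n :: nat
  assumes "n \<ge> 1"
  shows
   "B (int n, 0, 0, int n - 1) =
      sc (qpow (int n - 1)) * u 3 * B (int n - 1, 0, 0, int n - 1)
      - sc (qpow (2 * int n - 1)) * u 2 * B (int n - 1, 0, 1, int n - 2) \<and>
    B (int n, 0, 0, int n - 1) =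
      sc (qpow (3 * int n - 3)) * B (int n - 1, 0, 0, int n - 1) * u 3
      - sc (qpow (2 * int n - 3)) * B (int n - 1, 0, 1, int n - 2) * u 2 \<and>
    B (int n - 1, 0, 0, int n) =
      sc (qpow (int n - 1)) * B (int n - 1, 0, 0, int n - 1) * u 0
      - sc (qpow (2 * int n - 1)) * B (int n - 2, 1, 0, int n - 1) * u 1 \<and>
    B (int n - 1, 0, 0, int n) =
      sc (qpow (3 * int n - 3)) * u 0 * B (int n - 1, 0, 0, int n - 1)
      - sc (qpow (2 * int n - 3)) * u 1 * B (int n - 2, 1, 0, int n - 1) \<and>
    B (int n, 0, 0, int n) =
      sc (qpow (int n - 1)) * B (int n, 0, 0, int n - 1) * u 0
      - sc (qpow (2 * int n)) * B (int n - 1, 1, 0, int n - 1) * u 1 \<and>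
    B (int n, 0, 0, int n) =
      sc (qpow (3 * int n - 1)) * u 0 * B (int n, 0, 0, int n - 1)
      - sc (qpow (2 * int n - 2)) * u 1 * B (int n - 1, 1, 0, int n - 1) \<and>
    B (int n, 0, 0, int n) =
      sc (qpow (int n - 1)) * u 3 * B (int n - 1, 0, 0, int n)
      - sc (qpow (2 * int n)) * u 2 * B (int n - 1, 0, 1, int n - 1) \<and>
    B (int n, 0, 0, int n) =
      sc (qpow (3 * int n - 1)) * B (int n - 1, 0, 0, int n) * u 3
      - sc (qpow (2 * int n - 2)) * B (int n - 1, 0, 1, int n - 1) * u 2"
proof -
  obtain k where n: "n = Suc k"
    using assms by (cases n) auto
  have e1: "int n - 1 = int k" "int n - 2 = int k - 1" "2 * int n - 1 = 2 * int k + 1"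
    "3 * int n - 3 = 3 * int k" "2 * int n - 3 = 2 * int k - 1" "3 * int n - 1 = 3 * int k + 2" "2 * int n - 2 = 2 * int k"
    and e2: "2 * int n = 2 * int k + 2" and e3: "int n = int k + 1"
    by (simp_all add: n)
  have A: "B (int k + 1, 0, 0, int k + 1) = UP.A (Suc k)"
    using B_A[of "Suc k"] by (simp add: add.commute)
  have L: "UP.AL k = US.S (int k) (u 3 * UP.A k) - US.S (2 * int k + 1) (u 2 * B (int k, 0, 1, int k - 1))"
    "UP.AL k = US.S (3 * int k) (UP.A k * u 3) - US.S (2 * int k - 1) (B (int k, 0, 1, int k - 1) * u 2)"
    "UP.AR k = US.S (int k) (UP.A k * u 0) - US.S (2 * int k + 1) (B (int k - 1, 1, 0, int k) * u 1)"
    "UP.AR k = US.S (3 * int k) (u 0 * UP.A k) - US.S (2 * int k - 1) (u 1 * B (int k - 1, 1, 0, int k))"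
  proof -
    \<comment> \<open>For n = 1 the second terms have an entry -1 and vanish by convention, leaving
      u_3 and u_0. The recursions at k - 1 serve the case k > 0.\<close>
    have "B (int k, 0, 1, int k - 1) = 0" "B (int k - 1, 1, 0, int k) = 0" "UP.A k = 1" "UP.AL k = u 3" "UP.AR k = u 0"
      if "k = 0"
      using that by (simp_all add: B_negative UP.A_0 UP.AL_0 UP.AR_0)
    moreover have "B (int k, 0, 1, int k - 1) = UP.PA j" "B (int k - 1, 1, 0, int k) = UP.Ap j" if "k = Suc j" for j
      using that B_PA[of j] B_Ap[of j] by (simp_all add: add.commute)
    ultimately show "UP.AL k = US.S (int k) (u 3 * UP.A k) - US.S (2 * int k + 1) (u 2 * B (int k, 0, 1, int k - 1))"
      "UP.AL k = US.S (3 * int k) (UP.A k * u 3) - US.S (2 * int k - 1) (B (int k, 0, 1, int k - 1) * u 2)"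
      "UP.AR k = US.S (int k) (UP.A k * u 0) - US.S (2 * int k + 1) (B (int k - 1, 1, 0, int k) * u 1)"
      "UP.AR k = US.S (3 * int k) (u 0 * UP.A k) - US.S (2 * int k - 1) (u 1 * B (int k - 1, 1, 0, int k))"
      using UP.AL_x3[of "k - 1"] UP.AL_x3_right[of "k - 1"] UP.AR_x0[of "k - 1"] UP.AR_x0_left[of "k - 1"]
      by (cases k; simp add: US.S_simps algebra_simps)+
  qed
  show ?thesis
    \<comment> \<open>The composite exponents must be rewritten before \<open>int n\<close>, which
      occurs inside them.\<close>
    unfolding e1
    unfolding e2
    unfolding e3 B_AL B_AR B_ALp B_ARp B_A A mult.assoc
    unfolding US_S [symmetric]
    by (intro conjI L UP.A_AL_x0 UP.A_x0_AL UP.A_x3_AR UP.A_AR_x3)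
qed

end
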